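(* For each $\mu>0$ the mappings $V^\mu:\mathcal H_{1+2\beta}\to[0,+\infty)$ and $V_\mu:H^{1+2\beta}\to[0,+\infty)$ are well defined (i.e. finite-valued) and continuous. Moreover, for $(x,y),(x_n,y_n)\in\mathcal H_{1+2\beta}$, $n\in\mathbb N$, $$\lim_{n\to\infty}|(x,y)-(x_n,y_n)|_{\mathcal H_{1+2\beta}}=0\ \Longrightarrow\ \lim_{n\to\infty}\sup_{0<\mu<1}|V^\mu(x,y)-V^\mu(x_n,y_n)|=0,$$ and for $x,x_n\in H^{1+2\beta}$, $n\in\mathbb N$, $$\lim_{n\to\infty}|x-x_n|_{H^{1+2\beta}}=0\ \Longrightarrow\ \lim_{n\to\infty}\sup_{0<\mu<1}|V_\mu(x)-V_\mu(x_n)|=0.$$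
   Context: Spaces. Let $d\ge 1$, let $D\subset\mathbb R^d$ be a bounded regular open domain, $H=L^2(D)$, and let $A$ be the realization in $H$ of the Laplacian with Dirichlet boundary conditions. Let $\{e_k\}$ be a complete orthonormal basis of $H$ with $Ae_k=-\alpha_ke_k$, $0<\alpha_1\le\alpha_k\le\alpha_{k+1}$; $D$ is regular enough that $\alpha_k\sim k^{2/d}$. For $\delta\in\mathbb R$, $H^\delta$ is the Hilbert space obtained by completing $\mathrm{span}\{e_k\}$ in the norm $|x|_{H^\delta}^2=\sum_k\alpha_k^\delta\langle x,e_k\rangle_H^2$ (so $H^0=H$). Set $\mathcal H_\delta=H^\delta\times H^{\delta-1}$ with $|(u,v)|^2_{\mathcal H_\delta}=|u|^2_{H^\delta}+|v|^2_{H^{\delta-1}}$ and $\mathcal H=\mathcal H_0$. Assumptions. $Q$ is a bounded linear operator on $H$ with $Qe_k=\lambda_ke_k$ and $\frac1c\alpha_k^{-\beta}\le\lambda_k\le c\,\alpha_k^{-\beta}$ for all $k$, for some $c>0$ and $\beta>(d-2)/4$. For every $\delta\in[0,1+2\beta]$ the map $B:H^\delta\to H^\delta$ is Lipschitz with Lipschitz constant $\gamma_\delta<\alpha_1$; $B(0)=0$; $B$ is differentiable in $H^{2\beta}$ with $\sup_{x\in H^{2\beta}}\|DB(x)\|_{\mathcal L(H^{2\beta})}=\gamma_{2\beta}$. Operators. For $\mu>0$, $S_\mu(t)$, $t\ge0$, is the semigroup on $\mathcal H_\delta$ generated by $A_\mu(u,v)=\left(v,\frac1\mu Au-\frac1\mu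 v\right)$, $D(A_\mu)=\mathcal H_{1+\delta}$. Put $B_\mu(u,v)=\frac1\mu(0,B(u))$ and $Q_\mu u=\frac1\mu(0,Qu)$. Action functional and quasi-potential. For $t_1<t_2$ and $z\in C([t_1,t_2];\mathcal H)$, $I^\mu_{t_1,t_2}(z)=\frac12\inf|\psi|^2_{L^2((t_1,t_2);H)}$, the infimum over all $\psi\in L^2((t_1,t_2);H)$ with $z(t)=S_\mu(t-t_1)z(t_1)+\int_{t_1}^tS_\mu(t-s)B_\mu(z(s))ds+\int_{t_1}^tS_\mu(t-s)Q_\mu\psi(s)ds$ for $t\in[t_1,t_2]$ ($\inf\emptyset=+\infty$). For $(x,y)\in\mathcal H$, $V^\mu(x,y)=\inf\{I^\mu_{0,T}(z): T>0,\ z\in C([0,T];\mathcal H),\ z(0)=0,\ z(T)=(x,y)\}$, and for $x\in H$, $V_\mu(x)=\inf_{y\in H^{-1}}V^\mu(x,y)$. *)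

theory Defs
  imports
    "HOL-Analysis.Analysis"
    "HOL-Library.Function_Algebras"
    "HOL-Library.Landau_Symbols"
begin

section \<open>The space of square-integrable functions and the Dirichlet Laplacian on a domain\<close>

text \<open>Elements of \<open>L\<^sup>2(D)\<close> are represented by functions on the whole space, of which only the
  values on \<open>D\<close>, up to null sets, matter.\<close>

definition L2 :: "(real^'d) set \<Rightarrow> (real^'d \<Rightarrow> real) set" where
  "L2 D = {f. f \<in> borel_measurable (lebesgue_on D) \<and> integrable (lebesgue_on D) (\<lambda>x. (f x)\<^sup>2)}"

definition L2_inner :: "(real^'d) set \<Rightarrow> (real^'d \<Rightarrow> real) \<Rightarrow> (real^'d \<Rightarrow> real) \<Rightarrow> real" where
  "L2_inner D f g = (LINT x|lebesgue_on D. f x * g x)"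

text \<open>A function is smooth if all its iterated partial derivatives exist and are continuous;
  \<open>F [i\<^sub>1, \<dots>, i\<^sub>m]\<close> is the derivative in the directions \<open>i\<^sub>m, \<dots>, i\<^sub>1\<close>.\<close>

definition smooth :: "(real^'d \<Rightarrow> real) \<Rightarrow> bool" where
  "smooth f \<longleftrightarrow> (\<exists>F :: 'd list \<Rightarrow> real^'d \<Rightarrow> real. F [] = f \<and>
     (\<forall>is. continuous_on UNIV (F is) \<and>
       (\<forall>i x. ((\<lambda>t. F is (x + t *\<^sub>R axis i 1)) has_real_derivative F (i # is) x) (at 0))))"

definition test_functions :: "(real^'d) set \<Rightarrow> (real^'d \<Rightarrow> real) set" where
  "test_functions D = {\<phi>. smooth \<phi> \<and> (\<exists>K. compact K \<and> K \<subseteq> D \<and> (\<forall>x. x \<notin> K \<longrightarrow> \<phi> x = 0))}"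

definition grad :: "(real^'d \<Rightarrow> real) \<Rightarrow> real^'d \<Rightarrow> real^'d" where
  "grad \<phi> x = (\<chi> i. deriv (\<lambda>t. \<phi> (x + t *\<^sub>R axis i 1)) 0)"

text \<open>\<open>u\<close> lies in \<open>H\<^sup>1\<^sub>0(D)\<close>, the closure of the test functions in \<open>H\<^sup>1(D)\<close>, and has weak
  gradient \<open>g\<close>.\<close>

definition H10_with_grad :: "(real^'d) set \<Rightarrow> (real^'d \<Rightarrow> real) \<Rightarrow> (real^'d \<Rightarrow> real^'d) \<Rightarrow> bool" where
  "H10_with_grad D u g \<longleftrightarrow> u \<in> L2 D \<and> (\<forall>i. (\<lambda>x. g x $ i) \<in> L2 D) \<and>
     (\<exists>\<phi> :: nat \<Rightarrow> real^'d \<Rightarrow> real. (\<forall>n. \<phi> n \<in> test_functions D) \<and>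
        (\<lambda>n. LINT x|lebesgue_on D. (\<phi> n x - u x)\<^sup>2) \<longlonglongrightarrow> 0 \<and>
        (\<lambda>n. LINT x|lebesgue_on D. (norm (grad (\<phi> n) x - g x))\<^sup>2) \<longlonglongrightarrow> 0)"

text \<open>The graph of the realization \<open>A\<close> in \<open>L\<^sup>2(D)\<close> of the Laplacian with Dirichlet boundary
  conditions: \<open>u\<close> is in the domain of \<open>A\<close> and \<open>A u = f\<close>.\<close>

definition dirichlet_laplacian ::
    "(real^'d) set \<Rightarrow> (real^'d \<Rightarrow> real) \<Rightarrow> (real^'d \<Rightarrow> real) \<Rightarrow> bool" where
  "dirichlet_laplacian D u f \<longleftrightarrow> f \<in> L2 D \<and>
     (\<exists>g. H10_with_grad D u g \<and>
        (\<forall>\<phi>\<in>test_functions D.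
           (LINT x|lebesgue_on D. g x \<bullet> grad \<phi> x) = - L2_inner D f \<phi>))"

definition complete_orthonormal_basis ::
    "(real^'d) set \<Rightarrow> (nat \<Rightarrow> real^'d \<Rightarrow> real) \<Rightarrow> bool" where
  "complete_orthonormal_basis D e \<longleftrightarrow>
     (\<forall>k. e k \<in> L2 D) \<and>
     (\<forall>j k. L2_inner D (e j) (e k) = (if j = k then 1 else 0)) \<and>
     (\<forall>f\<in>L2 D. (\<lambda>n. LINT x|lebesgue_on D. (f x - (\<Sum>k<n. L2_inner D f (e k) * e k x))\<^sup>2)
        \<longlonglongrightarrow> 0)"


section \<open>The scale of Hilbert spaces\<close>

text \<open>The completion \<open>H\<^sup>\<delta>\<close> of the span of the \<open>e\<^sub>k\<close> is realized, for all real \<open>\<delta>\<close> simultaneously,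
  as a space of coefficient sequences \<open>(\<langle>x, e\<^sub>k\<rangle>)\<^sub>k\<close>: a finite linear combination of
  the \<open>e\<^sub>k\<close> is identified with its finitely supported sequence of coefficients, and a function
  \<open>f \<in> L\<^sup>2(D)\<close> with \<open>L2_coeffs D e f\<close>.  Under the latter map \<open>H\<^sup>0 = L\<^sup>2(D)\<close>
  isometrically: see \<open>L2_coeffs_isometry\<close> and \<open>L2_coeffs_surj\<close> below.  Indices start at \<open>0\<close>.\<close>

type_synonym coeffs = "nat \<Rightarrow> real"
type_synonym phase = "coeffs \<times> coeffs"

definition L2_coeffs :: "(real^'d) set \<Rightarrow> (nat \<Rightarrow> real^'d \<Rightarrow> real) \<Rightarrow> (real^'d \<Rightarrow> real) \<Rightarrow> coeffs" where
  "L2_coeffs D e f = (\<lambda>k. L2_inner D f (e k))"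

definition scl :: "real \<Rightarrow> coeffs \<Rightarrow> coeffs" where
  "scl a x = (\<lambda>k. a * x k)"

definition unit_coeffs :: "nat \<Rightarrow> coeffs" where
  "unit_coeffs k = (\<lambda>j. if j = k then 1 else 0)"

definition hs :: "(nat \<Rightarrow> real) \<Rightarrow> real \<Rightarrow> coeffs set" where
  "hs \<alpha> \<delta> = {x. (\<lambda>k. \<alpha> k powr \<delta> * (x k)\<^sup>2) summable_on UNIV}"

definition hs_norm :: "(nat \<Rightarrow> real) \<Rightarrow> real \<Rightarrow> coeffs \<Rightarrow> real" where
  "hs_norm \<alpha> \<delta> x = sqrt (\<Sum>\<^sub>\<infinity>k. \<alpha> k powr \<delta> * (x k)\<^sup>2)"

definition hs_topology :: "(nat \<Rightarrow> real) \<Rightarrow> real \<Rightarrow> coeffs topology" where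
  "hs_topology \<alpha> \<delta> = Metric_space.mtopology (hs \<alpha> \<delta>) (\<lambda>x y. hs_norm \<alpha> \<delta> (x - y))"

definition ph :: "(nat \<Rightarrow> real) \<Rightarrow> real \<Rightarrow> phase set" where
  "ph \<alpha> \<delta> = hs \<alpha> \<delta> \<times> hs \<alpha> (\<delta> - 1)"

definition ph_norm :: "(nat \<Rightarrow> real) \<Rightarrow> real \<Rightarrow> phase \<Rightarrow> real" where
  "ph_norm \<alpha> \<delta> z = sqrt ((hs_norm \<alpha> \<delta> (fst z))\<^sup>2 + (hs_norm \<alpha> (\<delta> - 1) (snd z))\<^sup>2)"

definition ph_topology :: "(nat \<Rightarrow> real) \<Rightarrow> real \<Rightarrow> phase topology" where
  "ph_topology \<alpha> \<delta> = Metric_space.mtopology (ph \<alpha> \<delta>) (\<lambda>z w. ph_norm \<alpha> \<delta> (z - w))"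

definition ph_scl :: "real \<Rightarrow> phase \<Rightarrow> phase" where
  "ph_scl a z = (scl a (fst z), scl a (snd z))"

lemma hs_norm_nonneg: "0 \<le> hs_norm \<alpha> \<delta> x"
  unfolding hs_norm_def by (intro real_sqrt_ge_zero infsum_nonneg) auto

lemma hs_diff:
  assumes "x \<in> hs \<alpha> \<delta>" "y \<in> hs \<alpha> \<delta>"
  shows "x - y \<in> hs \<alpha> \<delta>"
proof -
  have "(\<lambda>k. 2 * (\<alpha> k powr \<delta> * (x k)\<^sup>2) + 2 * (\<alpha> k powr \<delta> * (y k)\<^sup>2)) summable_on UNIV"
    using assms unfolding hs_def by (intro summable_on_add summable_on_cmult_right) auto
  moreover have "\<alpha> k powr \<delta> * ((x - y) k)\<^sup>2 \<le>
      2 * (\<alpha> k powr \<delta> * (x k)\<^sup>2) + 2 * (\<alpha> k powr \<delta> * (y k)\<^sup>2)" for k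
  proof -
    have "((x - y) k)\<^sup>2 \<le> 2 * (x k)\<^sup>2 + 2 * (y k)\<^sup>2"
      using zero_le_power2[of "x k + y k"] by (simp add: power2_eq_square algebra_simps)
    from mult_left_mono[OF this, of "\<alpha> k powr \<delta>"] show ?thesis
      by (simp add: algebra_simps)
  qed
  ultimately show ?thesis
    unfolding hs_def by (auto intro: summable_on_comparison_test)
qed

lemma hs_norm_triangle:
  assumes "x \<in> hs \<alpha> \<delta>" "y \<in> hs \<alpha> \<delta>" "x + y \<in> hs \<alpha> \<delta>"
  shows "hs_norm \<alpha> \<delta> (x + y) \<le> hs_norm \<alpha> \<delta> x + hs_norm \<alpha> \<delta> y"
proof -
  define w where "w x k = sqrt (\<alpha> k powr \<delta>) * x k" for x :: coeffs and k
  have w2: "(w x k)\<^sup>2 = \<alpha> k powr \<delta> * (x k)\<^sup>2" for x k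
    by (simp add: w_def power_mult_distrib)
  have le: "L2_set (w x) F \<le> hs_norm \<alpha> \<delta> x" if "x \<in> hs \<alpha> \<delta>" "finite F" for x F
    unfolding L2_set_def hs_norm_def w2 real_sqrt_le_iff
    using that by (intro finite_sum_le_infsum) (auto simp: hs_def)
  have "(\<Sum>\<^sub>\<infinity>k. \<alpha> k powr \<delta> * ((x + y) k)\<^sup>2) \<le> (hs_norm \<alpha> \<delta> x + hs_norm \<alpha> \<delta> y)\<^sup>2"
  proof (rule infsum_le_finite_sums)
    show "(\<lambda>k. \<alpha> k powr \<delta> * ((x + y) k)\<^sup>2) summable_on UNIV"
      using assms(3) by (simp add: hs_def)
    fix F :: "nat set" assume "finite F"
    have "\<alpha> k powr \<delta> * ((x + y) k)\<^sup>2 = (w x k + w y k)\<^sup>2" for k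
      using w2[of "x + y" k] by (simp add: w_def distrib_left)
    then have "(\<Sum>k\<in>F. \<alpha> k powr \<delta> * ((x + y) k)\<^sup>2) = (L2_set (\<lambda>k. w x k + w y k) F)\<^sup>2"
      unfolding L2_set_def by (simp only: real_sqrt_pow2 sum_nonneg zero_le_power2)
    also have "\<dots> \<le> (hs_norm \<alpha> \<delta> x + hs_norm \<alpha> \<delta> y)\<^sup>2"
      using L2_set_triangle_ineq[of "w x" "w y" F] le[OF assms(1) \<open>finite F\<close>]
        le[OF assms(2) \<open>finite F\<close>] by (intro power_mono) (auto simp: L2_set_nonneg)
    finally show "(\<Sum>k\<in>F. \<alpha> k powr \<delta> * ((x + y) k)\<^sup>2) \<le> \<dots>" .
  qed
  then show ?thesis
    unfolding hs_norm_def[of _ _ "x + y"] by (simp add: hs_norm_nonneg real_le_lsqrt infsum_nonneg)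
qed

lemma Metric_space_hs:
  assumes "\<And>k. 0 < \<alpha> k"
  shows "Metric_space (hs \<alpha> \<delta>) (\<lambda>x y. hs_norm \<alpha> \<delta> (x - y))"
proof
  show "0 \<le> hs_norm \<alpha> \<delta> (x - y)" for x y
    by (rule hs_norm_nonneg)
  show "hs_norm \<alpha> \<delta> (x - y) = hs_norm \<alpha> \<delta> (y - x)" for x y
    by (simp add: hs_norm_def power2_commute)
  fix x y assume x: "x \<in> hs \<alpha> \<delta>" and y: "y \<in> hs \<alpha> \<delta>"
  show "hs_norm \<alpha> \<delta> (x - y) = 0 \<longleftrightarrow> x = y"
  proof
    assume 0: "hs_norm \<alpha> \<delta> (x - y) = 0"
    have "\<alpha> k powr \<delta> * ((x - y) k)\<^sup>2 = 0" for k
      by (rule nonneg_infsum_le_0D[where A = UNIV])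
        (use 0 hs_diff[OF x y] in \<open>auto simp: hs_norm_def hs_def\<close>)
    then show "x = y" using assms by (auto simp: fun_eq_iff less_imp_neq[symmetric])
  qed (simp add: hs_norm_def)
  fix z assume z: "z \<in> hs \<alpha> \<delta>"
  show "hs_norm \<alpha> \<delta> (x - z) \<le> hs_norm \<alpha> \<delta> (x - y) + hs_norm \<alpha> \<delta> (y - z)"
    using hs_norm_triangle[OF hs_diff[OF x y] hs_diff[OF y z]] hs_diff[OF x z] by simp
qed

lemma Metric_space_ph:
  assumes "\<And>k. 0 < \<alpha> k"
  shows "Metric_space (ph \<alpha> \<delta>) (\<lambda>z w. ph_norm \<alpha> \<delta> (z - w))"
proof -
  have "Metric_space12 (hs \<alpha> \<delta>) (\<lambda>x y. hs_norm \<alpha> \<delta> (x - y))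
          (hs \<alpha> (\<delta> - 1)) (\<lambda>x y. hs_norm \<alpha> (\<delta> - 1) (x - y))"
    using assms by (simp add: Metric_space12_def Metric_space_hs)
  from Metric_space12.prod_metric[OF this] show ?thesis
    by (simp add: ph_def ph_norm_def prod_dist_def case_prod_unfold)
qed


section \<open>Maps between the spaces\<close>

definition hs_bounded_linear :: "(nat \<Rightarrow> real) \<Rightarrow> real \<Rightarrow> (coeffs \<Rightarrow> coeffs) \<Rightarrow> bool" where
  "hs_bounded_linear \<alpha> \<delta> L \<longleftrightarrow> L \<in> hs \<alpha> \<delta> \<rightarrow> hs \<alpha> \<delta> \<and>
     (\<forall>x\<in>hs \<alpha> \<delta>. \<forall>y\<in>hs \<alpha> \<delta>. L (x + y) = L x + L y) \<and>
     (\<forall>a. \<forall>x\<in>hs \<alpha> \<delta>. L (scl a x) = scl a (L x)) \<and>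
     (\<exists>C. \<forall>x\<in>hs \<alpha> \<delta>. hs_norm \<alpha> \<delta> (L x) \<le> C * hs_norm \<alpha> \<delta> x)"

definition hs_opnorm :: "(nat \<Rightarrow> real) \<Rightarrow> real \<Rightarrow> (coeffs \<Rightarrow> coeffs) \<Rightarrow> real" where
  "hs_opnorm \<alpha> \<delta> L = Sup {hs_norm \<alpha> \<delta> (L x) | x. x \<in> hs \<alpha> \<delta> \<and> hs_norm \<alpha> \<delta> x \<le> 1}"

definition hs_lipschitz :: "(nat \<Rightarrow> real) \<Rightarrow> real \<Rightarrow> real \<Rightarrow> (coeffs \<Rightarrow> coeffs) \<Rightarrow> bool" where
  "hs_lipschitz \<alpha> \<delta> C F \<longleftrightarrow> 0 \<le> C \<and> F \<in> hs \<alpha> \<delta> \<rightarrow> hs \<alpha> \<delta> \<and>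
     (\<forall>x\<in>hs \<alpha> \<delta>. \<forall>y\<in>hs \<alpha> \<delta>. hs_norm \<alpha> \<delta> (F x - F y) \<le> C * hs_norm \<alpha> \<delta> (x - y))"

text \<open>Frechet differentiability at \<open>x\<close> of a map \<open>F\<close> from \<open>H\<^sup>\<delta>\<close> to itself.\<close>

definition hs_has_derivative ::
    "(nat \<Rightarrow> real) \<Rightarrow> real \<Rightarrow> (coeffs \<Rightarrow> coeffs) \<Rightarrow> (coeffs \<Rightarrow> coeffs) \<Rightarrow> coeffs \<Rightarrow> bool" where
  "hs_has_derivative \<alpha> \<delta> F L x \<longleftrightarrow> hs_bounded_linear \<alpha> \<delta> L \<and>
     (\<forall>\<epsilon>>0. \<exists>\<eta>>0. \<forall>h\<in>hs \<alpha> \<delta>. hs_norm \<alpha> \<delta> h < \<eta> \<longrightarrow>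
        hs_norm \<alpha> \<delta> (F (x + h) - F x - L h) \<le> \<epsilon> * hs_norm \<alpha> \<delta> h)"

text \<open>\<open>S\<close> is a strongly continuous semigroup of bounded linear operators on \<open>H\<^sup>\<delta> \<times> H\<^sup>\<delta>\<^sup>-\<^sup>1\<close> whose
  infinitesimal generator is the operator \<open>G\<close> with domain exactly \<open>Dom\<close>.\<close>

definition ph_semigroup_generated_by ::
    "(nat \<Rightarrow> real) \<Rightarrow> real \<Rightarrow> phase set \<Rightarrow> (phase \<Rightarrow> phase) \<Rightarrow> (real \<Rightarrow> phase \<Rightarrow> phase) \<Rightarrow> bool" where
  "ph_semigroup_generated_by \<alpha> \<delta> Dom G S \<longleftrightarrow>
     (\<forall>t\<ge>0. S t \<in> ph \<alpha> \<delta> \<rightarrow> ph \<alpha> \<delta> \<and>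
        (\<forall>z\<in>ph \<alpha> \<delta>. \<forall>w\<in>ph \<alpha> \<delta>. S t (z + w) = S t z + S t w) \<and>
        (\<forall>a. \<forall>z\<in>ph \<alpha> \<delta>. S t (ph_scl a z) = ph_scl a (S t z)) \<and>
        (\<exists>C. \<forall>z\<in>ph \<alpha> \<delta>. ph_norm \<alpha> \<delta> (S t z) \<le> C * ph_norm \<alpha> \<delta> z)) \<and>
     (\<forall>z\<in>ph \<alpha> \<delta>. S 0 z = z) \<and>
     (\<forall>s\<ge>0. \<forall>t\<ge>0. \<forall>z\<in>ph \<alpha> \<delta>. S (s + t) z = S s (S t z)) \<and>
     (\<forall>z\<in>ph \<alpha> \<delta>. ((\<lambda>t. ph_norm \<alpha> \<delta> (S t z - z)) \<longlongrightarrow> 0) (at_right 0)) \<and>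
     Dom \<subseteq> ph \<alpha> \<delta> \<and>
     (\<forall>z\<in>ph \<alpha> \<delta>. \<forall>w\<in>ph \<alpha> \<delta>. (z \<in> Dom \<and> G z = w) \<longleftrightarrow>
        ((\<lambda>t. ph_norm \<alpha> \<delta> (ph_scl (1 / t) (S t z - z) - w)) \<longlongrightarrow> 0) (at_right 0))"

text \<open>The extension of the Dirichlet Laplacian \<open>A\<close> to the scale.\<close>

definition lap :: "(nat \<Rightarrow> real) \<Rightarrow> coeffs \<Rightarrow> coeffs" where
  "lap \<alpha> u = (\<lambda>k. - \<alpha> k * u k)"

definition A_mu :: "(nat \<Rightarrow> real) \<Rightarrow> real \<Rightarrow> phase \<Rightarrow> phase" where
  "A_mu \<alpha> \<mu> z = (snd z, scl (1 / \<mu>) (lap \<alpha> (fst z)) - scl (1 / \<mu>) (snd z))"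

definition B_mu :: "(coeffs \<Rightarrow> coeffs) \<Rightarrow> real \<Rightarrow> phase \<Rightarrow> phase" where
  "B_mu B \<mu> z = (0, scl (1 / \<mu>) (B (fst z)))"

definition Q_mu :: "(coeffs \<Rightarrow> coeffs) \<Rightarrow> real \<Rightarrow> coeffs \<Rightarrow> phase" where
  "Q_mu Q \<mu> u = (0, scl (1 / \<mu>) (Q u))"


section \<open>The action functional and the quasi-potential\<close>

text \<open>The Bochner integral in \<open>H\<^sup>\<delta> \<times> H\<^sup>\<delta>\<^sup>-\<^sup>1\<close>, computed coordinatewise (the coordinates are continuous
  linear functionals and separate points).  It is only used in the mild formulation below,
  where Bochner integrability is automatic: \<open>z\<close> is continuous and \<open>\<psi>\<close> is square integrable.\<close>

definition ph_integral :: "real \<Rightarrow> real \<Rightarrow> (real \<Rightarrow> phase) \<Rightarrow> phase" where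
  "ph_integral a b F =
     ((\<lambda>k. LINT s|lebesgue_on {a..b}. fst (F s) k), (\<lambda>k. LINT s|lebesgue_on {a..b}. snd (F s) k))"

text \<open>\<open>L\<^sup>2((t\<^sub>1,t\<^sub>2);H)\<close>; as \<open>H\<close> is separable, measurability can be tested on the coordinates.\<close>

definition L2_time :: "(nat \<Rightarrow> real) \<Rightarrow> real \<Rightarrow> real \<Rightarrow> (real \<Rightarrow> coeffs) set" where
  "L2_time \<alpha> t1 t2 = {\<psi>. (\<forall>s\<in>{t1<..<t2}. \<psi> s \<in> hs \<alpha> 0) \<and>
     (\<forall>k. (\<lambda>s. \<psi> s k) \<in> borel_measurable (lebesgue_on {t1<..<t2})) \<and>
     integrable (lebesgue_on {t1<..<t2}) (\<lambda>s. (hs_norm \<alpha> 0 (\<psi> s))\<^sup>2)}"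

definition L2_time_norm :: "(nat \<Rightarrow> real) \<Rightarrow> real \<Rightarrow> real \<Rightarrow> (real \<Rightarrow> coeffs) \<Rightarrow> real" where
  "L2_time_norm \<alpha> t1 t2 \<psi> = sqrt (LINT s|lebesgue_on {t1<..<t2}. (hs_norm \<alpha> 0 (\<psi> s))\<^sup>2)"

definition paths :: "(nat \<Rightarrow> real) \<Rightarrow> real \<Rightarrow> real \<Rightarrow> (real \<Rightarrow> phase) set" where
  "paths \<alpha> t1 t2 = {z. continuous_map (top_of_set {t1..t2}) (ph_topology \<alpha> 0) z}"

text \<open>In the following definitions, \<open>S\<close> is the semigroup generated by \<open>A_mu \<alpha> \<mu>\<close>.\<close>

definition mild_solution ::
    "(real \<Rightarrow> phase \<Rightarrow> phase) \<Rightarrow> (coeffs \<Rightarrow> coeffs) \<Rightarrow> (coeffs \<Rightarrow> coeffs) \<Rightarrow> real \<Rightarrow>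
     real \<Rightarrow> real \<Rightarrow> (real \<Rightarrow> coeffs) \<Rightarrow> (real \<Rightarrow> phase) \<Rightarrow> bool" where
  "mild_solution S B Q \<mu> t1 t2 \<psi> z \<longleftrightarrow> (\<forall>t\<in>{t1..t2}.
     z t = S (t - t1) (z t1) + ph_integral t1 t (\<lambda>s. S (t - s) (B_mu B \<mu> (z s)))
                             + ph_integral t1 t (\<lambda>s. S (t - s) (Q_mu Q \<mu> (\<psi> s))))"

definition action ::
    "(nat \<Rightarrow> real) \<Rightarrow> (real \<Rightarrow> phase \<Rightarrow> phase) \<Rightarrow> (coeffs \<Rightarrow> coeffs) \<Rightarrow> (coeffs \<Rightarrow> coeffs) \<Rightarrow> real \<Rightarrow>
     real \<Rightarrow> real \<Rightarrow> (real \<Rightarrow> phase) \<Rightarrow> ereal" where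
  "action \<alpha> S B Q \<mu> t1 t2 z =
     Inf {ereal (1 / 2 * (L2_time_norm \<alpha> t1 t2 \<psi>)\<^sup>2) | \<psi>.
            \<psi> \<in> L2_time \<alpha> t1 t2 \<and> mild_solution S B Q \<mu> t1 t2 \<psi> z}"

definition quasi_potential ::
    "(nat \<Rightarrow> real) \<Rightarrow> (real \<Rightarrow> phase \<Rightarrow> phase) \<Rightarrow> (coeffs \<Rightarrow> coeffs) \<Rightarrow> (coeffs \<Rightarrow> coeffs) \<Rightarrow> real \<Rightarrow>
     phase \<Rightarrow> ereal" where
  "quasi_potential \<alpha> S B Q \<mu> p =
     Inf {action \<alpha> S B Q \<mu> 0 T z | T z. T > 0 \<and> z \<in> paths \<alpha> 0 T \<and> z 0 = 0 \<and> z T = p}"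

definition quasi_potential_pos ::
    "(nat \<Rightarrow> real) \<Rightarrow> (real \<Rightarrow> phase \<Rightarrow> phase) \<Rightarrow> (coeffs \<Rightarrow> coeffs) \<Rightarrow> (coeffs \<Rightarrow> coeffs) \<Rightarrow> real \<Rightarrow>
     coeffs \<Rightarrow> ereal" where
  "quasi_potential_pos \<alpha> S B Q \<mu> x = (INF y\<in>hs \<alpha> (-1). quasi_potential \<alpha> S B Q \<mu> (x, y))"


section \<open>The identification of \<open>H\<^sup>0\<close> with \<open>L\<^sup>2(D)\<close>\<close>

lemma L2_mult_integrable:
  assumes "f \<in> L2 D" "g \<in> L2 D"
  shows "integrable (lebesgue_on D) (\<lambda>x. f x * g x)"
proof (rule Bochner_Integration.integrable_bound)
  show "integrable (lebesgue_on D) (\<lambda>x. (f x)\<^sup>2 + (g x)\<^sup>2)"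
    using assms by (auto simp: L2_def)
  show "(\<lambda>x. f x * g x) \<in> borel_measurable (lebesgue_on D)"
    using assms by (auto simp: L2_def)
  have "\<bar>a * b\<bar> \<le> a\<^sup>2 + b\<^sup>2" for a b :: real
  proof -
    have "2 * (\<bar>a\<bar> * \<bar>b\<bar>) \<le> a\<^sup>2 + b\<^sup>2"
      using sum_squares_bound[of "\<bar>a\<bar>" "\<bar>b\<bar>"] by simp
    moreover have "0 \<le> \<bar>a\<bar> * \<bar>b\<bar>" by simp
    ultimately show ?thesis unfolding abs_mult by linarith
  qed
  then show "AE x in lebesgue_on D. norm (f x * g x) \<le> norm ((f x)\<^sup>2 + (g x)\<^sup>2)"
    by simp
qed

lemma L2_add: "f \<in> L2 D \<Longrightarrow> g \<in> L2 D \<Longrightarrow> (\<lambda>x. f x + g x) \<in> L2 D"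
  using L2_mult_integrable[of f D g] by (auto simp: L2_def power2_sum mult.assoc)

lemma L2_cmult: "f \<in> L2 D \<Longrightarrow> (\<lambda>x. a * f x) \<in> L2 D"
  by (auto simp: L2_def power_mult_distrib)

lemma L2_diff: "f \<in> L2 D \<Longrightarrow> g \<in> L2 D \<Longrightarrow> (\<lambda>x. f x - g x) \<in> L2 D"
  using L2_add[of f D "\<lambda>x. -1 * g x"] L2_cmult[of g D "-1"] by simp

lemma L2_sum: "(\<And>k. k \<in> F \<Longrightarrow> e k \<in> L2 D) \<Longrightarrow> (\<lambda>x. \<Sum>k\<in>F. a k * e k x) \<in> L2 D"
proof (induction F rule: infinite_finite_induct)
  case (insert k F)
  then show ?case using L2_add[OF L2_cmult[of "e k" D "a k"]] by simp
qed (auto simp: L2_def)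

lemma L2_inner_diff_sum:
  assumes "f \<in> L2 D" "g \<in> L2 D" "\<And>k. e k \<in> L2 D" "finite F"
  shows "L2_inner D (\<lambda>x. f x - (\<Sum>k\<in>F. a k * e k x)) g =
    L2_inner D f g - (\<Sum>k\<in>F. a k * L2_inner D (e k) g)"
proof -
  have *: "integrable (lebesgue_on D) (\<lambda>x. e k x * g x)" for k
    using assms by (intro L2_mult_integrable)
  have "L2_inner D (\<lambda>x. f x - (\<Sum>k\<in>F. a k * e k x)) g =
      (LINT x|lebesgue_on D. f x * g x - (\<Sum>k\<in>F. a k * (e k x * g x)))"
    unfolding L2_inner_def by (simp add: algebra_simps sum_distrib_left)
  also have "\<dots> = L2_inner D f g - (\<Sum>k\<in>F. a k * L2_inner D (e k) g)"
    using assms * by (simp add: L2_inner_def L2_mult_integrable)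
  finally show ?thesis .
qed

lemma L2_norm_diff_sum:
  assumes f: "f \<in> L2 D" and e: "\<And>k. e k \<in> L2 D"
    and on: "\<And>j k. L2_inner D (e j) (e k) = (if j = k then 1 else 0)" and F: "finite F"
  shows "(LINT x|lebesgue_on D. (f x - (\<Sum>k\<in>F. a k * e k x))\<^sup>2) =
    (LINT x|lebesgue_on D. (f x)\<^sup>2) - 2 * (\<Sum>k\<in>F. a k * L2_inner D f (e k)) + (\<Sum>k\<in>F. (a k)\<^sup>2)"
proof -
  define s where "s x = (\<Sum>k\<in>F. a k * e k x)" for x
  have s: "s \<in> L2 D" unfolding s_def using e by (rule L2_sum)
  have comm: "L2_inner D u v = L2_inner D v u" for u v by (simp add: L2_inner_def mult.commute)
  have zero: "(\<lambda>x. 0) \<in> L2 D" by (simp add: L2_def)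
  have "L2_inner D s g = (\<Sum>k\<in>F. a k * L2_inner D (e k) g)" if "g \<in> L2 D" for g
    using L2_inner_diff_sum[OF zero that e F, of a] 
    by (simp add: s_def[abs_def] L2_inner_def)
  note sg = this
  have se: "L2_inner D s (e k) = a k" if "k \<in> F" for k
    using that F by (simp add: sg e on if_distrib[of "\<lambda>t. _ * t"] cong: if_cong)
  have ss: "L2_inner D s s = (\<Sum>k\<in>F. (a k)\<^sup>2)"
    by (subst sg[OF s]) (simp add: comm[of "e _"] se power2_eq_square)
  have "(f x - s x)\<^sup>2 = f x * f x - 2 * (s x * f x) + s x * s x" for x
    by (simp add: power2_eq_square algebra_simps)
  then have "(LINT x|lebesgue_on D. (f x - s x)\<^sup>2) =
      (LINT x|lebesgue_on D. f x * f x - 2 * (s x * f x) + s x * s x)"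
    by simp
  also have "\<dots> = L2_inner D f f - 2 * L2_inner D s f + L2_inner D s s"
    unfolding L2_inner_def by (simp add: L2_mult_integrable f s)
  finally show ?thesis
    unfolding sg[OF f] ss comm[of "e _" f] by (simp add: s_def L2_inner_def power2_eq_square)
qed

lemma L2_coeffs_isometry:
  assumes b: "complete_orthonormal_basis D e" and \<alpha>: "\<And>k. 0 < \<alpha> k" and f: "f \<in> L2 D"
  shows "L2_coeffs D e f \<in> hs \<alpha> 0"
    and "hs_norm \<alpha> 0 (L2_coeffs D e f) = sqrt (L2_inner D f f)"
proof -
  define c where "c = L2_coeffs D e f"
  have "(\<lambda>n. LINT x|lebesgue_on D. (f x - (\<Sum>k<n. L2_inner D f (e k) * e k x))\<^sup>2) \<longlonglongrightarrow> 0"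
    using b f unfolding complete_orthonormal_basis_def by blast
  moreover have "(LINT x|lebesgue_on D. (f x - (\<Sum>k<n. L2_inner D f (e k) * e k x))\<^sup>2) =
      L2_inner D f f - (\<Sum>k<n. (c k)\<^sup>2)" for n
    using b by (subst L2_norm_diff_sum[OF f])
      (auto simp: complete_orthonormal_basis_def c_def L2_coeffs_def L2_inner_def power2_eq_square)
  ultimately have "(\<lambda>n. L2_inner D f f - (\<Sum>k<n. (c k)\<^sup>2)) \<longlonglongrightarrow> 0"
    by simp
  from tendsto_diff[OF tendsto_const[of "L2_inner D f f"] this]
  have "(\<lambda>k. (c k)\<^sup>2) sums L2_inner D f f"
    by (simp add: sums_def)
  then have "((\<lambda>k. (c k)\<^sup>2) has_sum L2_inner D f f) UNIV"
    by (intro sums_nonneg_imp_has_sum) auto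
  moreover have "\<alpha> k powr 0 = 1" for k using \<alpha>[of k] by simp
  ultimately show "L2_coeffs D e f \<in> hs \<alpha> 0"
      "hs_norm \<alpha> 0 (L2_coeffs D e f) = sqrt (L2_inner D f f)"
    by (auto simp: hs_def hs_norm_def c_def[symmetric] has_sum_iff)
qed

text \<open>The theorem of Riesz and Fischer.\<close>

lemma L2_coeffs_surj:
  assumes b: "complete_orthonormal_basis D e" and \<alpha>: "\<And>k. 0 < \<alpha> k" and D: "open D" "bounded D"
    and c: "c \<in> hs \<alpha> 0"
  shows "\<exists>f\<in>L2 D. L2_coeffs D e f = c"
proof -
  let ?M = "lebesgue_on D"
  have e: "e k \<in> L2 D" for k using b by (simp add: complete_orthonormal_basis_def)
  have on: "L2_inner D (e j) (e k) = (if j = k then 1 else 0)" for j k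
    using b by (simp add: complete_orthonormal_basis_def)
  have comm: "L2_inner D u v = L2_inner D v u" for u v by (simp add: L2_inner_def mult.commute)
  have lm: "D \<in> lmeasurable"
    using D by (simp add: lmeasurable_open)
  then interpret finite_measure ?M
    by (rule finite_measure_lebesgue_on)
  have "\<alpha> k powr 0 = 1" for k using \<alpha>[of k] by simp
  then have sm: "summable (\<lambda>k. (c k)\<^sup>2)"
    using c by (simp add: hs_def summable_on_imp_summable)
  define r where "r n = (\<Sum>k. (c (k + n))\<^sup>2)" for n
  have "r \<longlonglongrightarrow> 0"
    unfolding r_def using suminf_exist_split2[OF sm] by simp
  define s where "s n x = (\<Sum>k<n. c k * e k x)" for n x
  have s: "s n \<in> L2 D" for n unfolding s_def[abs_def] using e by (rule L2_sum)
  have sdiff: "(LINT x|?M. (s n x - s m x)\<^sup>2) \<le> r m" if "m \<le> n" for m n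
  proof -
    have "s n x - s m x = - (0 - (\<Sum>k\<in>{m..<n}. c k * e k x))" for x
      unfolding s_def lessThan_atLeast0 using that by (simp add: sum_diff_nat_ivl)
    then have "(LINT x|?M. (s n x - s m x)\<^sup>2) = (LINT x|?M. (0 - (\<Sum>k\<in>{m..<n}. c k * e k x))\<^sup>2)"
      by simp
    also have "\<dots> = (\<Sum>k\<in>{m..<n}. (c k)\<^sup>2)"
      by (subst L2_norm_diff_sum[OF _ e on]) (simp_all add: L2_def L2_inner_def)
    also have "\<dots> = (\<Sum>k<n - m. (c (k + m))\<^sup>2)"
      using that sum.shift_bounds_nat_ivl[of "\<lambda>k. (c k)\<^sup>2" 0 m "n - m"] by (simp add: lessThan_atLeast0)
    also have "\<dots> \<le> r m"
      unfolding r_def using sm by (intro sum_le_suminf summable_ignore_initial_segment) auto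
    finally show ?thesis .
  qed
  have "\<exists>N. \<forall>n\<ge>N. \<bar>r n\<bar> < (1/4) ^ j" for j
    using \<open>r \<longlonglongrightarrow> 0\<close> by (auto simp: LIMSEQ_iff) 
  then obtain N where N: "\<And>j n. n \<ge> N j \<Longrightarrow> \<bar>r n\<bar> < (1/4) ^ j"
    by metis
  define q where "q j = (\<Sum>i\<le>j. N i) + j" for j
  have qN: "q j \<ge> N j" for j
    unfolding q_def by (simp add: member_le_sum trans_le_add1)
  have qm: "q j \<le> q (Suc j)" and qj: "j \<le> q j" for j
    unfolding q_def by auto
  define d where "d j x = s (q (Suc j)) x - s (q j) x" for j x
  have d: "d j \<in> L2 D" for j unfolding d_def[abs_def] by (intro L2_diff s)
  then have [measurable]: "d j \<in> borel_measurable ?M" for j by (simp add: L2_def)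
  have [measurable]: "s j \<in> borel_measurable ?M" for j using s[of j] by (simp add: L2_def)
  define C where "C = 1 + measure ?M (space ?M)"
  have "C \<ge> 1" unfolding C_def by simp
  have dint: "(\<integral>\<^sup>+x. ennreal \<bar>d j x\<bar> \<partial>?M) \<le> ennreal (C * (1/2) ^ j)" for j
  proof -
    have i: "integrable ?M (\<lambda>x. 2 ^ j * (d j x)\<^sup>2 + (1/2) ^ j)"
      using d[of j] by (auto simp: L2_def)
    have "\<bar>a\<bar> \<le> 2 ^ j * a\<^sup>2 + (1/2) ^ j" for a :: real
    proof -
      have "0 \<le> (2 ^ j * \<bar>a\<bar> - 1/2)\<^sup>2" by simp
      then have "2 ^ j * \<bar>a\<bar> \<le> (2 ^ j)\<^sup>2 * a\<^sup>2 + 1"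
        by (simp add: power2_diff power_mult_distrib power_one_over)
      then have "2 ^ j * \<bar>a\<bar> \<le> 2 ^ j * (2 ^ j * a\<^sup>2 + (1/2) ^ j)"
        by (simp add: algebra_simps power2_eq_square power_one_over)
      then show ?thesis by simp
    qed
    then have "(\<integral>\<^sup>+x. ennreal \<bar>d j x\<bar> \<partial>?M) \<le> (\<integral>\<^sup>+x. ennreal (2 ^ j * (d j x)\<^sup>2 + (1/2) ^ j) \<partial>?M)"
      by (intro nn_integral_mono ennreal_leI)
    also have "\<dots> = ennreal (LINT x|?M. 2 ^ j * (d j x)\<^sup>2 + (1/2) ^ j)"
      using i by (intro nn_integral_eq_integral) auto
    also have "(LINT x|?M. 2 ^ j * (d j x)\<^sup>2 + (1/2) ^ j) =
        2 ^ j * (LINT x|?M. (d j x)\<^sup>2) + measure ?M (space ?M) * (1/2) ^ j"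
      using d[of j] by (simp add: L2_def)
    also have "\<dots> \<le> 2 ^ j * (1/4) ^ j + measure ?M (space ?M) * (1/2) ^ j"
      using sdiff[OF qm[of j]] N[OF qN[of j]] by (simp add: d_def)
    also have "\<dots> = C * (1/2) ^ j"
      by (simp add: C_def algebra_simps flip: power_mult_distrib)
    finally show ?thesis by (simp add: ennreal_leI)
  qed
  have "(\<integral>\<^sup>+x. (\<Sum>j. ennreal \<bar>d j x\<bar>) \<partial>?M) = (\<Sum>j. \<integral>\<^sup>+x. ennreal \<bar>d j x\<bar> \<partial>?M)"
    by (intro nn_integral_suminf) measurable
  also have "\<dots> \<le> (\<Sum>j. ennreal (C * (1/2) ^ j))"
    by (intro suminf_le dint) auto
  also have "\<dots> = ennreal (\<Sum>j. C * (1/2) ^ j)"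
    using \<open>C \<ge> 1\<close> by (intro suminf_ennreal2 summable_mult) auto
  finally have "(\<integral>\<^sup>+x. (\<Sum>j. ennreal \<bar>d j x\<bar>) \<partial>?M) \<noteq> \<infinity>"
    by (auto simp: top_unique)
  then have "AE x in ?M. (\<Sum>j. ennreal \<bar>d j x\<bar>) \<noteq> \<infinity>"
    by (intro nn_integral_noteq_infinite) measurable
  then have conv: "AE x in ?M. convergent (\<lambda>j. s (q j) x)"
  proof eventually_elim
    case (elim x)
    then have "summable (\<lambda>j. \<bar>d j x\<bar>)"
      by (intro summable_suminf_not_top) auto
    then have "summable (\<lambda>j. d j x)" by (rule summable_rabs_cancel)
    then have "convergent (\<lambda>n. \<Sum>j<n. d j x)" by (simp add: summable_iff_convergent)
    moreover have "(\<Sum>j<n. d j x) = s (q n) x - s (q 0) x" for n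
      unfolding d_def by (rule sum_lessThan_telescope)
    ultimately have "convergent (\<lambda>n. s (q n) x - s (q 0) x)" by simp
    then have "convergent (\<lambda>n. s (q n) x - s (q 0) x + s (q 0) x)"
      by (intro convergent_add convergent_const)
    then show ?case by simp
  qed
  define f where "f x = lim (\<lambda>j. s (q j) x)" for x
  have [measurable]: "f \<in> borel_measurable ?M"
    unfolding f_def[abs_def] by measurable
  have lim: "AE x in ?M. (\<lambda>j. s (q j) x) \<longlonglongrightarrow> f x"
    using conv by eventually_elim (simp add: f_def convergent_LIMSEQ_iff)
  have fs: "(\<integral>\<^sup>+x. ennreal ((f x - s m x)\<^sup>2) \<partial>?M) \<le> ennreal (r m)" for m
  proof -
    have "(\<integral>\<^sup>+x. ennreal ((f x - s m x)\<^sup>2) \<partial>?M) =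
        (\<integral>\<^sup>+x. liminf (\<lambda>j. ennreal ((s (q j) x - s m x)\<^sup>2)) \<partial>?M)"
    proof (intro nn_integral_cong_AE, use lim in eventually_elim)
      case (elim x)
      then have "(\<lambda>j. ennreal ((s (q j) x - s m x)\<^sup>2)) \<longlonglongrightarrow> ennreal ((f x - s m x)\<^sup>2)"
        by (intro tendsto_intros)
      from lim_imp_Liminf[OF _ this] show ?case by simp
    qed
    also have "\<dots> \<le> liminf (\<lambda>j. \<integral>\<^sup>+x. ennreal ((s (q j) x - s m x)\<^sup>2) \<partial>?M)"
      by (intro nn_integral_liminf) measurable
    also have "\<dots> \<le> ennreal (r m)"
    proof (rule Liminf_le)
      show "\<forall>\<^sub>F j in sequentially. (\<integral>\<^sup>+x. ennreal ((s (q j) x - s m x)\<^sup>2) \<partial>?M) \<le> ennreal (r m)"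
        using eventually_ge_at_top[of m]
      proof eventually_elim
        case (elim j)
        have "(\<integral>\<^sup>+x. ennreal ((s (q j) x - s m x)\<^sup>2) \<partial>?M) =
            ennreal (LINT x|?M. (s (q j) x - s m x)\<^sup>2)"
          using L2_diff[OF s s, of "q j" m] by (intro nn_integral_eq_integral) (auto simp: L2_def)
        also have "\<dots> \<le> ennreal (r m)"
          using elim qj[of j] by (intro ennreal_leI sdiff) simp
        finally show ?case .
      qed
    qed auto
    finally show ?thesis .
  qed
  have fsL: "(\<lambda>x. f x - s m x) \<in> L2 D" for m
  proof -
    have "integrable ?M (\<lambda>x. (f x - s m x)\<^sup>2)"
      by (intro integrableI_bounded) (use fs[of m] in \<open>auto simp: less_top[symmetric] top_unique\<close>)
    then show ?thesis by (simp add: L2_def)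
  qed
  have f: "f \<in> L2 D" using L2_add[OF fsL[of 0] s[of 0]] by simp
  have bound: "(L2_inner D f (e k) - c k)\<^sup>2 \<le> r m" if "k < m" for k m
  proof -
    define a where "a = L2_inner D (\<lambda>x. f x - s m x) (e k)"
    have "a = L2_inner D f (e k) - c k"
      unfolding a_def s_def L2_inner_diff_sum[OF f e e finite_lessThan]
      using that by (simp add: on if_distrib[of "\<lambda>t. _ * t"] cong: if_cong)
    moreover have "0 \<le> (LINT x|?M. ((f x - s m x) - (\<Sum>i\<in>{k}. a * e i x))\<^sup>2)" by simp
    then have "a\<^sup>2 \<le> (LINT x|?M. (f x - s m x)\<^sup>2)"
      by (subst (asm) L2_norm_diff_sum[OF fsL e on]) (simp_all add: a_def power2_eq_square)
    moreover have "ennreal (LINT x|?M. (f x - s m x)\<^sup>2) \<le> ennreal (r m)"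
      using fs[of m] fsL[of m] by (subst nn_integral_eq_integral[symmetric]) (auto simp: L2_def)
    moreover have "0 \<le> r m"
      unfolding r_def using sm by (intro suminf_nonneg summable_ignore_initial_segment) auto
    ultimately show ?thesis by simp
  qed
  have "L2_inner D f (e k) = c k" for k
  proof -
    have "(L2_inner D f (e k) - c k)\<^sup>2 \<le> 0"
      using \<open>r \<longlonglongrightarrow> 0\<close> bound[of k] 
      by (intro LIMSEQ_le_const[of r]) (auto intro!: exI[of _ "Suc k"])
    then show ?thesis by simp
  qed
  then show ?thesis using f by (auto simp: L2_coeffs_def)
qed

end

theory Submission
  imports Defs
begin

text \<open>
  The quasi-potentials are continuous because a displacement of the end point can be realized by a
  control whose cost is quadratic in the displacement: for all \<open>x\<close>, all \<open>q \<in> \<H>\<^sub>1\<^sub>+\<^sub>2\<^sub>\<beta>\<close> and all \<open>\<eta> > 0\<close>,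
  \<open>V(x + q) \<le> (1 + \<eta>) V(x) + (1 + 1/\<eta>) K |q|\<^sup>2\<close> with a constant \<open>K\<close> that is the same for all
  \<open>\<mu> \<le> 1\<close> (\<open>V_displaced\<close>).  In other words the square root of \<open>V\<close> is Lipschitz.  As \<open>V(0) = 0\<close>, this
  contains the finiteness of \<open>V\<close>, and reading it in both directions gives continuity, uniformly in
  \<open>\<mu>\<close>.  Only the displacement \<open>q\<close> has to be smooth, while \<open>x\<close> may have a rough velocity; so the
  displacements \<open>q = (\<xi>, 0)\<close> yield the same inequality for the infimum over all final velocities
  (\<open>W_displaced\<close>).

  The control is found as follows (\<open>steers_displaced\<close>).  Up to constants, \<open>Q\<close> identifies \<open>H\<close> with
  \<open>H\<^sup>2\<^sup>\<beta>\<close>, so forces are to be measured in \<open>H\<^sup>2\<^sup>\<beta>\<close>.  Let \<open>q = (x, y)\<close>, and let \<open>u\<close> be the free damped motion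
  started at \<open>(x, - y)\<close>.  Run backwards it ends at \<open>q\<close>, and it needs the force \<open>-2u'\<close>.  Friction
  dissipates the energy, \<open>2 \<integral>|u'|\<^sup>2 \<le> |x|\<^sup>2 + \<mu>|y|\<^sup>2\<close>, where \<open>u'\<close> and \<open>y\<close> are measured in \<open>H\<^sup>2\<^sup>\<beta>\<close>
  and \<open>x\<close> in \<open>H\<^sup>1\<^sup>+\<^sup>2\<^sup>\<beta>\<close>; this bounds the cost without a trace of the singular limit \<open>\<mu> \<rightarrow> 0\<close>.  A cutoff in time lets the reversed motion
  start from rest one unit of time before the end, at the price of terms of lower order.  It is added
  to a given nearly optimal path, which may be assumed to last at least one unit of time because
  resting at \<open>0\<close> is free (\<open>steers_delay\<close>).  The resulting change of \<open>B\<close> is undone by the control as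
  well; as \<open>B\<close> is Lipschitz in \<open>H\<^sup>2\<^sup>\<beta>\<close>, this is affordable once the given path is known to lie in
  \<open>H\<^sup>2\<^sup>\<beta>\<close>, which follows from Duhamel's formula by a bootstrap (\<open>steered_regular\<close>).

  All computations are done mode by mode, where the equation is that of a single damped oscillator.
  The semigroup is given only by its generator, and the passage to the modes rests on the facts that
  the coordinates of its orbits are differentiable (\<open>orbit_ode\<close>) and that the oscillator equation
  has unique solutions (\<open>S_velocity\<close>).  The former requires left continuity of the orbits, hence
  that the operators of the semigroup are bounded uniformly near time \<open>0\<close>; this is the uniform
  boundedness principle, proved in \<open>locally_bounded_at_0\<close>.  Finally, \<open>\<beta>\<close> cannot be negative, since \<open>Q\<close>
  is bounded on \<open>H\<close> and the eigenvalues \<open>\<alpha>\<^sub>k\<close> tend to infinity (\<open>exponent_nonneg\<close>).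
\<close>

section \<open>The weighted sequence spaces\<close>

lemma hs_norm_sq: "(hs_norm \<alpha> \<delta> x)\<^sup>2 = (\<Sum>\<^sub>\<infinity>k. \<alpha> k powr \<delta> * (x k)\<^sup>2)"
  unfolding hs_norm_def by (simp add: infsum_nonneg)

lemma hs_dominated:
  assumes "\<And>k. \<alpha> k powr \<delta> * (x k)\<^sup>2 \<le> a k" "a summable_on UNIV"
  shows "x \<in> hs \<alpha> \<delta>" "(hs_norm \<alpha> \<delta> x)\<^sup>2 \<le> infsum a UNIV"
proof -
  show "x \<in> hs \<alpha> \<delta>"
    unfolding hs_def using assms by (auto intro: summable_on_comparison_test)
  then show "(hs_norm \<alpha> \<delta> x)\<^sup>2 \<le> infsum a UNIV"
    unfolding hs_norm_sq hs_def using assms by (intro infsum_mono) auto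
qed

lemma hs_finite_sums_bound:
  assumes "\<And>F. finite F \<Longrightarrow> (\<Sum>k\<in>F. \<alpha> k powr \<delta> * (x k)\<^sup>2) \<le> b"
  shows "x \<in> hs \<alpha> \<delta>" "(hs_norm \<alpha> \<delta> x)\<^sup>2 \<le> b"
proof -
  show "x \<in> hs \<alpha> \<delta>"
    unfolding hs_def mem_Collect_eq
    by (rule nonneg_bdd_above_summable_on) (auto intro!: bdd_aboveI[of _ b] assms)
  then show "(hs_norm \<alpha> \<delta> x)\<^sup>2 \<le> b"
    unfolding hs_norm_sq hs_def using assms by (intro infsum_le_finite_sums) auto
qed

lemma hs_finite_sum_le:
  assumes "x \<in> hs \<alpha> \<delta>" "finite F"
  shows "(\<Sum>k\<in>F. \<alpha> k powr \<delta> * (x k)\<^sup>2) \<le> (hs_norm \<alpha> \<delta> x)\<^sup>2"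
  unfolding hs_norm_sq using assms by (intro finite_sum_le_infsum) (auto simp: hs_def)

lemma hs_coord_le:
  assumes "x \<in> hs \<alpha> \<delta>"
  shows "\<alpha> k powr \<delta> * (x k)\<^sup>2 \<le> (hs_norm \<alpha> \<delta> x)\<^sup>2"
  using hs_finite_sum_le[OF assms, of "{k}"] by simp

lemma hs_zero [simp]: "0 \<in> hs \<alpha> \<delta>" "hs_norm \<alpha> \<delta> 0 = 0"
  by (simp_all add: hs_def hs_norm_def)

lemma hs_minus: "x \<in> hs \<alpha> \<delta> \<Longrightarrow> - x \<in> hs \<alpha> \<delta>" "hs_norm \<alpha> \<delta> (- x) = hs_norm \<alpha> \<delta> x"
  by (simp_all add: hs_def hs_norm_def)

lemma hs_add: "x \<in> hs \<alpha> \<delta> \<Longrightarrow> y \<in> hs \<alpha> \<delta> \<Longrightarrow> x + y \<in> hs \<alpha> \<delta>"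
  using hs_diff[of x \<alpha> \<delta> "- y"] by (simp add: hs_minus)

lemma hs_norm_add_le:
  "x \<in> hs \<alpha> \<delta> \<Longrightarrow> y \<in> hs \<alpha> \<delta> \<Longrightarrow> hs_norm \<alpha> \<delta> (x + y) \<le> hs_norm \<alpha> \<delta> x + hs_norm \<alpha> \<delta> y"
  by (intro hs_norm_triangle hs_add)

lemma hs_norm_diff_commute: "hs_norm \<alpha> \<delta> (x - y) = hs_norm \<alpha> \<delta> (y - x)"
  using hs_minus(2)[of \<alpha> \<delta> "x - y"] by simp

lemma hs_scl: "x \<in> hs \<alpha> \<delta> \<Longrightarrow> scl a x \<in> hs \<alpha> \<delta>" "hs_norm \<alpha> \<delta> (scl a x) = \<bar>a\<bar> * hs_norm \<alpha> \<delta> x"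
proof -
  have *: "\<alpha> k powr \<delta> * (scl a x k)\<^sup>2 = a\<^sup>2 * (\<alpha> k powr \<delta> * (x k)\<^sup>2)" for k x
    by (simp add: scl_def power_mult_distrib)
  show "x \<in> hs \<alpha> \<delta> \<Longrightarrow> scl a x \<in> hs \<alpha> \<delta>"
    using summable_on_cmult_right[of "\<lambda>k. \<alpha> k powr \<delta> * (x k)\<^sup>2" UNIV "a\<^sup>2"] by (simp add: hs_def *)
  show "hs_norm \<alpha> \<delta> (scl a x) = \<bar>a\<bar> * hs_norm \<alpha> \<delta> x"
    unfolding hs_norm_def * by (simp add: infsum_cmult_right' real_sqrt_mult)
qed

text \<open>The weighted form \<open>2ab \<le> \<eta>a\<^sup>2 + b\<^sup>2/\<eta>\<close> of the parallelogram inequality; the free parameter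
  \<open>\<eta>\<close> plays the role of Minkowski's inequality for the square-integrable controls.\<close>

lemma weighted_sq_add_le:
  fixes a b \<eta> :: real
  assumes "\<eta> > 0"
  shows "(a + b)\<^sup>2 \<le> (1 + \<eta>) * a\<^sup>2 + (1 + 1 / \<eta>) * b\<^sup>2"
proof -
  have "0 \<le> (\<eta> * a - b)\<^sup>2 / \<eta>" using assms by simp
  also have "(\<eta> * a - b)\<^sup>2 / \<eta> = \<eta> * a\<^sup>2 - 2 * a * b + b\<^sup>2 / \<eta>"
    using assms by (simp add: field_simps power2_eq_square)
  finally show ?thesis by (simp add: power2_sum algebra_simps)
qed

lemma hs_norm_sq_add_le:
  assumes "x \<in> hs \<alpha> \<delta>" "y \<in> hs \<alpha> \<delta>" "\<eta> > 0"
  shows "(hs_norm \<alpha> \<delta> (x + y))\<^sup>2 \<le> (1 + \<eta>) * (hs_norm \<alpha> \<delta> x)\<^sup>2 + (1 + 1 / \<eta>) * (hs_norm \<alpha> \<delta> y)\<^sup>2"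
  using power_mono[OF hs_norm_add_le[OF assms(1,2)] hs_norm_nonneg, of 2]
    weighted_sq_add_le[OF assms(3), of "hs_norm \<alpha> \<delta> x" "hs_norm \<alpha> \<delta> y"] by linarith

lemma hs_norm_sq_add2_le:
  assumes "x \<in> hs \<alpha> \<delta>" "y \<in> hs \<alpha> \<delta>"
  shows "(hs_norm \<alpha> \<delta> (x + y))\<^sup>2 \<le> 2 * (hs_norm \<alpha> \<delta> x)\<^sup>2 + 2 * (hs_norm \<alpha> \<delta> y)\<^sup>2"
  using hs_norm_sq_add_le[OF assms, of 1] by simp

text \<open>Completeness, in the form that absolutely convergent series converge: the partial sums are
  bounded on every finite set of coordinates, and this survives the limit.\<close>

lemma hs_series:
  assumes pos: "\<And>k. 0 < \<alpha> k" and x: "\<And>n. x n \<in> hs \<alpha> \<delta>"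
    and le: "\<And>n. hs_norm \<alpha> \<delta> (x n) \<le> b n" and b: "summable b"
  shows "\<And>k. summable (\<lambda>n. x n k)" "(\<lambda>k. \<Sum>n. x n k) \<in> hs \<alpha> \<delta>"
    "hs_norm \<alpha> \<delta> (\<lambda>k. \<Sum>n. x n k) \<le> suminf b"
proof -
  define w where "w x k = sqrt (\<alpha> k powr \<delta>) * x k" for x :: coeffs and k
  have w2: "(w x k)\<^sup>2 = \<alpha> k powr \<delta> * (x k)\<^sup>2" for x k
    by (simp add: w_def power_mult_distrib)
  have b0: "0 \<le> b n" for n using le[of n] hs_norm_nonneg[of \<alpha> \<delta> "x n"] by linarith
  have le1: "L2_set (w (x n)) F \<le> b n" if "finite F" for n F
    using real_sqrt_le_mono[OF hs_finite_sum_le[OF x[of n] that]] le[of n] hs_norm_nonneg[of \<alpha> \<delta> "x n"]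
    unfolding L2_set_def w2 by simp
  show sm: "summable (\<lambda>n. x n k)" for k
  proof -
    have "\<bar>w (x n) k\<bar> \<le> b n" for n
      using le1[of "{k}" n] by (simp add: L2_set_def)
    then have "summable (\<lambda>n. w (x n) k)"
      by (intro summable_comparison_test[OF _ b]) auto
    moreover have "sqrt (\<alpha> k powr \<delta>) \<noteq> 0" using pos[of k] by simp
    ultimately show ?thesis
      unfolding w_def by (simp add: summable_cmult_iff)
  qed
  define X where "X = (\<lambda>k. \<Sum>n. x n k)"
  have part: "L2_set (\<lambda>k. \<Sum>n<N. w (x n) k) F \<le> (\<Sum>n<N. b n)" if F: "finite F" for N F
  proof (induction N)
    case (Suc N)
    have "L2_set (\<lambda>k. \<Sum>n<Suc N. w (x n) k) F \<le> L2_set (\<lambda>k. \<Sum>n<N. w (x n) k) F + L2_set (w (x N)) F"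
      using L2_set_triangle_ineq[of "\<lambda>k. \<Sum>n<N. w (x n) k" "w (x N)" F] by simp
    then show ?case using Suc le1[OF F, of N] by simp
  qed (simp add: L2_set_def)
  have lim: "L2_set (w X) F \<le> suminf b" if F: "finite F" for F
  proof -
    have "(\<lambda>N. \<Sum>n<N. w (x n) k) \<longlonglongrightarrow> w X k" for k
      unfolding w_def X_def sum_distrib_left[symmetric]
      by (intro tendsto_mult tendsto_const summable_LIMSEQ sm)
    then have "(\<lambda>N. L2_set (\<lambda>k. \<Sum>n<N. w (x n) k) F) \<longlonglongrightarrow> L2_set (w X) F"
      unfolding L2_set_def by (intro tendsto_intros)
    then show ?thesis
      by (rule LIMSEQ_le_const2)
        (auto intro!: exI[of _ 0] order_trans[OF part[OF F]] sum_le_suminf b b0)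
  qed
  have sb: "0 \<le> suminf b" using b b0 by (intro suminf_nonneg)
  have "(\<Sum>k\<in>F. \<alpha> k powr \<delta> * (X k)\<^sup>2) \<le> (suminf b)\<^sup>2" if "finite F" for F
    using lim[OF that] sb unfolding L2_set_def w2 by (metis real_sqrt_le_iff real_sqrt_abs abs_of_nonneg)
  from hs_finite_sums_bound[OF this] show "(\<lambda>k. \<Sum>n. x n k) \<in> hs \<alpha> \<delta>" "hs_norm \<alpha> \<delta> (\<lambda>k. \<Sum>n. x n k) \<le> suminf b"
    using sb by (auto simp: X_def intro: power2_le_imp_le)
qed

lemma hs_measurable_norm_sq:
  assumes "\<And>k. (\<lambda>s. x s k) \<in> borel_measurable M" "\<And>s. s \<in> space M \<Longrightarrow> x s \<in> hs \<alpha> \<delta>"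
  shows "(\<lambda>s. (hs_norm \<alpha> \<delta> (x s))\<^sup>2) \<in> borel_measurable M"
proof -
  note [measurable] = assms(1)
  have eq: "(hs_norm \<alpha> \<delta> (x s))\<^sup>2 = (\<Sum>k. \<alpha> k powr \<delta> * (x s k)\<^sup>2)" if "s \<in> space M" for s
    using assms(2)[OF that] unfolding hs_norm_sq hs_def
    by (auto intro!: sums_unique has_sum_imp_sums)
  have "(\<lambda>s. \<Sum>k. \<alpha> k powr \<delta> * (x s k)\<^sup>2) \<in> borel_measurable M"
    by measurable
  then show ?thesis
    by (rule measurable_cong[THEN iffD1, rotated]) (simp add: eq)
qed

lemma ph_zero [simp]: "0 \<in> ph \<alpha> \<delta>" "ph_norm \<alpha> \<delta> 0 = 0"
  by (simp_all add: ph_def ph_norm_def zero_prod_def)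

lemma ph_norm_nonneg [simp]: "0 \<le> ph_norm \<alpha> \<delta> z"
  by (simp add: ph_norm_def)

lemma ph_norm_sq: "(ph_norm \<alpha> \<delta> z)\<^sup>2 = (hs_norm \<alpha> \<delta> (fst z))\<^sup>2 + (hs_norm \<alpha> (\<delta> - 1) (snd z))\<^sup>2"
  by (simp add: ph_norm_def)

lemma hs_norm_le_ph_norm:
  "hs_norm \<alpha> \<delta> (fst z) \<le> ph_norm \<alpha> \<delta> z" "hs_norm \<alpha> (\<delta> - 1) (snd z) \<le> ph_norm \<alpha> \<delta> z"
  using hs_norm_nonneg by (simp_all add: ph_norm_def real_le_rsqrt)

lemma ph_norm_le_add: "ph_norm \<alpha> \<delta> z \<le> hs_norm \<alpha> \<delta> (fst z) + hs_norm \<alpha> (\<delta> - 1) (snd z)"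
  unfolding ph_norm_def by (rule sqrt_sum_squares_le_sum) (simp_all add: hs_norm_nonneg)

lemma ph_add: "z \<in> ph \<alpha> \<delta> \<Longrightarrow> w \<in> ph \<alpha> \<delta> \<Longrightarrow> z + w \<in> ph \<alpha> \<delta>"
  and ph_diff: "z \<in> ph \<alpha> \<delta> \<Longrightarrow> w \<in> ph \<alpha> \<delta> \<Longrightarrow> z - w \<in> ph \<alpha> \<delta>"
  and ph_minus: "z \<in> ph \<alpha> \<delta> \<Longrightarrow> - z \<in> ph \<alpha> \<delta>"
  and ph_scl_mem: "z \<in> ph \<alpha> \<delta> \<Longrightarrow> ph_scl a z \<in> ph \<alpha> \<delta>"
  by (auto simp: ph_def hs_add hs_diff hs_minus hs_scl ph_scl_def)

lemma ph_norm_scl: "ph_norm \<alpha> \<delta> (ph_scl a z) = \<bar>a\<bar> * ph_norm \<alpha> \<delta> z"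
  by (simp add: ph_norm_def ph_scl_def hs_scl power_mult_distrib real_sqrt_mult flip: distrib_left)

lemma ph_norm_minus: "ph_norm \<alpha> \<delta> (- z) = ph_norm \<alpha> \<delta> z"
  by (simp add: ph_norm_def hs_minus)

lemma ph_norm_diff_commute: "ph_norm \<alpha> \<delta> (z - w) = ph_norm \<alpha> \<delta> (w - z)"
  using ph_norm_minus[of \<alpha> \<delta> "z - w"] by simp

lemma ph_norm_triangle:
  assumes "z \<in> ph \<alpha> \<delta>" "w \<in> ph \<alpha> \<delta>"
  shows "ph_norm \<alpha> \<delta> (z + w) \<le> ph_norm \<alpha> \<delta> z + ph_norm \<alpha> \<delta> w"
proof -
  have "ph_norm \<alpha> \<delta> (z + w) \<le> sqrt ((hs_norm \<alpha> \<delta> (fst z) + hs_norm \<alpha> \<delta> (fst w))\<^sup>2 +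
      (hs_norm \<alpha> (\<delta> - 1) (snd z) + hs_norm \<alpha> (\<delta> - 1) (snd w))\<^sup>2)"
    unfolding ph_norm_def using assms
    by (intro real_sqrt_le_mono add_mono power_mono) (auto simp: ph_def hs_norm_add_le hs_norm_nonneg)
  also have "\<dots> \<le> ph_norm \<alpha> \<delta> z + ph_norm \<alpha> \<delta> w"
    unfolding ph_norm_def by (rule real_sqrt_sum_squares_triangle_ineq)
  finally show ?thesis .
qed

lemma ph_coord_abs_le:
  assumes "0 < \<alpha> k" "z \<in> ph \<alpha> \<delta>"
  shows "\<bar>fst z k\<bar> \<le> ph_norm \<alpha> \<delta> z / sqrt (\<alpha> k powr \<delta>)"
    and "\<bar>snd z k\<bar> \<le> ph_norm \<alpha> \<delta> z / sqrt (\<alpha> k powr (\<delta> - 1))"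
proof -
  have *: "\<bar>x k\<bar> \<le> B / sqrt (\<alpha> k powr d)" if "x \<in> hs \<alpha> d" "hs_norm \<alpha> d x \<le> B" for x d B
  proof -
    have "sqrt (\<alpha> k powr d * (x k)\<^sup>2) \<le> hs_norm \<alpha> d x"
      using real_sqrt_le_mono[OF hs_coord_le[OF that(1), of k]] hs_norm_nonneg[of \<alpha> d x] by simp
    then show ?thesis using that(2) assms(1) by (simp add: real_sqrt_mult field_simps)
  qed
  show "\<bar>fst z k\<bar> \<le> ph_norm \<alpha> \<delta> z / sqrt (\<alpha> k powr \<delta>)"
      "\<bar>snd z k\<bar> \<le> ph_norm \<alpha> \<delta> z / sqrt (\<alpha> k powr (\<delta> - 1))"
    using assms(2) by (auto intro!: * hs_norm_le_ph_norm simp: ph_def)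
qed

locale spectrum =
  fixes \<alpha> :: "nat \<Rightarrow> real"
  assumes \<alpha>0: "0 < \<alpha> 0" and mono_\<alpha>: "mono \<alpha>"
begin

lemma \<alpha>0_le: "\<alpha> 0 \<le> \<alpha> k"
  using mono_\<alpha> by (simp add: monoD)

lemma \<alpha>_pos [simp]: "0 < \<alpha> k"
  using \<alpha>0 \<alpha>0_le[of k] by linarith

lemma \<alpha>_nonzero [simp]: "\<alpha> k \<noteq> 0"
  by (metis \<alpha>_pos less_irrefl)

lemma \<alpha>_powr_mono:
  assumes "\<delta>' \<le> \<delta>"
  shows "\<alpha> k powr \<delta>' \<le> \<alpha> 0 powr (\<delta>' - \<delta>) * \<alpha> k powr \<delta>"
proof -
  have "\<alpha> k powr (\<delta>' - \<delta>) \<le> \<alpha> 0 powr (\<delta>' - \<delta>)"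
    using assms \<alpha>0_le \<alpha>0 by (intro powr_mono2') auto
  then show ?thesis
    using mult_right_mono[of "\<alpha> k powr (\<delta>' - \<delta>)" "\<alpha> 0 powr (\<delta>' - \<delta>)" "\<alpha> k powr \<delta>"]
    by (simp flip: powr_add)
qed

text \<open>The scale is decreasing because \<open>\<alpha>\<close> is bounded below; the constant involves only
  \<open>\<alpha>\<^sub>0\<close> and the two exponents, so it is the same for all values of \<open>\<mu>\<close>.\<close>

lemma hs_mono:
  assumes "\<delta>' \<le> \<delta>" "x \<in> hs \<alpha> \<delta>"
  shows "x \<in> hs \<alpha> \<delta>'" "(hs_norm \<alpha> \<delta>' x)\<^sup>2 \<le> \<alpha> 0 powr (\<delta>' - \<delta>) * (hs_norm \<alpha> \<delta> x)\<^sup>2"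
proof -
  have le: "\<alpha> k powr \<delta>' * (x k)\<^sup>2 \<le> \<alpha> 0 powr (\<delta>' - \<delta>) * (\<alpha> k powr \<delta> * (x k)\<^sup>2)" for k
    using mult_right_mono[OF \<alpha>_powr_mono[OF assms(1), of k], of "(x k)\<^sup>2"] by (simp add: mult.assoc)
  have "(\<lambda>k. \<alpha> 0 powr (\<delta>' - \<delta>) * (\<alpha> k powr \<delta> * (x k)\<^sup>2)) summable_on UNIV"
    using assms(2) by (auto simp: hs_def intro: summable_on_cmult_right)
  from hs_dominated[OF le this] show "x \<in> hs \<alpha> \<delta>'"
      "(hs_norm \<alpha> \<delta>' x)\<^sup>2 \<le> \<alpha> 0 powr (\<delta>' - \<delta>) * (hs_norm \<alpha> \<delta> x)\<^sup>2"
    by (simp_all add: infsum_cmult_right' hs_norm_sq)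
qed

lemma unit_coeffs_mem: "unit_coeffs k \<in> hs \<alpha> \<delta>"
proof (rule hs_finite_sums_bound)
  fix F :: "nat set" assume "finite F"
  then show "(\<Sum>j\<in>F. \<alpha> j powr \<delta> * (unit_coeffs k j)\<^sup>2) \<le> \<alpha> k powr \<delta>"
    by (simp add: unit_coeffs_def if_distrib[of "\<lambda>x. x\<^sup>2"] if_distrib[of "\<lambda>x. _ * x"] cong: if_cong)
qed

lemma ph_mono: "\<delta>' \<le> \<delta> \<Longrightarrow> z \<in> ph \<alpha> \<delta> \<Longrightarrow> z \<in> ph \<alpha> \<delta>'"
  by (auto simp: ph_def intro: hs_mono(1)[rotated])

end

section \<open>From right derivatives to derivatives\<close>

text \<open>The usual mean value theorem is two-sided.  Here the set of times up to which
  \<open>\<bar>f t - f a\<bar> \<le> \<epsilon> (t - a)\<close> holds is closed by continuity, and the right derivative moves its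
  supremum past every point before \<open>b\<close>.\<close>

lemma right_derivative_zero_imp_const:
  fixes f :: "real \<Rightarrow> real"
  assumes ab: "a \<le> b" and cont: "continuous_on {a..b} f"
    and deriv: "\<And>t. a \<le> t \<Longrightarrow> t < b \<Longrightarrow> (f has_real_derivative 0) (at_right t)"
  shows "f b = f a"
proof -
  have "\<bar>f b - f a\<bar> \<le> \<epsilon> * (b - a)" if "\<epsilon> > 0" for \<epsilon>
  proof -
    define A where "A = {t\<in>{a..b}. \<forall>s\<in>{a..t}. \<bar>f s - f a\<bar> \<le> \<epsilon> * (s - a)}"
    define c where "c = Sup A"
    have "a \<in> A" using ab by (simp add: A_def)
    have bdd: "bdd_above A" by (auto simp: A_def)
    have c: "a \<le> c" "c \<le> b"
      unfolding c_def by (rule cSup_upper[OF \<open>a \<in> A\<close> bdd], rule cSup_least) (use \<open>a \<in> A\<close> in \<open>auto simp: A_def\<close>)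
    have below: "\<bar>f s - f a\<bar> \<le> \<epsilon> * (s - a)" if s: "a \<le> s" "s < c" for s
    proof -
      obtain t where "t \<in> A" "s < t"
        using less_cSup_iff[of A s] s(2) \<open>a \<in> A\<close> bdd unfolding c_def by auto
      then show ?thesis using s by (auto simp: A_def)
    qed
    have at_c: "\<bar>f c - f a\<bar> \<le> \<epsilon> * (c - a)"
    proof (cases "a = c")
      case False
      then have ac: "a < c" using c by simp
      have "continuous_on {a..c} (\<lambda>s. \<epsilon> * (s - a) - \<bar>f s - f a\<bar>)"
        using c by (intro continuous_intros continuous_on_subset[OF cont]) auto
      then have "((\<lambda>s. \<epsilon> * (s - a) - \<bar>f s - f a\<bar>) \<longlongrightarrow> \<epsilon> * (c - a) - \<bar>f c - f a\<bar>) (at c within {a..c})"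
        using ac by (simp add: continuous_on_def)
      then have "((\<lambda>s. \<epsilon> * (s - a) - \<bar>f s - f a\<bar>) \<longlongrightarrow> \<epsilon> * (c - a) - \<bar>f c - f a\<bar>) (at_left c)"
        using ac by (simp add: at_within_Icc_at_left)
      moreover have "\<forall>\<^sub>F s in at_left c. 0 \<le> \<epsilon> * (s - a) - \<bar>f s - f a\<bar>"
        using eventually_at_left_real[OF ac] by eventually_elim (use below in auto)
      ultimately have "0 \<le> \<epsilon> * (c - a) - \<bar>f c - f a\<bar>"
        by (intro tendsto_lowerbound) auto
      then show ?thesis by simp
    qed simp
    have "c = b"
    proof (rule ccontr)
      assume "c \<noteq> b"
      then have "c < b" using c by simp
      from deriv[OF c(1) this] have "((\<lambda>y. (f y - f c) / (y - c)) \<longlongrightarrow> 0) (at_right c)"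
        by (simp add: has_field_derivative_iff)
      from tendstoD[OF this that] have "\<forall>\<^sub>F y in at_right c. \<bar>(f y - f c) / (y - c)\<bar> < \<epsilon>"
        by simp
      then obtain d where d: "d > c" "\<And>y. c < y \<Longrightarrow> y < d \<Longrightarrow> \<bar>(f y - f c) / (y - c)\<bar> < \<epsilon>"
        by (auto simp: eventually_at_right_field)
      define y where "y = min b ((c + d) / 2)"
      have y: "c < y" "y \<le> b" "y < d" using d(1) \<open>c < b\<close> by (auto simp: y_def min_def)
      have "\<bar>f s - f a\<bar> \<le> \<epsilon> * (s - a)" if s: "s \<in> {a..y}" for s
      proof (cases "s \<le> c")
        case True then show ?thesis using below[of s] at_c s by (cases "s = c") auto
      next
        case False
        then have "\<bar>f s - f c\<bar> \<le> \<epsilon> * (s - c)"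
          using d(2)[of s] s y by (simp add: field_simps)
        then show ?thesis using at_c by (simp add: algebra_simps)
      qed
      then have "y \<in> A" using y c by (auto simp: A_def)
      then have "y \<le> c" unfolding c_def by (intro cSup_upper bdd)
      with y show False by simp
    qed
    then show ?thesis using at_c by simp
  qed
  then have "\<bar>f b - f a\<bar> \<le> 0 + e" if "e > 0" for e
  proof -
    have "e / (b - a + 1) * (b - a) \<le> e" using that ab by (simp add: field_simps)
    moreover have "\<bar>f b - f a\<bar> \<le> e / (b - a + 1) * (b - a)"
      using that ab \<open>\<And>\<epsilon>. \<epsilon> > 0 \<Longrightarrow> \<bar>f b - f a\<bar> \<le> \<epsilon> * (b - a)\<close>[of "e / (b - a + 1)"] by simp
    ultimately show ?thesis by linarith
  qed
  then have "\<bar>f b - f a\<bar> \<le> 0" by (rule field_le_epsilon)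
  then show ?thesis by simp
qed

text \<open>The generator of a semigroup provides right derivatives only.  Subtracting from \<open>f\<close> the
  primitive of \<open>\<phi>\<close> reduces the claim to the case \<open>\<phi> = 0\<close>.\<close>

lemma right_derivative_imp_derivative:
  fixes f \<phi> :: "real \<Rightarrow> real"
  assumes cf: "continuous_on {0..} f" and cp: "continuous_on {0..} \<phi>"
    and deriv: "\<And>t. 0 \<le> t \<Longrightarrow> (f has_real_derivative \<phi> t) (at_right t)"
    and t: "0 < t"
  shows "(f has_real_derivative \<phi> t) (at t)"
proof -
  define b where "b = t + 1"
  define P where "P = (\<lambda>s. integral {0..s} \<phi>)"
  have cpb: "continuous_on {0..b} \<phi>" using cp by (rule continuous_on_subset) auto
  have P: "(P has_real_derivative \<phi> s) (at s within {0..b})" if "s \<in> {0..b}" for s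
    unfolding P_def using integral_has_real_derivative[OF cpb that] .
  have cP: "continuous_on {0..b} P" by (rule DERIV_continuous_on[OF P])
  have f: "f s = f 0 + P s" if s: "s \<in> {0..b}" for s
  proof -
    have "f s - P s = f 0 - P 0"
    proof (rule right_derivative_zero_imp_const[where f = "\<lambda>s. f s - P s"])
      show "continuous_on {0..s} (\<lambda>s. f s - P s)"
        using s by (intro continuous_on_diff continuous_on_subset[OF cf] continuous_on_subset[OF cP]) auto
      fix r assume r: "0 \<le> r" "r < s"
      have "(P has_real_derivative \<phi> r) (at_right r)"
      proof -
        have "(P has_real_derivative \<phi> r) (at r within {r..b})"
          using r s by (intro DERIV_subset[OF P]) auto
        then show ?thesis using r s by (simp add: at_within_Icc_at_right)
      qed
      from DERIV_diff[OF deriv[OF r(1)] this]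
      show "((\<lambda>s. f s - P s) has_real_derivative 0) (at_right r)" by simp
    qed (use s in auto)
    then show ?thesis by (simp add: P_def)
  qed
  have "((\<lambda>s. f 0 + P s) has_real_derivative \<phi> t) (at t within {0..b})"
    using DERIV_add[OF DERIV_const P[of t]] t by (simp add: b_def)
  then have "((\<lambda>s. f 0 + P s) has_real_derivative \<phi> t) (at t within {0<..<b})"
    by (rule DERIV_subset) auto
  then have d: "((\<lambda>s. f 0 + P s) has_real_derivative \<phi> t) (at t)"
    using t at_within_open[of t "{0<..<b}"] by (simp add: b_def)
  have "f 0 + P s = f s" if "s \<in> {0<..<b}" for s
    using f[of s] that by simp
  from has_field_derivative_transform_within_open[OF d _ _ this, where S = "{0<..<b}"]
  show ?thesis using t by (simp add: b_def)
qed


section \<open>Local boundedness of the semigroup\<close>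

text \<open>This is the uniform boundedness principle for the sequence \<open>S (r n)\<close>, proved by a gliding hump:
  whatever the partial sum \<open>x\<close>, one of \<open>x \<plusminus> y\<close> is mapped to a vector at least as long as the image
  of \<open>y\<close>, so a suitable choice of signs in \<open>\<Sum>\<^sub>n \<plusminus> z\<^sub>n/8\<^sup>n\<close> makes all images large.\<close>

lemma locally_bounded_at_0:
  fixes S :: "real \<Rightarrow> phase \<Rightarrow> phase"
  assumes pos: "\<And>k. 0 < \<alpha> k"
    and S: "\<And>t. t \<ge> 0 \<Longrightarrow> S t \<in> ph \<alpha> \<delta> \<rightarrow> ph \<alpha> \<delta>"
    and S_add: "\<And>t z w. t \<ge> 0 \<Longrightarrow> z \<in> ph \<alpha> \<delta> \<Longrightarrow> w \<in> ph \<alpha> \<delta> \<Longrightarrow> S t (z + w) = S t z + S t w"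
    and S_scl: "\<And>t a z. t \<ge> 0 \<Longrightarrow> z \<in> ph \<alpha> \<delta> \<Longrightarrow> S t (ph_scl a z) = ph_scl a (S t z)"
    and S_bdd: "\<And>t. t \<ge> 0 \<Longrightarrow> \<exists>C. \<forall>z\<in>ph \<alpha> \<delta>. ph_norm \<alpha> \<delta> (S t z) \<le> C * ph_norm \<alpha> \<delta> z"
    and S_cont: "\<And>z. z \<in> ph \<alpha> \<delta> \<Longrightarrow> ((\<lambda>t. ph_norm \<alpha> \<delta> (S t z - z)) \<longlongrightarrow> 0) (at_right 0)"
  shows "\<exists>K \<eta>. \<eta> > 0 \<and> (\<forall>t z. 0 < t \<longrightarrow> t \<le> \<eta> \<longrightarrow> z \<in> ph \<alpha> \<delta> \<longrightarrow> ph_norm \<alpha> \<delta> (S t z) \<le> K * ph_norm \<alpha> \<delta> z)"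
proof (rule ccontr)
  let ?n = "ph_norm \<alpha> \<delta>"
  assume "\<not> ?thesis"
  then have neg: "\<exists>t z. 0 < t \<and> t \<le> \<eta> \<and> z \<in> ph \<alpha> \<delta> \<and> K * ?n z < ?n (S t z)" if "\<eta> > 0" for K \<eta>
    using that by (meson not_le)
  (* Near-maximizers z of operators S t with norm at least 9^n.  The ratio 9 beats the damping
     factor 8 used below, and the factor 2 is the price for a supremum that need not be attained. *)
  have "\<exists>t z. 0 < t \<and> t \<le> 1 / real (Suc n) \<and> z \<in> ph \<alpha> \<delta> \<and> ?n z \<le> 1 \<and> 9 ^ n \<le> ?n (S t z) \<and>
      (\<forall>w\<in>ph \<alpha> \<delta>. ?n (S t w) \<le> 2 * ?n (S t z) * ?n w)" for n
  proof -
    obtain t z where t: "0 < t" "t \<le> 1 / real (Suc n)" and z: "z \<in> ph \<alpha> \<delta>" "9 ^ n * ?n z < ?n (S t z)"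
      using neg[of "1 / real (Suc n)" "9 ^ n"] by auto
    obtain C where C: "\<And>z. z \<in> ph \<alpha> \<delta> \<Longrightarrow> ?n (S t z) \<le> C * ?n z"
      using S_bdd[of t] t by auto
    define A where "A = {?n (S t w) | w. w \<in> ph \<alpha> \<delta> \<and> ?n w \<le> 1}"
    have unit: "?n (S t w) / ?n w \<in> A" if "w \<in> ph \<alpha> \<delta>" "?n w > 0" for w
      unfolding A_def mem_Collect_eq using that t
      by (intro exI[of _ "ph_scl (1 / ?n w) w"]) (simp add: S_scl ph_norm_scl ph_scl_mem)
    have bdd: "bdd_above A"
    proof (rule bdd_aboveI)
      fix a assume "a \<in> A"
      then obtain w where w: "a = ?n (S t w)" "w \<in> ph \<alpha> \<delta>" "?n w \<le> 1" by (auto simp: A_def)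
      have "C * ?n w \<le> \<bar>C\<bar> * 1" using w by (intro mult_mono) auto
      then show "a \<le> \<bar>C\<bar>" using C[OF w(2)] w(1) by simp
    qed
    have "?n z \<noteq> 0" using C[OF z(1)] z(2) by auto
    then have "?n z > 0" using ph_norm_nonneg[of \<alpha> \<delta> z] by linarith
    then have ge: "9 ^ n < Sup A"
    proof -
      have "9 ^ n * ?n z < Sup A * ?n z"
        using pos_divide_le_eq[OF \<open>?n z > 0\<close>, THEN iffD1, OF cSup_upper[OF unit[OF z(1) \<open>?n z > 0\<close>] bdd]] z(2)
        by linarith
      then show ?thesis using mult_less_cancel_right_pos[OF \<open>?n z > 0\<close>] by blast
    qed
    have "Sup A > 0" using ge by (meson less_trans zero_less_numeral zero_less_power)
    then have "max (9 ^ n) (Sup A / 2) < Sup A" using ge by simp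
    then obtain y where y: "y \<in> ph \<alpha> \<delta>" "?n y \<le> 1" "max (9 ^ n) (Sup A / 2) < ?n (S t y)"
      using less_cSupD[of A] \<open>?n z > 0\<close> unit[OF z(1)] unfolding A_def by blast
    have "?n (S t w) \<le> 2 * ?n (S t y) * ?n w" if w: "w \<in> ph \<alpha> \<delta>" for w
    proof (cases "?n w = 0")
      case True then show ?thesis using C[OF w] by simp
    next
      case False
      then have "?n w > 0" using ph_norm_nonneg[of \<alpha> \<delta> w] by linarith
      then have "?n (S t w) / ?n w \<le> 2 * ?n (S t y)"
        using cSup_upper[OF unit[OF w] bdd] y(3) by simp
      then show ?thesis using \<open>?n w > 0\<close> by (simp add: field_simps)
    qed
    then show ?thesis using t y by (intro exI[of _ t] exI[of _ y]) auto
  qed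
  then obtain r z where r: "\<And>n. 0 < r n" "\<And>n. r n \<le> 1 / real (Suc n)"
    and z: "\<And>n. z n \<in> ph \<alpha> \<delta>" "\<And>n. ?n (z n) \<le> 1" "\<And>n. 9 ^ n \<le> ?n (S (r n) (z n))"
    and rz: "\<And>n w. w \<in> ph \<alpha> \<delta> \<Longrightarrow> ?n (S (r n) w) \<le> 2 * ?n (S (r n) (z n)) * ?n w"
    by metis
  define y where "y n = ph_scl ((1/8) ^ n) (z n)" for n
  have y: "y n \<in> ph \<alpha> \<delta>" "?n (y n) \<le> (1/8) ^ n" "?n (S (r n) (y n)) = (1/8) ^ n * ?n (S (r n) (z n))" for n
    using z[of n] r(1)[of n] mult_left_mono[OF z(2)[of n], of "(1/8) ^ n"]
    by (simp_all add: y_def ph_scl_mem ph_norm_scl S_scl)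
  define x where "x = rec_nat 0 (\<lambda>n x. if ?n (S (r n) (y n)) \<le> ?n (S (r n) (x + y n)) then x + y n else x - y n)"
  have x0: "x 0 = 0" and xS: "x (Suc n) =
      (if ?n (S (r n) (y n)) \<le> ?n (S (r n) (x n + y n)) then x n + y n else x n - y n)" for n
    by (simp_all add: x_def)
  have x: "x n \<in> ph \<alpha> \<delta>" for n
    by (induction n) (simp_all add: x0 xS y ph_add ph_diff)
  have large: "?n (S (r n) (y n)) \<le> ?n (S (r n) (x (Suc n)))" for n
  proof (rule ccontr)
    assume *: "\<not> ?thesis"
    have r0: "0 \<le> r n" using r(1)[of n] by simp
    have neg_S: "S (r n) (- w) = - S (r n) w" if "w \<in> ph \<alpha> \<delta>" for w
      using S_scl[OF r0 that, of "-1"] by (simp add: ph_scl_def scl_def uminus_prod_def fun_Compl_def)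
    have "S (r n) (x n + y n) - S (r n) (x n - y n) = S (r n) (y n) + S (r n) (y n)"
      using S_add[OF r0 x[of n] y(1)[of n]] S_add[OF r0 x[of n] ph_minus[OF y(1)[of n]]] neg_S[OF y(1)[of n]]
      by simp
    moreover have "?n (S (r n) (y n) + S (r n) (y n)) = 2 * ?n (S (r n) (y n))"
      using ph_norm_scl[of \<alpha> \<delta> 2 "S (r n) (y n)"]
      by (simp add: ph_scl_def scl_def plus_prod_def plus_fun_def)
    moreover have "S (r n) (x n + y n) \<in> ph \<alpha> \<delta>" "S (r n) (x n - y n) \<in> ph \<alpha> \<delta>"
      using S[OF r0] x[of n] y(1)[of n] ph_add ph_diff by blast+
    then have "?n (S (r n) (x n + y n) - S (r n) (x n - y n)) \<le> ?n (S (r n) (x n + y n)) + ?n (S (r n) (x n - y n))"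
      using ph_norm_triangle[of "S (r n) (x n + y n)" \<alpha> \<delta> "- S (r n) (x n - y n)"]
      by (simp add: ph_minus ph_norm_minus)
    ultimately show False using * by (auto simp: xS split: if_splits)
  qed
  define d where "d n = x (Suc n) - x n" for n
  have d: "d n \<in> ph \<alpha> \<delta>" "?n (d n) \<le> (1/8) ^ n" for n
    using y[of n] by (auto simp: d_def xS ph_minus ph_norm_minus)
  have d1: "fst (d n) \<in> hs \<alpha> \<delta>" "hs_norm \<alpha> \<delta> (fst (d n)) \<le> (1/8) ^ n"
    and d2: "snd (d n) \<in> hs \<alpha> (\<delta> - 1)" "hs_norm \<alpha> (\<delta> - 1) (snd (d n)) \<le> (1/8) ^ n" for n
    using d[of n] hs_norm_le_ph_norm[of \<alpha> \<delta> "d n"] by (auto simp: ph_def)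
  have sums: "summable (\<lambda>m. (1/8) ^ (m + n) :: real)" "(\<Sum>m. (1/8) ^ (m + n) :: real) = (8/7) * (1/8) ^ n" for n
    using sums_mult2[OF geometric_sums[of "1/8 :: real"], of "(1/8) ^ n"]
    by (auto simp: power_add sums_iff)
  define X where "X = ((\<lambda>k. \<Sum>n. fst (d n) k), (\<lambda>k. \<Sum>n. snd (d n) k))"
  note ser1 = hs_series[where \<alpha> = \<alpha> and \<delta> = \<delta> and x = "\<lambda>m. fst (d (m + n))" for n, OF pos d1 sums(1)]
  note ser2 = hs_series[where \<alpha> = \<alpha> and \<delta> = "\<delta> - 1" and x = "\<lambda>m. snd (d (m + n))" for n, OF pos d2 sums(1)]
  have tele: "(\<Sum>m<n. d m) = x n" for n
    unfolding d_def by (simp add: sum_lessThan_telescope x0)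
  have fst_sum: "fst (sum f A) k = (\<Sum>m\<in>A. fst (f m) k)" "snd (sum f A) k = (\<Sum>m\<in>A. snd (f m) k)"
    for f :: "nat \<Rightarrow> phase" and A k
    by (induction A rule: infinite_finite_induct) auto
  have tail: "fst (X - x n) = (\<lambda>k. \<Sum>m. fst (d (m + n)) k)" "snd (X - x n) = (\<lambda>k. \<Sum>m. snd (d (m + n)) k)" for n
    using suminf_minus_initial_segment[OF ser1(1)[of 0, simplified], of n]
      suminf_minus_initial_segment[OF ser2(1)[of 0, simplified], of n]
    by (simp_all add: X_def fun_eq_iff tele[symmetric] fst_sum)
  have Xx: "X - x n \<in> ph \<alpha> \<delta>" "?n (X - x n) \<le> 2 * ((8/7) * (1/8) ^ n)" for n
  proof -
    show "X - x n \<in> ph \<alpha> \<delta>"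
      unfolding ph_def mem_Times_iff tail using ser1(2)[of n] ser2(2)[of n] by simp
    show "?n (X - x n) \<le> 2 * ((8/7) * (1/8) ^ n)"
      using ph_norm_le_add[of \<alpha> \<delta> "X - x n"] ser1(3)[of n] ser2(3)[of n] unfolding tail sums(2) by simp
  qed
  have X: "X \<in> ph \<alpha> \<delta>" using Xx(1)[of 0] by (simp add: x0)
  (* Of the hump of height s/8^n, s = ph_norm (S (r n) (z n)), the tail of the series can destroy at
     most 2 s * 2 * (8/7) / 8^(n+1) = (4/7) s/8^n. *)
  have big: "(3/7) * (9/8) ^ n \<le> ?n (S (r n) X)" for n
  proof -
    have r0: "0 \<le> r n" using r(1)[of n] by simp
    let ?\<sigma> = "?n (S (r n) (z n))"
    have SX: "S (r n) X \<in> ph \<alpha> \<delta>" using S[OF r0] X by blast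
    have SXx: "S (r n) (X - x (Suc n)) \<in> ph \<alpha> \<delta>" using S[OF r0] Xx(1)[of "Suc n"] by blast
    have "S (r n) X = S (r n) (X - x (Suc n)) + S (r n) (x (Suc n))"
      using S_add[OF r0 Xx(1) x, of "Suc n" "Suc n"] by simp
    then have "?n (S (r n) (x (Suc n))) = ?n (S (r n) X + - S (r n) (X - x (Suc n)))"
      by simp
    also have "\<dots> \<le> ?n (S (r n) X) + ?n (S (r n) (X - x (Suc n)))"
      using ph_norm_triangle[OF SX ph_minus[OF SXx]] by (simp add: ph_norm_minus)
    also have "?n (S (r n) (X - x (Suc n))) \<le> 2 * ?\<sigma> * (2 * ((8/7) * (1/8) ^ Suc n))"
      using rz[OF Xx(1)] mult_left_mono[OF Xx(2), of "2 * ?\<sigma>"] by (meson mult_nonneg_nonneg order_trans ph_norm_nonneg zero_le_numeral)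
    finally have "(1/8) ^ n * ?\<sigma> \<le> ?n (S (r n) X) + 2 * ?\<sigma> * (2 * ((8/7) * (1/8) ^ Suc n))"
      using large[of n] y(3)[of n] by simp
    then have "(3/7) * ((1/8) ^ n * ?\<sigma>) \<le> ?n (S (r n) X)" by (simp add: algebra_simps)
    moreover have "(1/8) ^ n * 9 ^ n \<le> (1/8) ^ n * ?\<sigma>" using z(3)[of n] by (intro mult_left_mono) auto
    moreover have "(1/8) ^ n * 9 ^ n = (9/8 :: real) ^ n" by (simp flip: power_mult_distrib)
    ultimately show ?thesis by linarith
  qed
  have "r \<longlonglongrightarrow> 0"
    by (rule tendsto_sandwich[OF _ _ tendsto_const LIMSEQ_inverse_real_of_nat])
      (use r in \<open>auto simp: less_imp_le inverse_eq_divide\<close>)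
  then have "filterlim r (at_right 0) sequentially"
    using r(1) by (intro tendsto_imp_filterlim_at_right) auto
  from filterlim_compose[OF S_cont[OF X] this] have lim: "(\<lambda>n. ?n (S (r n) X - X)) \<longlonglongrightarrow> 0" .
  have "\<forall>\<^sub>F n in sequentially. (3/7) * (9/8) ^ n < 1 + ?n X"
  proof -
    have "\<forall>\<^sub>F n in sequentially. ?n (S (r n) X - X) < 1" using order_tendstoD(2)[OF lim] by simp
    then show ?thesis
    proof eventually_elim
      case (elim n)
      have "S (r n) X - X \<in> ph \<alpha> \<delta>" using S[of "r n"] r(1)[of n] X by (auto intro!: ph_diff)
      from ph_norm_triangle[OF this X] show ?case using elim big[of n] by simp
    qed
  qed
  moreover have "\<forall>\<^sub>F n in sequentially. (7/3) * (1 + ?n X) \<le> (9/8) ^ n"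
  proof -
    have "filterlim (\<lambda>n. (9/8 :: real) ^ n) at_infinity sequentially"
      by (rule filterlim_realpow_sequentially_gt1) simp
    then have "filterlim (\<lambda>n. (9/8 :: real) ^ n) at_top sequentially"
      by (rule filterlim_at_infinity_imp_filterlim_at_top) simp
    then show ?thesis unfolding filterlim_at_top by blast
  qed
  ultimately have "\<forall>\<^sub>F n in sequentially. False" by eventually_elim simp
  then show False by simp
qed


section \<open>The damped wave semigroup\<close>

locale wave_semigroup = spectrum +
  fixes \<mu> :: real and S :: "real \<Rightarrow> phase \<Rightarrow> phase"
  assumes \<mu>_pos: "0 < \<mu>"
    and gen: "\<And>\<delta>. ph_semigroup_generated_by \<alpha> \<delta> (ph \<alpha> (1 + \<delta>)) (A_mu \<alpha> \<mu>) S"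
begin

lemma S_mem: "t \<ge> 0 \<Longrightarrow> z \<in> ph \<alpha> \<delta> \<Longrightarrow> S t z \<in> ph \<alpha> \<delta>"
  and S_add: "t \<ge> 0 \<Longrightarrow> z \<in> ph \<alpha> \<delta> \<Longrightarrow> w \<in> ph \<alpha> \<delta> \<Longrightarrow> S t (z + w) = S t z + S t w"
  and S_scl: "t \<ge> 0 \<Longrightarrow> z \<in> ph \<alpha> \<delta> \<Longrightarrow> S t (ph_scl a z) = ph_scl a (S t z)"
  and S_bdd: "t \<ge> 0 \<Longrightarrow> \<exists>C. \<forall>z\<in>ph \<alpha> \<delta>. ph_norm \<alpha> \<delta> (S t z) \<le> C * ph_norm \<alpha> \<delta> z"
  and S_0: "z \<in> ph \<alpha> \<delta> \<Longrightarrow> S 0 z = z"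
  and S_plus: "s \<ge> 0 \<Longrightarrow> t \<ge> 0 \<Longrightarrow> z \<in> ph \<alpha> \<delta> \<Longrightarrow> S (s + t) z = S s (S t z)"
  and S_cont_0: "z \<in> ph \<alpha> \<delta> \<Longrightarrow> ((\<lambda>t. ph_norm \<alpha> \<delta> (S t z - z)) \<longlongrightarrow> 0) (at_right 0)"
  using gen[of \<delta>] unfolding ph_semigroup_generated_by_def by blast+

lemma A_mu_mem: "z \<in> ph \<alpha> 0 \<Longrightarrow> A_mu \<alpha> \<mu> z \<in> ph \<alpha> (-1)"
proof -
  assume z: "z \<in> ph \<alpha> 0"
  have "\<alpha> k powr (- 2) * (lap \<alpha> (fst z) k)\<^sup>2 = \<alpha> k powr 0 * (fst z k)\<^sup>2" for k
    using powr_realpow[OF \<alpha>_pos[of k], of 2]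
    by (simp add: lap_def power_mult_distrib powr_minus divide_simps)
  then have "lap \<alpha> (fst z) \<in> hs \<alpha> (- 2)"
    using z by (simp add: ph_def hs_def mem_Times_iff)
  moreover have "snd z \<in> hs \<alpha> (- 2)"
    using hs_mono(1)[of "- 2" "- 1" "snd z"] z by (simp add: ph_def mem_Times_iff)
  ultimately show "A_mu \<alpha> \<mu> z \<in> ph \<alpha> (-1)"
    using z by (auto simp: ph_def A_mu_def intro!: hs_diff hs_scl)
qed

text \<open>As \<open>\<H>\<^sub>0\<close> is the domain of the generator on \<open>\<H>\<^sub>-\<^sub>1\<close>, difference quotients converge in the weaker
  norm; for statements about single coordinates that is good enough.\<close>

lemma S_deriv_0:
  assumes "z \<in> ph \<alpha> 0"
  shows "((\<lambda>t. ph_norm \<alpha> (-1) (ph_scl (1 / t) (S t z - z) - A_mu \<alpha> \<mu> z)) \<longlongrightarrow> 0) (at_right 0)"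
proof -
  have "z \<in> ph \<alpha> (1 + (-1))" "z \<in> ph \<alpha> (-1)" using assms ph_mono[of "-1" 0 z] by simp_all
  then show ?thesis
    using gen[of "-1"] A_mu_mem[OF assms] unfolding ph_semigroup_generated_by_def by blast
qed

lemma S_bounded_on_intervals:
  "\<exists>K. \<forall>t z. 0 \<le> t \<longrightarrow> t \<le> T \<longrightarrow> z \<in> ph \<alpha> 0 \<longrightarrow> ph_norm \<alpha> 0 (S t z) \<le> K * ph_norm \<alpha> 0 z"
proof -
  let ?n = "ph_norm \<alpha> 0"
  have "\<exists>K \<eta>. \<eta> > 0 \<and> (\<forall>t z. 0 < t \<longrightarrow> t \<le> \<eta> \<longrightarrow> z \<in> ph \<alpha> 0 \<longrightarrow> ?n (S t z) \<le> K * ?n z)"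
    by (rule locally_bounded_at_0) (auto simp: S_mem S_scl S_bdd S_cont_0 intro: S_add)
  then obtain K \<eta> where \<eta>: "\<eta> > 0"
    and K: "\<And>t z. 0 < t \<Longrightarrow> t \<le> \<eta> \<Longrightarrow> z \<in> ph \<alpha> 0 \<Longrightarrow> ?n (S t z) \<le> K * ?n z"
    by blast
  define L where "L = max 1 K"
  have L: "1 \<le> L" by (simp add: L_def)
  have small: "?n (S t z) \<le> L * ?n z" if "0 \<le> t" "t \<le> \<eta>" "z \<in> ph \<alpha> 0" for t z
  proof (cases "t = 0")
    case True
    then show ?thesis using S_0[OF that(3)] mult_right_mono[OF L ph_norm_nonneg[of \<alpha> 0 z]] by simp
  next
    case False
    then have "?n (S t z) \<le> K * ?n z" using K that by simp
    also have "\<dots> \<le> L * ?n z" by (intro mult_right_mono) (auto simp: L_def)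
    finally show ?thesis .
  qed
  have *: "?n (S t z) \<le> L ^ n * ?n z" if "0 \<le> t" "t \<le> real n * \<eta>" "z \<in> ph \<alpha> 0" for n t z
    using that
  proof (induction n arbitrary: t)
    case 0
    then show ?case using S_0[OF 0(3)] by simp
  next
    case (Suc n)
    show ?case
    proof (cases "t \<le> \<eta>")
      case True
      have "L * ?n z \<le> L ^ Suc n * ?n z"
        using L by (intro mult_right_mono) (auto simp: one_le_power mult_le_cancel_left1)
      then show ?thesis using small[OF Suc.prems(1) True Suc.prems(3)] by linarith
    next
      case False
      then have t: "0 \<le> t - \<eta>" "t - \<eta> \<le> real n * \<eta>" using Suc.prems by (auto simp: algebra_simps)
      have "S t z = S \<eta> (S (t - \<eta>) z)"
        using S_plus[of \<eta> "t - \<eta>" z 0] t(1) \<eta> Suc.prems(3) by simp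
      then have "?n (S t z) \<le> L * ?n (S (t - \<eta>) z)"
        using small[of \<eta> "S (t - \<eta>) z"] \<eta> S_mem[OF t(1) Suc.prems(3)] by simp
      also have "\<dots> \<le> L * (L ^ n * ?n z)"
        using L by (intro mult_left_mono Suc.IH[OF t Suc.prems(3)]) auto
      finally show ?thesis by simp
    qed
  qed
  obtain n where "T \<le> real n * \<eta>" using reals_Archimedean3[OF \<eta>] less_imp_le by blast
  then show ?thesis using * by (meson order_trans)
qed

text \<open>Left continuity at \<open>t\<close> needs the bound on intervals:
  \<open>S t z - S (t - h) z\<close> is the image under \<open>S (t - h)\<close> of the small vector \<open>S h z - z\<close>.\<close>

lemma S_uniformly_continuous:
  assumes z: "z \<in> ph \<alpha> 0" and "\<epsilon> > 0"
  shows "\<exists>d>0. \<forall>s t. 0 \<le> s \<longrightarrow> s \<le> t \<longrightarrow> t \<le> T \<longrightarrow> t - s < d \<longrightarrow> ph_norm \<alpha> 0 (S t z - S s z) < \<epsilon>"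
proof -
  let ?n = "ph_norm \<alpha> 0"
  obtain K where K: "\<And>t z. 0 \<le> t \<Longrightarrow> t \<le> T \<Longrightarrow> z \<in> ph \<alpha> 0 \<Longrightarrow> ?n (S t z) \<le> K * ?n z"
    using S_bounded_on_intervals[of T] by blast
  define L where "L = max 1 K"
  have L: "L > 0" by (simp add: L_def)
  have "\<forall>\<^sub>F h in at_right 0. ?n (S h z - z) < \<epsilon> / L"
    using order_tendstoD(2)[OF S_cont_0[OF z]] \<open>\<epsilon> > 0\<close> L by simp
  then obtain d where d: "d > 0" "\<And>h. 0 < h \<Longrightarrow> h < d \<Longrightarrow> ?n (S h z - z) < \<epsilon> / L"
    by (auto simp: eventually_at_right_field)
  have "?n (S t z - S s z) < \<epsilon>" if "0 \<le> s" "s \<le> t" "t \<le> T" "t - s < d" for s t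
  proof (cases "s = t")
    case False
    have h: "0 \<le> t - s" using that by simp
    have mem: "S (t - s) z - z \<in> ph \<alpha> 0" using S_mem[OF h z] z by (rule ph_diff)
    have "S t z = S s (S (t - s) z)" using S_plus[OF that(1) h z] by simp
    also have "\<dots> = S s (S (t - s) z - z) + S s z"
      using S_add[OF that(1) mem z] by simp
    finally have "?n (S t z - S s z) = ?n (S s (S (t - s) z - z))" by simp
    also have "\<dots> \<le> K * ?n (S (t - s) z - z)" using K[OF _ _ mem] that by simp
    also have "\<dots> \<le> L * ?n (S (t - s) z - z)" by (intro mult_right_mono) (auto simp: L_def)
    also have "\<dots> < \<epsilon>" using d(2)[of "t - s"] that False L by (simp add: field_simps)
    finally show ?thesis .
  qed (use \<open>\<epsilon> > 0\<close> in simp)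
  then show ?thesis using d(1) by blast
qed

lemma continuous_coordinate:
  fixes \<pi> :: "phase \<Rightarrow> real"
  assumes \<pi>: "\<And>w. w \<in> ph \<alpha> 0 \<Longrightarrow> \<bar>\<pi> w\<bar> \<le> C * ph_norm \<alpha> 0 w" "\<And>w w'. \<pi> (w - w') = \<pi> w - \<pi> w'"
    and C: "C > 0" and z: "z \<in> ph \<alpha> 0"
  shows "continuous_on {0..} (\<lambda>t. \<pi> (S t z))"
  unfolding continuous_on_iff
proof (intro ballI allI impI)
  fix s \<epsilon> :: real assume s: "s \<in> {0..}" and e: "\<epsilon> > 0"
  obtain d where d: "d > 0" "\<And>r t. 0 \<le> r \<Longrightarrow> r \<le> t \<Longrightarrow> t \<le> s + 1 \<Longrightarrow> t - r < d \<Longrightarrow> ph_norm \<alpha> 0 (S t z - S r z) < \<epsilon> / C"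
    using S_uniformly_continuous[OF z, of "\<epsilon> / C" "s + 1"] e C by auto
  have close: "\<bar>\<pi> (S t z) - \<pi> (S r z)\<bar> < \<epsilon>" if "0 \<le> r" "r \<le> t" "t \<le> s + 1" "t - r < d" for r t
  proof -
    have "S t z - S r z \<in> ph \<alpha> 0" using that z by (intro ph_diff S_mem) auto
    from \<pi>(1)[OF this] d(2)[OF that] C show ?thesis by (simp add: \<pi>(2) field_simps)
  qed
  show "\<exists>d>0. \<forall>t\<in>{0..}. dist t s < d \<longrightarrow> dist (\<pi> (S t z)) (\<pi> (S s z)) < \<epsilon>"
  proof (intro exI[of _ "min d 1"] conjI ballI impI)
    fix t assume "t \<in> {0..}" "dist t s < min d 1"
    then show "dist (\<pi> (S t z)) (\<pi> (S s z)) < \<epsilon>"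
      using close[of s t] close[of t s] s by (cases "s \<le> t") (auto simp: dist_real_def abs_minus_commute)
  qed (use d in simp)
qed

lemma right_derivative_coordinate:
  fixes \<pi> :: "phase \<Rightarrow> real"
  assumes \<pi>: "\<And>w. w \<in> ph \<alpha> (-1) \<Longrightarrow> \<bar>\<pi> w\<bar> \<le> C * ph_norm \<alpha> (-1) w" "\<And>w w'. \<pi> (w - w') = \<pi> w - \<pi> w'"
      "\<And>a w. \<pi> (ph_scl a w) = a * \<pi> w"
    and z: "z \<in> ph \<alpha> 0" and t: "0 \<le> t"
  shows "((\<lambda>t. \<pi> (S t z)) has_real_derivative \<pi> (A_mu \<alpha> \<mu> (S t z))) (at_right t)"
proof -
  let ?w = "S t z"
  have w: "?w \<in> ph \<alpha> 0" by (rule S_mem[OF t z])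
  have "((\<lambda>h. (\<pi> (S (h + t) z) - \<pi> ?w) / h - \<pi> (A_mu \<alpha> \<mu> ?w)) \<longlongrightarrow> 0) (at_right 0)"
  proof (rule Lim_null_comparison)
    show "((\<lambda>h. C * ph_norm \<alpha> (-1) (ph_scl (1 / h) (S h ?w - ?w) - A_mu \<alpha> \<mu> ?w)) \<longlongrightarrow> 0) (at_right 0)"
      using tendsto_mult_right_zero[OF S_deriv_0[OF w]] .
    show "\<forall>\<^sub>F h in at_right 0. norm ((\<pi> (S (h + t) z) - \<pi> ?w) / h - \<pi> (A_mu \<alpha> \<mu> ?w))
        \<le> C * ph_norm \<alpha> (-1) (ph_scl (1 / h) (S h ?w - ?w) - A_mu \<alpha> \<mu> ?w)"
      using eventually_at_right_less[of 0]
    proof eventually_elim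
      case (elim h)
      have "ph_scl (1 / h) (S h ?w - ?w) - A_mu \<alpha> \<mu> ?w \<in> ph \<alpha> (-1)"
        using elim t ph_mono[of "-1" 0, OF _ z] A_mu_mem[OF w] by (intro ph_diff ph_scl_mem S_mem) auto
      from \<pi>(1)[OF this] show ?case
        using S_plus[of h t z 0] elim t z by (simp add: \<pi>)
    qed
  qed
  then have "((\<lambda>h. (\<pi> (S (h + t) z) - \<pi> ?w) / h) \<longlongrightarrow> \<pi> (A_mu \<alpha> \<mu> ?w)) (at_right 0)"
    by (simp add: LIM_zero_iff)
  then show ?thesis
    unfolding has_field_derivative_iff by (subst filterlim_at_right_to_0) simp
qed

text \<open>Every coordinate of an orbit solves \<open>\<mu>u'' + u' + \<alpha>\<^sub>ku = 0\<close>, for all starting points in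
  \<open>\<H>\<^sub>0\<close>: these form the domain of the generator of the same semigroup on \<open>\<H>\<^sub>-\<^sub>1\<close>.\<close>

lemma orbit_ode:
  assumes z: "z \<in> ph \<alpha> 0"
  shows "continuous_on {0..} (\<lambda>t. fst (S t z) k)" "continuous_on {0..} (\<lambda>t. snd (S t z) k)"
    and "0 < t \<Longrightarrow> ((\<lambda>t. fst (S t z) k) has_real_derivative snd (S t z) k) (at t)"
    and "0 < t \<Longrightarrow> ((\<lambda>t. snd (S t z) k) has_real_derivative
          - (\<alpha> k * fst (S t z) k + snd (S t z) k) / \<mu>) (at t)"
proof -
  note c = ph_coord_abs_le[of \<alpha> k, OF \<alpha>_pos]
  show c1: "continuous_on {0..} (\<lambda>t. fst (S t z) k)"
    by (rule continuous_coordinate[where \<pi> = "\<lambda>z. fst z k" and C = "1 / sqrt (\<alpha> k powr 0)"])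
      (use z c(1)[of _ 0] in simp_all)
  show c2: "continuous_on {0..} (\<lambda>t. snd (S t z) k)"
    by (rule continuous_coordinate[where \<pi> = "\<lambda>z. snd z k" and C = "1 / sqrt (\<alpha> k powr (0 - 1))"])
      (use z c(2)[of _ 0] in simp_all)
  have d1: "((\<lambda>t. fst (S t z) k) has_real_derivative snd (S t z) k) (at_right t)" if "0 \<le> t" for t
    using right_derivative_coordinate[where \<pi> = "\<lambda>z. fst z k" and C = "1 / sqrt (\<alpha> k powr (-1))", OF _ _ _ z that]
      c(1)[of _ "-1"] by (simp add: ph_scl_def scl_def A_mu_def)
  have d2: "((\<lambda>t. snd (S t z) k) has_real_derivative - (\<alpha> k * fst (S t z) k + snd (S t z) k) / \<mu>) (at_right t)"
    if "0 \<le> t" for t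
  proof -
    have "snd (A_mu \<alpha> \<mu> (S t z)) k = - (\<alpha> k * fst (S t z) k + snd (S t z) k) / \<mu>"
      using \<mu>_pos by (simp add: A_mu_def scl_def lap_def field_simps)
    then show ?thesis
      using right_derivative_coordinate[where \<pi> = "\<lambda>z. snd z k" and C = "1 / sqrt (\<alpha> k powr (-2))", OF _ _ _ z that]
        c(2)[of _ "-1"] by (simp add: ph_scl_def scl_def)
  qed
  show "0 < t \<Longrightarrow> ((\<lambda>t. fst (S t z) k) has_real_derivative snd (S t z) k) (at t)"
    by (rule right_derivative_imp_derivative[OF c1 c2 d1])
  show "0 < t \<Longrightarrow> ((\<lambda>t. snd (S t z) k) has_real_derivative
      - (\<alpha> k * fst (S t z) k + snd (S t z) k) / \<mu>) (at t)"
    using \<mu>_pos by (intro right_derivative_imp_derivative[OF c2 _ d2]) (auto intro!: continuous_intros c1 c2)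
qed

end

section \<open>A single damped oscillator\<close>

definition damped_oscillator :: "real \<Rightarrow> real \<Rightarrow> (real \<Rightarrow> real) \<Rightarrow> (real \<Rightarrow> real) \<Rightarrow> bool" where
  "damped_oscillator \<mu> a u v \<longleftrightarrow> continuous_on {0..} u \<and> continuous_on {0..} v \<and>
     (\<forall>t>0. (u has_real_derivative v t) (at t) \<and> (v has_real_derivative - (a * u t + v t) / \<mu>) (at t))"

lemma damped_oscillatorD:
  assumes "damped_oscillator \<mu> a u v"
  shows "continuous_on {0..} u" "continuous_on {0..} v"
    and "0 < t \<Longrightarrow> (u has_real_derivative v t) (at t)"
    and "0 < t \<Longrightarrow> (v has_real_derivative - (a * u t + v t) / \<mu>) (at t)"
  using assms by (auto simp: damped_oscillator_def)

lemma damped_oscillator_add: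
  assumes "damped_oscillator \<mu> a u v" "damped_oscillator \<mu> a u' v'"
  shows "damped_oscillator \<mu> a (\<lambda>t. u t + u' t) (\<lambda>t. v t + v' t)"
  unfolding damped_oscillator_def
  by (auto intro!: continuous_intros derivative_eq_intros damped_oscillatorD[OF assms(1)]
      damped_oscillatorD[OF assms(2)] simp: algebra_simps add_divide_distrib diff_divide_distrib)

lemma damped_oscillator_cmult:
  assumes "damped_oscillator \<mu> a u v"
  shows "damped_oscillator \<mu> a (\<lambda>t. c * u t) (\<lambda>t. c * v t)"
  unfolding damped_oscillator_def
  by (auto intro!: continuous_intros derivative_eq_intros damped_oscillatorD[OF assms]
      simp: algebra_simps add_divide_distrib diff_divide_distrib)

text \<open>The energy is dissipated by friction only.\<close>

lemma damped_oscillator_energy: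
  assumes d: "damped_oscillator \<mu> a u v" and \<mu>: "0 < \<mu>" and t: "0 \<le> t"
  shows "((\<lambda>s. 2 * (v s)\<^sup>2) has_integral (a * (u 0)\<^sup>2 + \<mu> * (v 0)\<^sup>2 - (a * (u t)\<^sup>2 + \<mu> * (v t)\<^sup>2))) {0..t}"
    and "a * (u t)\<^sup>2 + \<mu> * (v t)\<^sup>2 \<le> a * (u 0)\<^sup>2 + \<mu> * (v 0)\<^sup>2"
proof -
  note D = damped_oscillatorD[OF d]
  let ?E = "\<lambda>s. a * (u s)\<^sup>2 + \<mu> * (v s)\<^sup>2"
  have sub: "{0..t} \<subseteq> {0..}" by auto
  have deriv: "((\<lambda>s. - ?E s) has_vector_derivative 2 * (v s)\<^sup>2) (at s)" if "s \<in> {0<..<t}" for s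
    unfolding has_real_derivative_iff_has_vector_derivative[symmetric]
    using that \<mu> by (auto intro!: derivative_eq_intros D simp: field_simps power2_eq_square)
  have "((\<lambda>s. 2 * (v s)\<^sup>2) has_integral (- ?E t - (- ?E 0))) {0..t}"
    by (rule fundamental_theorem_of_calculus_interior[OF t _ deriv])
      (auto intro!: continuous_intros continuous_on_subset[OF D(1) sub] continuous_on_subset[OF D(2) sub])
  then show *: "((\<lambda>s. 2 * (v s)\<^sup>2) has_integral (?E 0 - ?E t)) {0..t}" by (simp add: algebra_simps)
  from has_integral_nonneg[OF this] show "?E t \<le> ?E 0" by simp
qed

text \<open>None of these bounds degenerates as \<open>\<mu> \<rightarrow> 0\<close>, except the pointwise one for the velocity; where
  uniformity in \<open>\<mu>\<close> matters, the velocity is therefore measured in mean square.\<close>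

lemma damped_oscillator_bounds:
  assumes d: "damped_oscillator \<mu> a u v" and \<mu>: "0 < \<mu>" and a: "0 < a" and t: "0 \<le> t"
  defines "E \<equiv> a * (u 0)\<^sup>2 + \<mu> * (v 0)\<^sup>2"
  shows "(u t)\<^sup>2 \<le> E / a" "(v t)\<^sup>2 \<le> E / \<mu>" "integral {0..t} (\<lambda>s. (v s)\<^sup>2) \<le> E / 2"
proof -
  note e = damped_oscillator_energy[OF d \<mu> t]
  have E: "a * (u t)\<^sup>2 + \<mu> * (v t)\<^sup>2 \<le> E" using e(2) by (simp add: E_def)
  have nn: "0 \<le> a * (u t)\<^sup>2" "0 \<le> \<mu> * (v t)\<^sup>2" using \<mu> a by simp_all
  have "a * (u t)\<^sup>2 \<le> E" "\<mu> * (v t)\<^sup>2 \<le> E" using E nn by linarith+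
  then show "(u t)\<^sup>2 \<le> E / a" "(v t)\<^sup>2 \<le> E / \<mu>" using \<mu> a by (simp_all add: field_simps)
  have "((\<lambda>s. (v s)\<^sup>2) has_integral ((E - (a * (u t)\<^sup>2 + \<mu> * (v t)\<^sup>2)) / 2)) {0..t}"
    using has_integral_divide[OF e(1), of 2] by (simp add: E_def)
  then show "integral {0..t} (\<lambda>s. (v s)\<^sup>2) \<le> E / 2"
    using nn by (auto dest!: integral_unique)
qed

lemma damped_oscillator_unique:
  assumes "damped_oscillator \<mu> a u v" "0 < \<mu>" "0 < a" "0 \<le> t" "u 0 = 0" "v 0 = 0"
  shows "u t = 0" "v t = 0"
  using damped_oscillator_bounds(1,2)[OF assms(1-4)] assms(5,6) by auto


section \<open>The fundamental solution of every mode\<close>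

context wave_semigroup
begin

text \<open>Position and velocity of the \<open>k\<close>-th mode when it is started at position \<open>0\<close> with unit velocity:
  the second column of the fundamental matrix of \<open>\<mu>u'' + u' + \<alpha>\<^sub>ku = 0\<close>.\<close>

definition g :: "nat \<Rightarrow> real \<Rightarrow> real" where
  "g k t = fst (S t (0, unit_coeffs k)) k"

definition p :: "nat \<Rightarrow> real \<Rightarrow> real" where
  "p k t = snd (S t (0, unit_coeffs k)) k"

lemma orbit_oscillator:
  "z \<in> ph \<alpha> 0 \<Longrightarrow> damped_oscillator \<mu> (\<alpha> k) (\<lambda>t. fst (S t z) k) (\<lambda>t. snd (S t z) k)"
  unfolding damped_oscillator_def using orbit_ode[of z] by auto

lemma velocity_mem: "v \<in> hs \<alpha> (-1) \<Longrightarrow> (0, v) \<in> ph \<alpha> 0"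
  by (simp add: ph_def)

lemma g_p_oscillator: "damped_oscillator \<mu> (\<alpha> k) (g k) (p k)"
  using orbit_oscillator[OF velocity_mem[OF unit_coeffs_mem]] unfolding g_def p_def .

lemma g_0 [simp]: "g k 0 = 0" and p_0 [simp]: "p k 0 = 1"
  using S_0[OF velocity_mem[OF unit_coeffs_mem]] by (simp_all add: g_def p_def unit_coeffs_def)

lemma g_bound: "0 \<le> t \<Longrightarrow> (g k t)\<^sup>2 \<le> \<mu> / \<alpha> k"
  using damped_oscillator_bounds(1)[OF g_p_oscillator \<mu>_pos \<alpha>_pos, of t k] by simp

text \<open>The semigroup acts diagonally: both sides are oscillators with the same initial values.\<close>

lemma S_velocity:
  assumes v: "v \<in> hs \<alpha> (-1)" and t: "0 \<le> t"
  shows "fst (S t (0, v)) k = g k t * v k" "snd (S t (0, v)) k = p k t * v k"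
proof -
  have mem: "(0, v) \<in> ph \<alpha> 0" by (rule velocity_mem[OF v])
  have "damped_oscillator \<mu> (\<alpha> k) (\<lambda>t. fst (S t (0, v)) k + (- v k) * g k t) (\<lambda>t. snd (S t (0, v)) k + (- v k) * p k t)"
    by (intro damped_oscillator_add damped_oscillator_cmult orbit_oscillator mem g_p_oscillator)
  from damped_oscillator_unique[OF this \<mu>_pos \<alpha>_pos t] S_0[OF mem]
  show "fst (S t (0, v)) k = g k t * v k" "snd (S t (0, v)) k = p k t * v k"
    by (simp_all add: mult.commute)
qed

lemma S_zero: "0 \<le> t \<Longrightarrow> S t 0 = 0"
  using S_velocity[of 0 t] by (simp add: zero_prod_def prod_eq_iff fun_eq_iff)

text \<open>The first column of the fundamental matrix is determined by the second one.\<close>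

lemma free_oscillator:
  "damped_oscillator \<mu> (\<alpha> k) (\<lambda>t. (p k t + g k t / \<mu>) * a + g k t * b) (\<lambda>t. - \<alpha> k * g k t / \<mu> * a + p k t * b)"
proof -
  note D = damped_oscillatorD[OF g_p_oscillator[of k]]
  have "damped_oscillator \<mu> (\<alpha> k) (\<lambda>t. p k t + g k t / \<mu>) (\<lambda>t. - \<alpha> k * g k t / \<mu>)"
    unfolding damped_oscillator_def using \<mu>_pos
    by (auto intro!: continuous_intros derivative_eq_intros D simp: field_simps)
  from damped_oscillator_add[OF damped_oscillator_cmult[OF this, where c = a] damped_oscillator_cmult[OF g_p_oscillator, where c = b]]
  show ?thesis by (simp add: mult.commute)
qed

text \<open>Variation of constants: each integrand is the derivative of the corresponding
  row of the fundamental matrix at time \<open>t - s\<close>, applied to \<open>(w s, w1 s)\<close>.\<close>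

lemma duhamel:
  fixes k :: nat and t :: real and w w1 w2 :: "real \<Rightarrow> real"
  assumes t: "0 \<le> t" and w: "continuous_on {0..t} w" "continuous_on {0..t} w1" "w 0 = 0" "w1 0 = 0"
    and dw: "\<And>s. 0 < s \<Longrightarrow> s < t \<Longrightarrow> (w has_real_derivative w1 s) (at s)"
    and dw1: "\<And>s. 0 < s \<Longrightarrow> s < t \<Longrightarrow> (w1 has_real_derivative w2 s) (at s)"
  defines "f \<equiv> \<lambda>s. (\<mu> * w2 s + w1 s + \<alpha> k * w s) / \<mu>"
  shows "((\<lambda>s. g k (t - s) * f s) has_integral w t) {0..t}" "((\<lambda>s. p k (t - s) * f s) has_integral w1 t) {0..t}"
proof -
  note D = damped_oscillatorD[OF g_p_oscillator[of k]]
  have c: "continuous_on {0..t} (\<lambda>s. g k (t - s))" "continuous_on {0..t} (\<lambda>s. p k (t - s))"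
    by (auto intro!: continuous_on_compose2[OF D(1)] continuous_on_compose2[OF D(2)] continuous_intros)
  have i: "((\<lambda>s. t - s) has_real_derivative - 1) (at s)" for s
    by (auto intro!: derivative_eq_intros)
  have dg: "((\<lambda>s. g k (t - s)) has_real_derivative - p k (t - s)) (at s)"
    and dp: "((\<lambda>s. p k (t - s)) has_real_derivative (\<alpha> k * g k (t - s) + p k (t - s)) / \<mu>) (at s)" if "s < t" for s
    using DERIV_chain2[where f = "g k" and g = "\<lambda>s. t - s", OF D(3) i]
      DERIV_chain2[where f = "p k" and g = "\<lambda>s. t - s", OF D(4) i] that
    by (simp_all add: minus_divide_left add.commute)
  have c1: "continuous_on {0..t} (\<lambda>s. p k (t - s) * w s + g k (t - s) * (w s / \<mu> + w1 s))"
    and c2: "continuous_on {0..t} (\<lambda>s. - \<alpha> k * g k (t - s) * w s / \<mu> + p k (t - s) * w1 s)"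
    using w \<mu>_pos by (auto intro!: continuous_intros c)
  have "((\<lambda>s. p k (t - s) * w s + g k (t - s) * (w s / \<mu> + w1 s)) has_vector_derivative g k (t - s) * f s) (at s)"
    if "s \<in> {0<..<t}" for s
    unfolding has_real_derivative_iff_has_vector_derivative[symmetric] f_def
    using that \<mu>_pos by (auto intro!: derivative_eq_intros dg dp dw dw1 simp: field_simps)
  from fundamental_theorem_of_calculus_interior[OF t c1 this]
  show "((\<lambda>s. g k (t - s) * f s) has_integral w t) {0..t}"
    using w by simp
  have "((\<lambda>s. - \<alpha> k * g k (t - s) * w s / \<mu> + p k (t - s) * w1 s) has_vector_derivative p k (t - s) * f s) (at s)"
    if "s \<in> {0<..<t}" for s
    unfolding has_real_derivative_iff_has_vector_derivative[symmetric] f_def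
    using that \<mu>_pos by (auto intro!: derivative_eq_intros dg dp dw dw1 simp: field_simps)
  from fundamental_theorem_of_calculus_interior[OF t c2 this]
  show "((\<lambda>s. p k (t - s) * f s) has_integral w1 t) {0..t}"
    using w by simp
qed

end


section \<open>A cutoff in time\<close>

lemma DERIV_max_power:
  assumes "n > 0"
  shows "((\<lambda>x::real. max 0 x ^ Suc n) has_real_derivative real (Suc n) * max 0 x ^ n) (at x)"
proof -
  consider "x > 0" | "x < 0" | "x = 0" by linarith
  then show ?thesis
  proof cases
    case 1
    have "((\<lambda>x::real. x ^ Suc n) has_real_derivative real (Suc n) * max 0 x ^ n) (at x)"
      using 1 DERIV_pow[of "Suc n" x] by (simp add: max_def)
    then show ?thesis
      by (rule has_field_derivative_transform_within_open[where S = "{0<..}"]) (use 1 in auto)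
  next
    case 2
    have "((\<lambda>x::real. 0) has_real_derivative real (Suc n) * max 0 x ^ n) (at x)"
      using 2 assms by (simp add: max_def zero_power)
    then show ?thesis
      by (rule has_field_derivative_transform_within_open[where S = "{..<0}"]) (use 2 in auto)
  next
    case 3
    have "((\<lambda>y::real. max 0 y ^ Suc n / y) \<longlongrightarrow> 0) (at 0)"
    proof (rule Lim_null_comparison)
      show "((\<lambda>y::real. \<bar>y\<bar> ^ n) \<longlongrightarrow> 0) (at 0)"
        using assms by (auto intro!: tendsto_eq_intros)
      show "\<forall>\<^sub>F y::real in at 0. norm (max 0 y ^ Suc n / y) \<le> \<bar>y\<bar> ^ n"
        by (auto simp: eventually_at max_def intro!: exI[of _ 1])
    qed
    then show ?thesis using 3 assms by (simp add: has_field_derivative_iff zero_power)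
  qed
qed

text \<open>A twice continuously differentiable cutoff that joins \<open>1\<close> with zero slope at time \<open>0\<close> to rest at
  time \<open>1\<close>.\<close>

definition cutoff :: "real \<Rightarrow> real" where
  "cutoff s = max 0 (1 - s\<^sup>2) ^ 3"

definition cutoff1 :: "real \<Rightarrow> real" where
  "cutoff1 s = - 6 * s * max 0 (1 - s\<^sup>2) ^ 2"

definition cutoff2 :: "real \<Rightarrow> real" where
  "cutoff2 s = 24 * s\<^sup>2 * max 0 (1 - s\<^sup>2) - 6 * max 0 (1 - s\<^sup>2) ^ 2"

lemma DERIV_cutoff: "(cutoff has_real_derivative cutoff1 s) (at s)"
  and DERIV_cutoff1: "(cutoff1 has_real_derivative cutoff2 s) (at s)"
proof -
  have i: "((\<lambda>s::real. 1 - s\<^sup>2) has_real_derivative - 2 * s) (at s)"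
    by (auto intro!: derivative_eq_intros)
  show "(cutoff has_real_derivative cutoff1 s) (at s)"
    unfolding cutoff_def cutoff1_def
    using DERIV_chain2[OF DERIV_max_power[of 2] i] by (simp add: numeral_eq_Suc mult_ac)
  have "((\<lambda>s. max 0 (1 - s\<^sup>2) ^ 2) has_real_derivative 2 * max 0 (1 - s\<^sup>2) * (- 2 * s)) (at s)"
    using DERIV_chain2[OF DERIV_max_power[of 1] i] by (simp add: numeral_eq_Suc mult_ac)
  from DERIV_mult[OF DERIV_cmult[OF DERIV_ident, of "-6"] this]
  show "(cutoff1 has_real_derivative cutoff2 s) (at s)"
    unfolding cutoff1_def cutoff2_def by (simp add: power2_eq_square algebra_simps)
qed

lemma cutoff_0 [simp]: "cutoff 0 = 1" "cutoff1 0 = 0"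
  by (simp_all add: cutoff_def cutoff1_def)

lemma cutoff_late [simp]: "1 \<le> s \<Longrightarrow> cutoff s = 0" "1 \<le> s \<Longrightarrow> cutoff1 s = 0" "1 \<le> s \<Longrightarrow> cutoff2 s = 0"
  using one_le_power[of s 2] by (simp_all add: cutoff_def cutoff1_def cutoff2_def)

lemma cutoff_bounds:
  assumes "0 \<le> s"
  shows "\<bar>cutoff s\<bar> \<le> 1" "\<bar>cutoff1 s\<bar> \<le> 6" "\<bar>cutoff2 s\<bar> \<le> 30"
proof -
  define m where "m = max 0 (1 - s\<^sup>2)"
  have m: "0 \<le> m" "m \<le> 1" by (simp_all add: m_def)
  have m2: "0 \<le> m\<^sup>2" "m\<^sup>2 \<le> 1" "0 \<le> m ^ 3" "m ^ 3 \<le> 1" using m by (simp_all add: power_le_one)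
  have "\<bar>cutoff s\<bar> \<le> 1 \<and> \<bar>cutoff1 s\<bar> \<le> 6 \<and> \<bar>cutoff2 s\<bar> \<le> 30"
  proof (cases "s \<le> 1")
    case True
    have s2: "0 \<le> s\<^sup>2" "s\<^sup>2 \<le> 1" using True assms by (simp_all add: power_le_one)
    have "s * m\<^sup>2 \<le> 1 * 1" "s\<^sup>2 * m \<le> 1 * 1" using True assms m m2 s2 by (intro mult_mono; simp)+
    moreover have "0 \<le> s * m\<^sup>2" "0 \<le> s\<^sup>2 * m" using assms m by simp_all
    moreover have "cutoff s = m ^ 3" "cutoff1 s = - 6 * (s * m\<^sup>2)" "cutoff2 s = 24 * (s\<^sup>2 * m) - 6 * m\<^sup>2"
      by (simp_all add: cutoff_def cutoff1_def cutoff2_def m_def)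
    ultimately show ?thesis using m2 unfolding abs_le_iff by linarith
  qed simp
  then show "\<bar>cutoff s\<bar> \<le> 1" "\<bar>cutoff1 s\<bar> \<le> 6" "\<bar>cutoff2 s\<bar> \<le> 30" by simp_all
qed

lemma continuous_cutoff: "continuous_on A cutoff" "continuous_on A cutoff1" "continuous_on A cutoff2"
  unfolding cutoff_def[abs_def] cutoff1_def[abs_def] cutoff2_def[abs_def] by (intro continuous_intros)+

section \<open>Continuous paths and square-integrable controls\<close>

lemma continuous_map_to_Metric_space_iff:
  fixes z :: "real \<Rightarrow> 'b"
  assumes "Metric_space M d"
  shows "continuous_map (top_of_set {a..b}) (Metric_space.mtopology M d) z \<longleftrightarrow>
    (\<forall>t\<in>{a..b}. z t \<in> M \<and> (\<forall>\<epsilon>>0. \<exists>\<eta>>0. \<forall>s\<in>{a..b}. \<bar>s - t\<bar> < \<eta> \<longrightarrow> d (z t) (z s) < \<epsilon> \<and> z s \<in> M))"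
proof -
  interpret Metric_space M d by fact
  have "(\<exists>U. openin (top_of_set {a..b}) U \<and> t \<in> U \<and> (\<forall>y\<in>U. z y \<in> mball (z t) \<epsilon>)) \<longleftrightarrow>
      z t \<in> M \<and> (\<exists>\<eta>>0. \<forall>s\<in>{a..b}. \<bar>s - t\<bar> < \<eta> \<longrightarrow> d (z t) (z s) < \<epsilon> \<and> z s \<in> M)" (is "?L \<longleftrightarrow> ?R")
    if t: "t \<in> {a..b}" for t \<epsilon>
  proof
    assume ?L
    then obtain U where U: "openin (top_of_set {a..b}) U" "t \<in> U" "\<And>y. y \<in> U \<Longrightarrow> z y \<in> mball (z t) \<epsilon>" by blast
    then obtain \<eta> where "\<eta> > 0" "ball t \<eta> \<inter> {a..b} \<subseteq> U"
      by (auto simp: openin_contains_ball)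
    then show ?R using U by (force simp: dist_real_def subset_iff abs_minus_commute)
  next
    assume ?R
    then obtain \<eta> where "\<eta> > 0" "z t \<in> M" "\<forall>s\<in>{a..b}. \<bar>s - t\<bar> < \<eta> \<longrightarrow> d (z t) (z s) < \<epsilon> \<and> z s \<in> M" by blast
    then show ?L using t
      by (intro exI[of _ "{a..b} \<inter> ball t \<eta>"]) (auto simp: dist_real_def abs_minus_commute)
  qed
  then have "continuous_map (top_of_set {a..b}) mtopology z \<longleftrightarrow> (\<forall>t\<in>{a..b}. \<forall>\<epsilon>>0.
      z t \<in> M \<and> (\<exists>\<eta>>0. \<forall>s\<in>{a..b}. \<bar>s - t\<bar> < \<eta> \<longrightarrow> d (z t) (z s) < \<epsilon> \<and> z s \<in> M))"
    unfolding continuous_map_to_metric topspace_euclidean_subtopology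
    by (auto simp del: in_mball)
  moreover have "(\<forall>\<epsilon>>0. P \<and> R \<epsilon>) \<longleftrightarrow> P \<and> (\<forall>\<epsilon>>0. R \<epsilon>)" for P and R :: "real \<Rightarrow> bool"
    using zero_less_one by blast
  ultimately show ?thesis by (simp only:)
qed

context spectrum
begin

lemma paths_iff:
  "z \<in> paths \<alpha> a b \<longleftrightarrow> (\<forall>t\<in>{a..b}. z t \<in> ph \<alpha> 0 \<and>
     (\<forall>\<epsilon>>0. \<exists>\<eta>>0. \<forall>s\<in>{a..b}. \<bar>s - t\<bar> < \<eta> \<longrightarrow> ph_norm \<alpha> 0 (z s - z t) < \<epsilon>))"
  unfolding paths_def mem_Collect_eq ph_topology_def
    continuous_map_to_Metric_space_iff[OF Metric_space_ph[OF \<alpha>_pos, where \<delta> = 0]]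
  by (subst ph_norm_diff_commute) blast

lemma paths_close:
  assumes "z \<in> paths \<alpha> a b" "t \<in> {a..b}" "\<epsilon> > 0"
  obtains \<eta> where "\<eta> > 0" "\<And>s. s \<in> {a..b} \<Longrightarrow> \<bar>s - t\<bar> < \<eta> \<Longrightarrow> ph_norm \<alpha> 0 (z s - z t) < \<epsilon>"
  using assms unfolding paths_iff by blast

lemma paths_mem: "z \<in> paths \<alpha> a b \<Longrightarrow> t \<in> {a..b} \<Longrightarrow> z t \<in> ph \<alpha> 0"
  by (simp add: paths_iff)

lemma paths_add:
  assumes "z \<in> paths \<alpha> a b" "w \<in> paths \<alpha> a b"
  shows "(\<lambda>t. z t + w t) \<in> paths \<alpha> a b"
  unfolding paths_iff
proof (intro ballI conjI allI impI)
  fix t assume t: "t \<in> {a..b}"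
  show "z t + w t \<in> ph \<alpha> 0" by (intro ph_add paths_mem[OF assms(1) t] paths_mem[OF assms(2) t])
  fix \<epsilon> :: real assume "\<epsilon> > 0"
  then have "\<epsilon> / 2 > 0" by simp
  from paths_close[OF assms(1) t this] obtain \<eta>1 where
    1: "\<eta>1 > 0" "\<And>s. s \<in> {a..b} \<Longrightarrow> \<bar>s - t\<bar> < \<eta>1 \<Longrightarrow> ph_norm \<alpha> 0 (z s - z t) < \<epsilon> / 2" by blast
  from paths_close[OF assms(2) t \<open>\<epsilon> / 2 > 0\<close>] obtain \<eta>2 where
    2: "\<eta>2 > 0" "\<And>s. s \<in> {a..b} \<Longrightarrow> \<bar>s - t\<bar> < \<eta>2 \<Longrightarrow> ph_norm \<alpha> 0 (w s - w t) < \<epsilon> / 2" by blast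
  have "ph_norm \<alpha> 0 (z s + w s - (z t + w t)) < \<epsilon>" if s: "s \<in> {a..b}" "\<bar>s - t\<bar> < min \<eta>1 \<eta>2" for s
  proof -
    have "ph_norm \<alpha> 0 ((z s - z t) + (w s - w t)) \<le> ph_norm \<alpha> 0 (z s - z t) + ph_norm \<alpha> 0 (w s - w t)"
      using assms t s by (intro ph_norm_triangle ph_diff) (auto intro: paths_mem)
    then show ?thesis using 1(2)[of s] 2(2)[of s] s by (simp add: algebra_simps)
  qed
  then show "\<exists>\<eta>>0. \<forall>s\<in>{a..b}. \<bar>s - t\<bar> < \<eta> \<longrightarrow> ph_norm \<alpha> 0 (z s + w s - (z t + w t)) < \<epsilon>"
    using 1(1) 2(1) by (intro exI[of _ "min \<eta>1 \<eta>2"]) auto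
qed

lemma paths_functional:
  fixes \<pi> :: "phase \<Rightarrow> real"
  assumes z: "z \<in> paths \<alpha> a b"
    and \<pi>: "\<And>w w'. w \<in> ph \<alpha> 0 \<Longrightarrow> w' \<in> ph \<alpha> 0 \<Longrightarrow> \<bar>\<pi> w - \<pi> w'\<bar> \<le> C * ph_norm \<alpha> 0 (w - w')" and C: "C > 0"
  shows "continuous_on {a..b} (\<lambda>t. \<pi> (z t))"
  unfolding continuous_on_iff dist_real_def
proof (intro ballI allI impI)
  fix t \<epsilon> :: real assume t: "t \<in> {a..b}" and "\<epsilon> > 0"
  then have "\<epsilon> / C > 0" using C by simp
  from paths_close[OF z t this] obtain \<eta> where
    \<eta>: "\<eta> > 0" "\<And>s. s \<in> {a..b} \<Longrightarrow> \<bar>s - t\<bar> < \<eta> \<Longrightarrow> ph_norm \<alpha> 0 (z s - z t) < \<epsilon> / C" by blast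
  have "\<bar>\<pi> (z s) - \<pi> (z t)\<bar> < \<epsilon>" if "s \<in> {a..b}" "\<bar>s - t\<bar> < \<eta>" for s
    using \<pi>[OF paths_mem[OF z that(1)] paths_mem[OF z t]] \<eta>(2)[OF that] C
    by (simp add: field_simps)
  then show "\<exists>\<eta>>0. \<forall>s\<in>{a..b}. \<bar>s - t\<bar> < \<eta> \<longrightarrow> \<bar>\<pi> (z s) - \<pi> (z t)\<bar> < \<epsilon>" using \<eta>(1) by blast
qed

lemma paths_bounded:
  assumes z: "z \<in> paths \<alpha> a b"
  shows "\<exists>K. \<forall>t\<in>{a..b}. ph_norm \<alpha> 0 (z t) \<le> K"
proof -
  have "\<bar>ph_norm \<alpha> 0 w - ph_norm \<alpha> 0 w'\<bar> \<le> 1 * ph_norm \<alpha> 0 (w - w')" if "w \<in> ph \<alpha> 0" "w' \<in> ph \<alpha> 0" for w w'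
    using ph_norm_triangle[OF ph_diff[OF that] that(2)] ph_norm_triangle[OF ph_diff[OF that(2,1)] that(1)]
      ph_norm_diff_commute[of \<alpha> 0 w w'] by (simp add: abs_le_iff)
  then have "continuous_on {a..b} (\<lambda>t. ph_norm \<alpha> 0 (z t))"
    by (intro paths_functional[OF z, of _ 1]) auto
  then have "bounded ((\<lambda>t. ph_norm \<alpha> 0 (z t)) ` {a..b})"
    by (intro compact_imp_bounded compact_continuous_image) auto
  then show ?thesis by (force simp: bounded_iff)
qed

lemma hs_coord_0_le: "x \<in> hs \<alpha> 0 \<Longrightarrow> (x k)\<^sup>2 \<le> (hs_norm \<alpha> 0 x)\<^sup>2"
  using hs_coord_le[of x \<alpha> 0 k] by simp

text \<open>The control space in terms of the Henstock--Kurzweil integral, where the substitution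
  rules and the fundamental theorem of calculus are at hand.\<close>

lemma L2_time_iff:
  "\<psi> \<in> L2_time \<alpha> 0 T \<longleftrightarrow> (\<forall>s\<in>{0<..<T}. \<psi> s \<in> hs \<alpha> 0) \<and>
     (\<forall>k. (\<lambda>s. \<psi> s k) absolutely_integrable_on {0..T}) \<and>
     (\<lambda>s. (hs_norm \<alpha> 0 (\<psi> s))\<^sup>2) integrable_on {0..T}" (is "_ \<longleftrightarrow> ?R")
proof -
  let ?I = "{0<..<T}"
  have hk: "integrable (lebesgue_on ?I) (\<lambda>s. (hs_norm \<alpha> 0 (\<psi> s))\<^sup>2) \<longleftrightarrow> (\<lambda>s. (hs_norm \<alpha> 0 (\<psi> s))\<^sup>2) integrable_on {0..T}"
  proof -
    have "integrable (lebesgue_on ?I) (\<lambda>s. (hs_norm \<alpha> 0 (\<psi> s))\<^sup>2) \<longleftrightarrow> (\<lambda>s. (hs_norm \<alpha> 0 (\<psi> s))\<^sup>2) absolutely_integrable_on ?I"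
      by (simp add: integrable_restrict_space set_integrable_def)
    also have "\<dots> \<longleftrightarrow> (\<lambda>s. (hs_norm \<alpha> 0 (\<psi> s))\<^sup>2) integrable_on {0..T}"
      by (simp add: absolutely_integrable_on_iff_nonneg integrable_on_Icc_iff_Ioo)
    finally show ?thesis .
  qed
  have "(\<lambda>s. \<psi> s k) \<in> borel_measurable (lebesgue_on ?I) \<longleftrightarrow> (\<lambda>s. \<psi> s k) absolutely_integrable_on {0..T}"
    if int: "(\<lambda>s. (hs_norm \<alpha> 0 (\<psi> s))\<^sup>2) integrable_on {0..T}" and mem: "\<forall>s\<in>?I. \<psi> s \<in> hs \<alpha> 0" for k
  proof
    assume m: "(\<lambda>s. \<psi> s k) \<in> borel_measurable (lebesgue_on ?I)"
    have "(\<lambda>s. \<psi> s k) absolutely_integrable_on ?I"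
    proof (rule measurable_bounded_by_integrable_imp_absolutely_integrable[OF m])
      show "(\<lambda>s. 1 + (hs_norm \<alpha> 0 (\<psi> s))\<^sup>2) integrable_on ?I"
        using int by (intro integrable_add) (auto simp: integrable_on_Icc_iff_Ioo[symmetric])
      fix s assume s: "s \<in> ?I"
      have "\<bar>x\<bar> \<le> 1 + x\<^sup>2" for x :: real
        using sum_squares_bound[of "\<bar>x\<bar>" 1] by (simp add: power2_eq_square)
      then show "norm (\<psi> s k) \<le> 1 + (hs_norm \<alpha> 0 (\<psi> s))\<^sup>2"
        using hs_coord_0_le[of "\<psi> s" k] mem s by (smt (verit) real_norm_def)
    qed simp
    then show "(\<lambda>s. \<psi> s k) absolutely_integrable_on {0..T}"
      by (simp add: absolutely_integrable_on_Icc_iff_Ioo)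
  next
    assume "(\<lambda>s. \<psi> s k) absolutely_integrable_on {0..T}"
    then show "(\<lambda>s. \<psi> s k) \<in> borel_measurable (lebesgue_on ?I)"
      by (simp add: absolutely_integrable_on_Icc_iff_Ioo absolutely_integrable_measurable_real)
  qed
  then show ?thesis unfolding L2_time_def mem_Collect_eq hk by blast
qed

lemma L2_time_norm_sq:
  assumes "\<psi> \<in> L2_time \<alpha> 0 T"
  shows "(L2_time_norm \<alpha> 0 T \<psi>)\<^sup>2 = integral {0..T} (\<lambda>s. (hs_norm \<alpha> 0 (\<psi> s))\<^sup>2)"
proof -
  have i: "integrable (lebesgue_on {0<..<T}) (\<lambda>s. (hs_norm \<alpha> 0 (\<psi> s))\<^sup>2)"
    using assms by (simp add: L2_time_def)
  have "0 \<le> (LINT s|lebesgue_on {0<..<T}. (hs_norm \<alpha> 0 (\<psi> s))\<^sup>2)"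
    by (intro Bochner_Integration.integral_nonneg) simp
  then show ?thesis
    unfolding L2_time_norm_def
    using lebesgue_integral_eq_integral[OF i] by (subst real_sqrt_pow2) (simp_all add: integral_open_interval_real)
qed

end

text \<open>A control takes values in \<open>H\<close> at interior times only, so the integrand of the convolution
  in the mild formulation is known only there.\<close>

lemma LINT_eq_integral_spike:
  fixes h h' :: "real \<Rightarrow> real"
  assumes "h' absolutely_integrable_on {0..t}" "\<And>s. s \<in> {0<..<t} \<Longrightarrow> h s = h' s"
  shows "(LINT s|lebesgue_on {0..t}. h s) = integral {0..t} h'"
proof -
  have n: "negligible {0, t}" by simp
  have eq: "\<And>s. s \<in> {0..t} - {0, t} \<Longrightarrow> h s = h' s" using assms(2) by auto
  have "h absolutely_integrable_on {0..t}"
    by (rule absolutely_integrable_spike[OF assms(1) n eq])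
  then have "(LINT s|lebesgue_on {0..t}. h s) = integral {0..t} h"
    by (intro lebesgue_integral_eq_integral absolutely_integrable_imp_integrable) auto
  also have "\<dots> = integral {0..t} h'" by (rule integral_spike[OF n]) (use eq in auto)
  finally show ?thesis .
qed


section \<open>Mild solutions in coordinates\<close>

locale controlled_wave = wave_semigroup +
  fixes B Q :: "coeffs \<Rightarrow> coeffs" and lam :: "nat \<Rightarrow> real" and c \<beta> :: real and \<gamma> :: "real \<Rightarrow> real"
  assumes \<beta>_nonneg: "0 \<le> \<beta>" and c_pos: "0 < c"
    and lam_lower: "1 / c * \<alpha> k powr (- \<beta>) \<le> lam k" and lam_upper: "lam k \<le> c * \<alpha> k powr (- \<beta>)"
    and Q_diagonal: "\<psi> \<in> hs \<alpha> 0 \<Longrightarrow> Q \<psi> = (\<lambda>k. lam k * \<psi> k)"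
    and B_lip: "0 \<le> \<delta> \<Longrightarrow> \<delta> \<le> 2 * \<beta> \<Longrightarrow> hs_lipschitz \<alpha> \<delta> (\<gamma> \<delta>) B"
    and B_zero: "B 0 = 0"
begin

lemma lam_pos [simp]: "0 < lam k"
  using lam_lower[of k] c_pos by (smt (verit) \<alpha>_pos divide_pos_pos mult_pos_pos powr_gt_zero zero_less_one)

lemma lam_nonzero [simp]: "lam k \<noteq> 0"
  by (metis lam_pos less_irrefl)

lemma Q_bound:
  assumes "\<psi> \<in> hs \<alpha> 0"
  shows "(\<lambda>k. lam k * \<psi> k) \<in> hs \<alpha> (2 * \<beta>)"
    and "(hs_norm \<alpha> (2 * \<beta>) (\<lambda>k. lam k * \<psi> k))\<^sup>2 \<le> c\<^sup>2 * (hs_norm \<alpha> 0 \<psi>)\<^sup>2"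
proof -
  have le: "\<alpha> k powr (2 * \<beta>) * (lam k * \<psi> k)\<^sup>2 \<le> c\<^sup>2 * (\<alpha> k powr 0 * (\<psi> k)\<^sup>2)" for k
  proof -
    have "(lam k)\<^sup>2 \<le> (c * \<alpha> k powr (- \<beta>))\<^sup>2"
      using lam_upper[of k] lam_pos[of k] by (intro power_mono) (auto simp: less_imp_le)
    also have "\<dots> = c\<^sup>2 * \<alpha> k powr (- (2 * \<beta>))"
      by (simp add: power_mult_distrib power2_eq_square flip: powr_add)
    finally have "\<alpha> k powr (2 * \<beta>) * (lam k)\<^sup>2 \<le> c\<^sup>2"
      by (simp add: powr_minus field_simps)
    from mult_right_mono[OF this, of "(\<psi> k)\<^sup>2"] show ?thesis
      by (simp add: power_mult_distrib algebra_simps)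
  qed
  have "(\<lambda>k. c\<^sup>2 * (\<alpha> k powr 0 * (\<psi> k)\<^sup>2)) summable_on UNIV"
    using assms unfolding hs_def by (intro summable_on_cmult_right) simp
  from hs_dominated[where x = "\<lambda>k. lam k * \<psi> k", OF le this]
  show "(\<lambda>k. lam k * \<psi> k) \<in> hs \<alpha> (2 * \<beta>)"
      "(hs_norm \<alpha> (2 * \<beta>) (\<lambda>k. lam k * \<psi> k))\<^sup>2 \<le> c\<^sup>2 * (hs_norm \<alpha> 0 \<psi>)\<^sup>2"
    unfolding hs_norm_sq[of \<alpha> 0] by (simp_all add: infsum_cmult_right')
qed

text \<open>Dividing by \<open>\<lambda>\<^sub>k\<close> costs \<open>2\<beta>\<close> orders of regularity: every force in \<open>H\<^sup>2\<^sup>\<beta>\<close> comes from a control in \<open>H\<close>.\<close>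

lemma Q_inverse_bound:
  assumes "h \<in> hs \<alpha> (2 * \<beta>)"
  shows "(\<lambda>k. h k / lam k) \<in> hs \<alpha> 0"
    and "(hs_norm \<alpha> 0 (\<lambda>k. h k / lam k))\<^sup>2 \<le> c\<^sup>2 * (hs_norm \<alpha> (2 * \<beta>) h)\<^sup>2"
proof -
  have le: "\<alpha> k powr 0 * (h k / lam k)\<^sup>2 \<le> c\<^sup>2 * (\<alpha> k powr (2 * \<beta>) * (h k)\<^sup>2)" for k
  proof -
    have "1 / lam k \<le> c * \<alpha> k powr \<beta>"
      using lam_lower[of k] c_pos by (simp add: powr_minus field_simps)
    then have "(1 / lam k)\<^sup>2 \<le> (c * \<alpha> k powr \<beta>)\<^sup>2"
      by (intro power_mono) (auto simp: less_imp_le)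
    also have "\<dots> = c\<^sup>2 * \<alpha> k powr (2 * \<beta>)"
      by (simp add: power_mult_distrib power2_eq_square flip: powr_add)
    finally have "(1 / lam k)\<^sup>2 * (h k)\<^sup>2 \<le> c\<^sup>2 * \<alpha> k powr (2 * \<beta>) * (h k)\<^sup>2"
      by (rule mult_right_mono) simp
    then show ?thesis by (simp add: power_divide mult.assoc)
  qed
  have "(\<lambda>k. c\<^sup>2 * (\<alpha> k powr (2 * \<beta>) * (h k)\<^sup>2)) summable_on UNIV"
    using assms unfolding hs_def by (intro summable_on_cmult_right) simp
  from hs_dominated[where x = "\<lambda>k. h k / lam k", OF le this]
  show "(\<lambda>k. h k / lam k) \<in> hs \<alpha> 0"
      "(hs_norm \<alpha> 0 (\<lambda>k. h k / lam k))\<^sup>2 \<le> c\<^sup>2 * (hs_norm \<alpha> (2 * \<beta>) h)\<^sup>2"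
    unfolding hs_norm_sq[of \<alpha> "2 * \<beta>"] by (simp_all add: infsum_cmult_right')
qed

lemma B_mem: "0 \<le> \<delta> \<Longrightarrow> \<delta> \<le> 2 * \<beta> \<Longrightarrow> u \<in> hs \<alpha> \<delta> \<Longrightarrow> B u \<in> hs \<alpha> \<delta>"
  and B_diff_le: "0 \<le> \<delta> \<Longrightarrow> \<delta> \<le> 2 * \<beta> \<Longrightarrow> u \<in> hs \<alpha> \<delta> \<Longrightarrow> u' \<in> hs \<alpha> \<delta> \<Longrightarrow>
    hs_norm \<alpha> \<delta> (B u - B u') \<le> \<gamma> \<delta> * hs_norm \<alpha> \<delta> (u - u')"
  and \<gamma>_nonneg: "0 \<le> \<delta> \<Longrightarrow> \<delta> \<le> 2 * \<beta> \<Longrightarrow> 0 \<le> \<gamma> \<delta>"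
  using B_lip[of \<delta>] by (auto simp: hs_lipschitz_def)

lemma B_bound: "0 \<le> \<delta> \<Longrightarrow> \<delta> \<le> 2 * \<beta> \<Longrightarrow> u \<in> hs \<alpha> \<delta> \<Longrightarrow> hs_norm \<alpha> \<delta> (B u) \<le> \<gamma> \<delta> * hs_norm \<alpha> \<delta> u"
  using B_diff_le[of \<delta> u 0] by (simp add: B_zero)

lemma hs_0_in_velocities: "x \<in> hs \<alpha> 0 \<Longrightarrow> x \<in> hs \<alpha> (-1)"
  by (rule hs_mono(1)) auto

lemma continuous_B_along_path:
  assumes z: "z \<in> paths \<alpha> a b"
  shows "continuous_on {a..b} (\<lambda>t. B (fst (z t)) k)"
proof (rule paths_functional[OF z, of "\<lambda>w. B (fst w) k" "\<gamma> 0 + 1"])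
  fix w w' assume w: "w \<in> ph \<alpha> 0" "w' \<in> ph \<alpha> 0"
  then have f: "fst w \<in> hs \<alpha> 0" "fst w' \<in> hs \<alpha> 0" by (auto simp: ph_def)
  have "\<bar>B (fst w) k - B (fst w') k\<bar> \<le> hs_norm \<alpha> 0 (B (fst w) - B (fst w'))"
    using hs_coord_0_le[OF hs_diff[OF B_mem[of 0, OF _ _ f(1)] B_mem[of 0, OF _ _ f(2)]], of k] \<beta>_nonneg
    by (simp add: abs_le_square_iff[symmetric] hs_norm_nonneg)
  also have "\<dots> \<le> \<gamma> 0 * hs_norm \<alpha> 0 (fst (w - w'))"
    using B_diff_le[of 0, OF _ _ f] \<beta>_nonneg by simp
  also have "\<dots> \<le> (\<gamma> 0 + 1) * ph_norm \<alpha> 0 (w - w')"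
    using \<gamma>_nonneg[of 0] \<beta>_nonneg by (intro mult_mono hs_norm_le_ph_norm) (auto simp: hs_norm_nonneg)
  finally show "\<bar>B (fst w) k - B (fst w') k\<bar> \<le> (\<gamma> 0 + 1) * ph_norm \<alpha> 0 (w - w')" .
qed (use \<gamma>_nonneg[of 0] \<beta>_nonneg in simp)

text \<open>The acceleration of the \<open>k\<close>-th mode due to \<open>B\<close> and to the control.\<close>

definition force :: "(real \<Rightarrow> phase) \<Rightarrow> (real \<Rightarrow> coeffs) \<Rightarrow> nat \<Rightarrow> real \<Rightarrow> real" where
  "force z \<psi> k s = (B (fst (z s)) k + lam k * \<psi> s k) / \<mu>"

lemma continuous_kernels:
  "continuous_on {0..t} (\<lambda>s. g k (t - s))" "continuous_on {0..t} (\<lambda>s. p k (t - s))"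
  using damped_oscillatorD(1,2)[OF g_p_oscillator[of k]]
  by (auto intro!: continuous_on_compose2[of "{0..}" "g k"] continuous_on_compose2[of "{0..}" "p k"] continuous_intros)

lemma continuous_times_absolutely_integrable:
  fixes q h :: "real \<Rightarrow> real"
  assumes "continuous_on {0..t} q" "h absolutely_integrable_on {0..t}"
  shows "(\<lambda>s. q s * h s) absolutely_integrable_on {0..t}"
  by (rule absolutely_integrable_bounded_measurable_product_real)
    (use assms in \<open>auto intro!: continuous_imp_measurable_on_sets_lebesgue compact_imp_bounded compact_continuous_image\<close>)

lemma force_absolutely_integrable:
  assumes "z \<in> paths \<alpha> 0 T" "\<psi> \<in> L2_time \<alpha> 0 T" "t \<le> T"
  shows "force z \<psi> k absolutely_integrable_on {0..t}"
proof -
  have "(\<lambda>s. B (fst (z s)) k / \<mu> + (lam k / \<mu>) * \<psi> s k) absolutely_integrable_on {0..T}"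
    using assms continuous_B_along_path[OF assms(1), of k] \<mu>_pos
    by (intro set_integral_add(1)[OF absolutely_integrable_continuous_real set_integrable_mult_right])
      (auto simp: L2_time_iff intro!: continuous_intros)
  then have "force z \<psi> k absolutely_integrable_on {0..T}"
    unfolding force_def[abs_def] by (simp add: add_divide_distrib)
  then show ?thesis
    by (rule absolutely_integrable_on_subinterval) (use assms in auto)
qed

text \<open>The semigroup is diagonal, and \<open>B\<close> and \<open>Q\<close> act on the velocities only; so the second column of the
  fundamental matrix of every mode is all that is left of the semigroup.\<close>

lemma mild_solution_iff:
  assumes z: "z \<in> paths \<alpha> 0 T" "z 0 = 0" and \<psi>: "\<psi> \<in> L2_time \<alpha> 0 T"
  shows "mild_solution S B Q \<mu> 0 T \<psi> z \<longleftrightarrow> (\<forall>t\<in>{0..T}. \<forall>k.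
    fst (z t) k = integral {0..t} (\<lambda>s. g k (t - s) * force z \<psi> k s) \<and>
    snd (z t) k = integral {0..t} (\<lambda>s. p k (t - s) * force z \<psi> k s))"
  unfolding mild_solution_def
proof (rule ball_cong[OF refl])
  fix t assume t: "t \<in> {0..T}"
  define b where "b k s = B (fst (z s)) k / \<mu>" for k s
  define f where "f k s = lam k * \<psi> s k / \<mu>" for k s
  have bi: "b k absolutely_integrable_on {0..t}" for k
    unfolding b_def using \<mu>_pos t continuous_B_along_path[OF z(1), of k]
    by (intro absolutely_integrable_continuous_real continuous_intros)
      (auto elim: continuous_on_subset)
  have fi: "f k absolutely_integrable_on {0..t}" for k
  proof -
    have "(\<lambda>s. (lam k / \<mu>) * \<psi> s k) absolutely_integrable_on {0..T}"
      using \<psi> by (intro set_integrable_mult_right) (auto simp: L2_time_iff)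
    then have "(\<lambda>s. (lam k / \<mu>) * \<psi> s k) absolutely_integrable_on {0..t}"
      by (rule absolutely_integrable_on_subinterval) (use t in auto)
    then show ?thesis by (simp add: f_def[abs_def])
  qed
  have vB: "scl (1 / \<mu>) (B (fst (z s))) \<in> hs \<alpha> (-1)" if "s \<in> {0..t}" for s
    using that t paths_mem[OF z(1), of s] \<beta>_nonneg
    by (intro hs_0_in_velocities hs_scl B_mem) (auto simp: ph_def)
  have vQ: "scl (1 / \<mu>) (Q (\<psi> s)) \<in> hs \<alpha> (-1)" "Q (\<psi> s) = (\<lambda>k. lam k * \<psi> s k)" if "s \<in> {0<..<t}" for s
  proof -
    have m: "\<psi> s \<in> hs \<alpha> 0" using that t \<psi> by (auto simp: L2_time_iff)
    show q: "Q (\<psi> s) = (\<lambda>k. lam k * \<psi> s k)" by (rule Q_diagonal[OF m])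
    show "scl (1 / \<mu>) (Q (\<psi> s)) \<in> hs \<alpha> (-1)"
      unfolding q using Q_bound(1)[OF m] \<beta>_nonneg by (intro hs_scl hs_mono(1)[of "-1" "2 * \<beta>"]) auto
  qed
  have 1: "(LINT s|lebesgue_on {0..t}. fst (S (t - s) (B_mu B \<mu> (z s))) k) = integral {0..t} (\<lambda>s. g k (t - s) * b k s)"
    and 2: "(LINT s|lebesgue_on {0..t}. snd (S (t - s) (B_mu B \<mu> (z s))) k) = integral {0..t} (\<lambda>s. p k (t - s) * b k s)"
    and 3: "(LINT s|lebesgue_on {0..t}. fst (S (t - s) (Q_mu Q \<mu> (\<psi> s))) k) = integral {0..t} (\<lambda>s. g k (t - s) * f k s)"
    and 4: "(LINT s|lebesgue_on {0..t}. snd (S (t - s) (Q_mu Q \<mu> (\<psi> s))) k) = integral {0..t} (\<lambda>s. p k (t - s) * f k s)" for k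
    by (rule LINT_eq_integral_spike; (intro continuous_times_absolutely_integrable continuous_kernels bi fi)?;
        simp add: B_mu_def Q_mu_def S_velocity vB vQ(1); simp add: vQ(2) scl_def b_def f_def)+
  have sum: "integral {0..t} (\<lambda>s. q s * b k s) + integral {0..t} (\<lambda>s. q s * f k s) = integral {0..t} (\<lambda>s. q s * force z \<psi> k s)"
    if "continuous_on {0..t} q" for q k
  proof -
    have "(\<lambda>s. q s * b k s) integrable_on {0..t}" "(\<lambda>s. q s * f k s) integrable_on {0..t}"
      using that by (auto intro!: set_lebesgue_integral_eq_integral(1) continuous_times_absolutely_integrable bi fi)
    then have "integral {0..t} (\<lambda>s. q s * b k s) + integral {0..t} (\<lambda>s. q s * f k s) = integral {0..t} (\<lambda>s. q s * b k s + q s * f k s)"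
      by (rule integral_add[symmetric])
    also have "(\<lambda>s. q s * b k s + q s * f k s) = (\<lambda>s. q s * force z \<psi> k s)"
      by (simp add: fun_eq_iff b_def f_def force_def add_divide_distrib distrib_left)
    finally show ?thesis .
  qed
  have "S (t - 0) (z 0) = 0" using t z(2) S_zero[of t] by simp
  then show "(z t = S (t - 0) (z 0) + ph_integral 0 t (\<lambda>s. S (t - s) (B_mu B \<mu> (z s))) +
        ph_integral 0 t (\<lambda>s. S (t - s) (Q_mu Q \<mu> (\<psi> s)))) \<longleftrightarrow>
      (\<forall>k. fst (z t) k = integral {0..t} (\<lambda>s. g k (t - s) * force z \<psi> k s) \<and>
        snd (z t) k = integral {0..t} (\<lambda>s. p k (t - s) * force z \<psi> k s))"
    by (auto simp: ph_integral_def prod_eq_iff fun_eq_iff 1 2 3 4 sum[OF continuous_kernels(1)] sum[OF continuous_kernels(2)])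
qed

end

section \<open>Waiting at rest\<close>

text \<open>The detour constructed below takes one unit of time, so every path is first prolonged by that
  amount; the integrals over the prolonged path are the old ones, shifted.\<close>

lemma has_integral_delay:
  fixes f :: "real \<Rightarrow> real"
  assumes f: "(f has_integral I) {0..T}" and T: "0 \<le> T"
  shows "((\<lambda>s. if s \<le> 1 then 0 else f (s - 1)) has_integral I) {0..T + 1}"
proof -
  let ?h = "\<lambda>s. if s \<le> 1 then 0 else f (s - 1)"
  have "((\<lambda>s. f (s - 1)) has_integral I) {1..T + 1}"
    using has_integral_shift_Icc_real[of "\<lambda>s. f (s - 1)" 1 I 0 T] f by (simp add: o_def)
  then have 1: "(?h has_integral I) {1..T + 1}"
    by (rule has_integral_spike_finite[of "{1}", rotated 2]) auto
  have 0: "(?h has_integral 0) {0..1}"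
    by (rule has_integral_is_0) auto
  show ?thesis using has_integral_combine[OF _ _ 0 1] T by simp
qed

lemma absolutely_integrable_delay:
  fixes f :: "real \<Rightarrow> real"
  assumes f: "f absolutely_integrable_on {0..T}" and T: "0 \<le> T"
  shows "(\<lambda>s. if s \<le> 1 then 0 else f (s - 1)) absolutely_integrable_on {0..T + 1}"
proof -
  have i: "f integrable_on {0..T}" "(\<lambda>s. norm (f s)) integrable_on {0..T}"
    using f by (auto simp: absolutely_integrable_on_def)
  have "(\<lambda>s. norm (if s \<le> 1 then 0 else f (s - 1))) = (\<lambda>s. if s \<le> 1 then 0 else norm (f (s - 1)))" by auto
  then show ?thesis
    unfolding absolutely_integrable_on_def
    using has_integral_delay[OF integrable_integral[OF i(1)] T] has_integral_delay[OF integrable_integral[OF i(2)] T]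
    by (auto simp: integrable_on_def)
qed

context controlled_wave
begin

definition steers :: "real \<Rightarrow> (real \<Rightarrow> phase) \<Rightarrow> (real \<Rightarrow> coeffs) \<Rightarrow> bool" where
  "steers T z \<psi> \<longleftrightarrow> 0 < T \<and> z \<in> paths \<alpha> 0 T \<and> z 0 = 0 \<and> \<psi> \<in> L2_time \<alpha> 0 T \<and> mild_solution S B Q \<mu> 0 T \<psi> z"

lemma steersI:
  assumes "0 < T" "z \<in> paths \<alpha> 0 T" "z 0 = 0" "\<psi> \<in> L2_time \<alpha> 0 T"
    and "\<And>t k. t \<in> {0..T} \<Longrightarrow> ((\<lambda>s. g k (t - s) * force z \<psi> k s) has_integral fst (z t) k) {0..t}"
    and "\<And>t k. t \<in> {0..T} \<Longrightarrow> ((\<lambda>s. p k (t - s) * force z \<psi> k s) has_integral snd (z t) k) {0..t}"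
  shows "steers T z \<psi>"
  unfolding steers_def using assms by (subst mild_solution_iff) (auto intro!: integral_unique[symmetric])

lemma steersD:
  assumes "steers T z \<psi>"
  shows "0 < T" "z \<in> paths \<alpha> 0 T" "z 0 = 0" "\<psi> \<in> L2_time \<alpha> 0 T"
    and "t \<in> {0..T} \<Longrightarrow> ((\<lambda>s. g k (t - s) * force z \<psi> k s) has_integral fst (z t) k) {0..t}"
    and "t \<in> {0..T} \<Longrightarrow> ((\<lambda>s. p k (t - s) * force z \<psi> k s) has_integral snd (z t) k) {0..t}"
proof -
  show s: "0 < T" "z \<in> paths \<alpha> 0 T" "z 0 = 0" "\<psi> \<in> L2_time \<alpha> 0 T"
    using assms by (auto simp: steers_def)
  assume t: "t \<in> {0..T}"
  have i: "(\<lambda>s. g k (t - s) * force z \<psi> k s) integrable_on {0..t}" "(\<lambda>s. p k (t - s) * force z \<psi> k s) integrable_on {0..t}"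
    using t s by (auto intro!: set_lebesgue_integral_eq_integral(1) continuous_times_absolutely_integrable
        continuous_kernels force_absolutely_integrable)
  show "((\<lambda>s. g k (t - s) * force z \<psi> k s) has_integral fst (z t) k) {0..t}"
      "((\<lambda>s. p k (t - s) * force z \<psi> k s) has_integral snd (z t) k) {0..t}"
    using i[THEN integrable_integral] assms t mild_solution_iff[OF s(2-4)] by (auto simp: steers_def)
qed

text \<open>Since \<open>B 0 = 0\<close>, the system can rest at the origin for one unit of time at no cost.\<close>

lemma steers_delay:
  assumes st: "steers T z \<psi>"
  obtains z' \<psi>' where "steers (T + 1) z' \<psi>'" "z' (T + 1) = z T"
    "L2_time_norm \<alpha> 0 (T + 1) \<psi>' = L2_time_norm \<alpha> 0 T \<psi>"
proof -
  note s = steersD[OF st]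
  define z' where "z' t = z (max 0 (t - 1))" for t
  define \<psi>' where "\<psi>' t = (if t \<le> 1 then 0 else \<psi> (t - 1))" for t
  have z'0: "z' t = 0" if "t \<le> 1" for t using that s(3) by (simp add: z'_def)
  have z': "z' \<in> paths \<alpha> 0 (T + 1)"
    unfolding paths_iff
  proof (intro ballI conjI allI impI)
    fix t assume "t \<in> {0..T + 1}"
    then have t: "max 0 (t - 1) \<in> {0..T}" using s(1) by auto
    show "z' t \<in> ph \<alpha> 0" unfolding z'_def by (rule paths_mem[OF s(2) t])
    fix \<epsilon> :: real assume "\<epsilon> > 0"
    from paths_close[OF s(2) t this] obtain \<eta> where
      \<eta>: "\<eta> > 0" "\<And>r. r \<in> {0..T} \<Longrightarrow> \<bar>r - max 0 (t - 1)\<bar> < \<eta> \<Longrightarrow> ph_norm \<alpha> 0 (z r - z (max 0 (t - 1))) < \<epsilon>" by blast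
    have "ph_norm \<alpha> 0 (z' r - z' t) < \<epsilon>" if "r \<in> {0..T + 1}" "\<bar>r - t\<bar> < \<eta>" for r
      unfolding z'_def using that s(1) by (intro \<eta>(2)) auto
    then show "\<exists>\<eta>>0. \<forall>r\<in>{0..T + 1}. \<bar>r - t\<bar> < \<eta> \<longrightarrow> ph_norm \<alpha> 0 (z' r - z' t) < \<epsilon>" using \<eta>(1) by blast
  qed
  have T: "0 \<le> T" using s(1) by simp
  have nsq: "(\<lambda>s. (hs_norm \<alpha> 0 (\<psi>' s))\<^sup>2) = (\<lambda>s. if s \<le> 1 then 0 else (hs_norm \<alpha> 0 (\<psi> (s - 1)))\<^sup>2)"
    by (simp add: fun_eq_iff \<psi>'_def)
  have I: "((\<lambda>s. (hs_norm \<alpha> 0 (\<psi>' s))\<^sup>2) has_integral integral {0..T} (\<lambda>s. (hs_norm \<alpha> 0 (\<psi> s))\<^sup>2)) {0..T + 1}"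
    unfolding nsq using s(4) T by (intro has_integral_delay integrable_integral) (auto simp: L2_time_iff)
  have coord: "(\<lambda>s. \<psi>' s k) = (\<lambda>s. if s \<le> 1 then 0 else \<psi> (s - 1) k)" for k
    by (simp add: fun_eq_iff \<psi>'_def)
  have \<psi>': "\<psi>' \<in> L2_time \<alpha> 0 (T + 1)"
    unfolding L2_time_iff coord using s(4) I T
    by (auto simp: L2_time_iff \<psi>'_def integrable_on_def intro!: absolutely_integrable_delay)
  have frc: "force z' \<psi>' k r = (if r \<le> 1 then 0 else force z \<psi> k (r - 1))" for k r
    by (cases "r \<le> 1") (auto simp: force_def \<psi>'_def s(3) B_zero z'_def)
  have delay: "((\<lambda>r. q (t - r) * force z' \<psi>' k r) has_integral y) {0..t}"
    if t: "t \<in> {0..T + 1}" and q: "1 < t \<Longrightarrow> ((\<lambda>r. q (t - 1 - r) * force z \<psi> k r) has_integral y) {0..t - 1}"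
      and y: "t \<le> 1 \<Longrightarrow> y = 0" for q y t k
  proof (cases "t \<le> 1")
    case True
    then show ?thesis using y by (intro has_integral_is_0[THEN has_integral_eq_rhs]) (auto simp: frc)
  next
    case False
    have "((\<lambda>r. if r \<le> 1 then 0 else q (t - 1 - (r - 1)) * force z \<psi> k (r - 1)) has_integral y) {0..(t - 1) + 1}"
      using q False by (intro has_integral_delay) auto
    then show ?thesis
      by (simp add: frc if_distrib[of "\<lambda>x. _ * x"] cong: if_cong)
  qed
  have "steers (T + 1) z' \<psi>'"
  proof (rule steersI)
    fix t k assume t: "t \<in> {0..T + 1}"
    show "((\<lambda>r. g k (t - r) * force z' \<psi>' k r) has_integral fst (z' t) k) {0..t}"
      by (rule delay[OF t]) (use t s(5)[of "t - 1" k] in \<open>auto simp: z'_def s(3)\<close>)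
    show "((\<lambda>r. p k (t - r) * force z' \<psi>' k r) has_integral snd (z' t) k) {0..t}"
      by (rule delay[OF t]) (use t s(6)[of "t - 1" k] in \<open>auto simp: z'_def s(3)\<close>)
  qed (use s(1) z' z'0 \<psi>' in auto)
  moreover have "z' (T + 1) = z T" using T by (simp add: z'_def)
  moreover have "(L2_time_norm \<alpha> 0 (T + 1) \<psi>')\<^sup>2 = (L2_time_norm \<alpha> 0 T \<psi>)\<^sup>2"
    using I unfolding L2_time_norm_sq[OF \<psi>'] L2_time_norm_sq[OF s(4)] by (rule integral_unique)
  then have "L2_time_norm \<alpha> 0 (T + 1) \<psi>' = L2_time_norm \<alpha> 0 T \<psi>"
    by (simp add: L2_time_norm_def Bochner_Integration.integral_nonneg)
  ultimately show thesis by (rule that)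
qed

end


section \<open>Spatial regularity of controlled paths\<close>

text \<open>Jensen's inequality, from \<open>(h - m)\<^sup>2 \<ge> 0\<close> with \<open>m\<close> the mean of \<open>h\<close>; with the majorant \<open>q\<close> the
  square of \<open>h\<close> itself is never integrated.\<close>

lemma integral_sq_le:
  fixes h q :: "real \<Rightarrow> real"
  assumes h: "(h has_integral I) {0..t}" and q: "q integrable_on {0..t}"
    and le: "\<And>s. s \<in> {0..t} \<Longrightarrow> (h s)\<^sup>2 \<le> q s" and t: "0 \<le> t"
  shows "I\<^sup>2 \<le> t * integral {0..t} q"
proof (cases "t = 0")
  case True
  then have "(h has_integral I) {0}" using h by simp
  then have "I = 0" using has_integral_unique has_integral_refl(2) by blast
  then show ?thesis using True by simp
next
  case False
  then have t: "0 < t" using assms by simp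
  define m where "m = I / t"
  have "((\<lambda>s. 2 * m * h s - m\<^sup>2) has_integral (2 * m * I - m\<^sup>2 * t)) {0..t}"
    using has_integral_diff[OF has_integral_mult_right[OF h, of "2 * m"] has_integral_const_real[of "m\<^sup>2" 0 t]] t
    by (simp add: mult.commute)
  then have "2 * m * I - m\<^sup>2 * t \<le> integral {0..t} q"
  proof (rule has_integral_le[OF _ integrable_integral[OF q]])
    fix s assume s: "s \<in> {0..t}"
    have "0 \<le> (h s - m)\<^sup>2" by simp
    then show "2 * m * h s - m\<^sup>2 \<le> q s" using le[OF s] by (simp add: power2_diff mult_ac)
  qed
  moreover have "2 * m * I - m\<^sup>2 * t = I\<^sup>2 / t"
    using t by (simp add: m_def power2_eq_square field_simps)
  ultimately have "I\<^sup>2 / t \<le> integral {0..t} q" by simp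
  then show ?thesis using t by (simp add: divide_le_eq mult.commute)
qed

context spectrum
begin

lemma L2_time_coord_sq_integrable:
  assumes "\<psi> \<in> L2_time \<alpha> 0 T"
  shows "(\<lambda>s. (\<psi> s k)\<^sup>2) integrable_on {0<..<T}"
proof (rule measurable_bounded_by_integrable_imp_integrable_real)
  show "(\<lambda>s. (\<psi> s k)\<^sup>2) \<in> borel_measurable (lebesgue_on {0<..<T})"
    using assms unfolding L2_time_def by (auto intro!: borel_measurable_power)
  show "(\<lambda>s. (hs_norm \<alpha> 0 (\<psi> s))\<^sup>2) integrable_on {0<..<T}"
    using assms unfolding L2_time_iff integrable_on_Icc_iff_Ioo by blast
  show "\<bar>(\<psi> s k)\<^sup>2\<bar> \<le> (hs_norm \<alpha> 0 (\<psi> s))\<^sup>2" if "s \<in> {0<..<T}" for s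
    using assms that hs_coord_0_le[of "\<psi> s" k] by (simp add: L2_time_def)
qed simp

end

context controlled_wave
begin

lemma steered_coord_sq_le:
  assumes st: "steers T z \<psi>" and t: "t \<in> {0..T}"
  shows "(fst (z t) k)\<^sup>2 \<le> 2 * T / (\<mu> * \<alpha> k) * integral {0<..<T} (\<lambda>s. (B (fst (z s)) k)\<^sup>2 + (lam k * \<psi> s k)\<^sup>2)"
proof -
  note s = steersD[OF st]
  define r where "r s = (B (fst (z s)) k)\<^sup>2 + (lam k * \<psi> s k)\<^sup>2" for s
  define C where "C = 2 / (\<mu> * \<alpha> k)"
  have C: "0 \<le> C" using \<mu>_pos by (simp add: C_def less_imp_le)
  have "(\<lambda>s. (B (fst (z s)) k)\<^sup>2) integrable_on {0..T}"
    by (intro integrable_continuous_real continuous_on_power continuous_B_along_path s(2))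
  moreover have "(\<lambda>s. (lam k)\<^sup>2 * (\<psi> s k)\<^sup>2) integrable_on {0..T}"
    using L2_time_coord_sq_integrable[OF s(4), of k]
    by (intro integrable_on_mult_right) (simp add: integrable_on_Icc_iff_Ioo)
  ultimately have r: "r integrable_on {0..T}"
    unfolding r_def power_mult_distrib by (rule integrable_add)
  have rt: "r integrable_on {0..t}" by (rule integrable_subinterval_real[OF r]) (use t in auto)
  have "(fst (z t) k)\<^sup>2 \<le> t * integral {0..t} (\<lambda>s. C * r s)"
  proof (rule integral_sq_le[OF s(5)[OF t]])
    fix s assume s: "s \<in> {0..t}"
    have "(g k (t - s) * force z \<psi> k s)\<^sup>2 = (g k (t - s))\<^sup>2 * (B (fst (z s)) k + lam k * \<psi> s k)\<^sup>2 / \<mu>\<^sup>2"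
      by (simp add: force_def power_mult_distrib power_divide)
    also have "\<dots> \<le> (\<mu> / \<alpha> k) * (2 * r s) / \<mu>\<^sup>2"
      using g_bound[of "t - s" k] s \<mu>_pos weighted_sq_add_le[of 1 "B (fst (z s)) k" "lam k * \<psi> s k"]
      by (intro divide_right_mono mult_mono) (auto simp: r_def less_imp_le)
    also have "\<dots> = C * r s" using \<mu>_pos by (simp add: C_def power2_eq_square field_simps)
    finally show "(g k (t - s) * force z \<psi> k s)\<^sup>2 \<le> C * r s" .
  qed (use t rt in \<open>auto intro: integrable_on_mult_right\<close>)
  also have "\<dots> = t * (C * integral {0..t} r)" by simp
  also have "\<dots> \<le> T * (C * integral {0..T} r)"
    using t C rt r by (intro mult_mono mult_left_mono integral_subset_le mult_nonneg_nonneg integral_nonneg) (auto simp: r_def)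
  also have "integral {0..T} r = integral {0<..<T} r" by (rule integral_open_interval_real)
  finally show ?thesis by (simp add: r_def[abs_def] C_def mult_ac)
qed

text \<open>One step of the bootstrap: the kernel \<open>g\<close> is of size \<open>\<alpha>\<^sub>k\<^sup>-\<^sup>1\<^sup>/\<^sup>2\<close>, so Duhamel's formula gains one
  order of regularity over the force, until the force is limited by the control.\<close>

lemma regularity_step:
  assumes st: "steers T z \<psi>" and \<delta>: "0 \<le> \<delta>" "\<delta> \<le> 2 * \<beta>" and \<delta>': "\<delta>' \<le> \<delta> + 1"
    and K: "\<And>t. t \<in> {0..T} \<Longrightarrow> fst (z t) \<in> hs \<alpha> \<delta> \<and> (hs_norm \<alpha> \<delta> (fst (z t)))\<^sup>2 \<le> K"
  shows "\<exists>K'. \<forall>t\<in>{0..T}. fst (z t) \<in> hs \<alpha> \<delta>' \<and> (hs_norm \<alpha> \<delta>' (fst (z t)))\<^sup>2 \<le> K'"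
proof -
  note s = steersD[OF st]
  define r where "r k s = \<alpha> k powr \<delta> * ((B (fst (z s)) k)\<^sup>2 + (lam k * \<psi> s k)\<^sup>2)" for k s
  define R where "R s = (\<gamma> \<delta>)\<^sup>2 * K + \<alpha> 0 powr (\<delta> - 2 * \<beta>) * (c\<^sup>2 * (hs_norm \<alpha> 0 (\<psi> s))\<^sup>2)" for s
  define C where "C = 2 * T / \<mu> * \<alpha> 0 powr (\<delta>' - 1 - \<delta>)"
  have C: "0 \<le> C" using s(1) \<mu>_pos by (simp add: C_def)
  have Bi: "(\<lambda>s. (B (fst (z s)) k)\<^sup>2) integrable_on {0<..<T}" for k
    unfolding integrable_on_Icc_iff_Ioo[symmetric]
    by (intro integrable_continuous_real continuous_on_power continuous_B_along_path s(2))
  have \<psi>i: "(\<lambda>s. (lam k * \<psi> s k)\<^sup>2) integrable_on {0<..<T}" for k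
    unfolding power_mult_distrib by (intro integrable_on_mult_right L2_time_coord_sq_integrable s(4))
  have ri: "r k integrable_on {0<..<T}" for k
    unfolding r_def by (intro integrable_on_mult_right integrable_add Bi \<psi>i)
  have Ri: "R integrable_on {0<..<T}"
    unfolding R_def using s(4) by (intro integrable_add integrable_on_mult_right)
      (auto simp: L2_time_iff integrable_on_Icc_iff_Ioo[symmetric])
  have rR: "(\<Sum>k\<in>F. r k s) \<le> R s" if F: "finite F" and s': "s \<in> {0<..<T}" for F s
  proof -
    have u: "fst (z s) \<in> hs \<alpha> \<delta>" "(hs_norm \<alpha> \<delta> (fst (z s)))\<^sup>2 \<le> K" using K[of s] s' by auto
    have \<psi>: "\<psi> s \<in> hs \<alpha> 0" using s(4) s' by (auto simp: L2_time_iff)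
    have "(\<Sum>k\<in>F. \<alpha> k powr \<delta> * (B (fst (z s)) k)\<^sup>2) \<le> (hs_norm \<alpha> \<delta> (B (fst (z s))))\<^sup>2"
      by (rule hs_finite_sum_le[OF B_mem[OF \<delta> u(1)] F])
    also have "\<dots> \<le> (\<gamma> \<delta>)\<^sup>2 * (hs_norm \<alpha> \<delta> (fst (z s)))\<^sup>2"
      using power_mono[OF B_bound[OF \<delta> u(1)] hs_norm_nonneg, of 2] by (simp add: power_mult_distrib)
    also have "\<dots> \<le> (\<gamma> \<delta>)\<^sup>2 * K" using u(2) by (intro mult_left_mono) auto
    finally have 1: "(\<Sum>k\<in>F. \<alpha> k powr \<delta> * (B (fst (z s)) k)\<^sup>2) \<le> (\<gamma> \<delta>)\<^sup>2 * K" .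
    have "(\<Sum>k\<in>F. \<alpha> k powr \<delta> * (lam k * \<psi> s k)\<^sup>2) \<le> (hs_norm \<alpha> \<delta> (\<lambda>k. lam k * \<psi> s k))\<^sup>2"
      by (rule hs_finite_sum_le[OF hs_mono(1)[OF \<delta>(2) Q_bound(1)[OF \<psi>]] F])
    also have "\<dots> \<le> \<alpha> 0 powr (\<delta> - 2 * \<beta>) * (hs_norm \<alpha> (2 * \<beta>) (\<lambda>k. lam k * \<psi> s k))\<^sup>2"
      by (rule hs_mono(2)[OF \<delta>(2) Q_bound(1)[OF \<psi>]])
    also have "\<dots> \<le> \<alpha> 0 powr (\<delta> - 2 * \<beta>) * (c\<^sup>2 * (hs_norm \<alpha> 0 (\<psi> s))\<^sup>2)"
      by (intro mult_left_mono Q_bound(2)[OF \<psi>]) simp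
    finally show ?thesis using 1
      unfolding r_def R_def distrib_left sum.distrib by linarith
  qed
  have le: "\<alpha> k powr \<delta>' * (fst (z t) k)\<^sup>2 \<le> C * integral {0<..<T} (r k)" if t: "t \<in> {0..T}" for k t
  proof -
    define J where "J = integral {0<..<T} (\<lambda>s. (B (fst (z s)) k)\<^sup>2 + (lam k * \<psi> s k)\<^sup>2)"
    have J: "0 \<le> J" unfolding J_def by (intro integral_nonneg integrable_add Bi \<psi>i) auto
    have "\<alpha> k powr \<delta>' * (fst (z t) k)\<^sup>2 \<le> \<alpha> k powr \<delta>' * (2 * T / (\<mu> * \<alpha> k) * J)"
      unfolding J_def by (intro mult_left_mono steered_coord_sq_le[OF st t]) simp
    also have "\<dots> = 2 * T / \<mu> * (\<alpha> k powr (\<delta>' - 1) * J)"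
      using powr_diff[of "\<alpha> k" \<delta>' 1] abs_of_pos[OF \<alpha>_pos[of k]] by simp
    also have "\<dots> \<le> 2 * T / \<mu> * ((\<alpha> 0 powr (\<delta>' - 1 - \<delta>) * \<alpha> k powr \<delta>) * J)"
      using \<delta>' s(1) \<mu>_pos J by (intro mult_left_mono mult_right_mono \<alpha>_powr_mono) auto
    also have "\<dots> = C * integral {0<..<T} (r k)"
      by (simp add: C_def r_def[abs_def] J_def mult.assoc)
    finally show ?thesis .
  qed
  have "(\<Sum>k\<in>F. \<alpha> k powr \<delta>' * (fst (z t) k)\<^sup>2) \<le> C * integral {0<..<T} R" if t: "t \<in> {0..T}" and F: "finite F" for t F
  proof -
    have "(\<Sum>k\<in>F. \<alpha> k powr \<delta>' * (fst (z t) k)\<^sup>2) \<le> (\<Sum>k\<in>F. C * integral {0<..<T} (r k))"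
      by (intro sum_mono le t)
    also have "\<dots> = C * integral {0<..<T} (\<lambda>s. \<Sum>k\<in>F. r k s)"
      using F ri by (simp add: integral_sum sum_distrib_left)
    also have "\<dots> \<le> C * integral {0<..<T} R"
      using F ri by (intro mult_left_mono integral_le integrable_sum Ri rR C) auto
    finally show ?thesis .
  qed
  then show ?thesis
    using hs_finite_sums_bound[of \<alpha> \<delta>' "fst (z t)" "C * integral {0<..<T} R" for t] by blast
qed

text \<open>In \<open>H\<^sup>2\<^sup>\<beta>\<close> the map \<open>B\<close> is Lipschitz, and a force in \<open>H\<^sup>2\<^sup>\<beta>\<close> can be compensated by a control: this is
  the regularity that makes two controlled paths comparable.\<close>

lemma steered_regular:
  assumes st: "steers T z \<psi>" and t: "t \<in> {0..T}"
  shows "fst (z t) \<in> hs \<alpha> (2 * \<beta>)"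
proof -
  note s = steersD[OF st]
  have *: "\<exists>K. \<forall>t\<in>{0..T}. fst (z t) \<in> hs \<alpha> (min (real n) (2 * \<beta>)) \<and> (hs_norm \<alpha> (min (real n) (2 * \<beta>)) (fst (z t)))\<^sup>2 \<le> K" for n
  proof (induction n)
    case 0
    obtain K where K: "\<And>t. t \<in> {0..T} \<Longrightarrow> ph_norm \<alpha> 0 (z t) \<le> K" using paths_bounded[OF s(2)] by blast
    have "fst (z t) \<in> hs \<alpha> 0 \<and> (hs_norm \<alpha> 0 (fst (z t)))\<^sup>2 \<le> K\<^sup>2" if t: "t \<in> {0..T}" for t
      using paths_mem[OF s(2) t] order_trans[OF hs_norm_le_ph_norm(1) K[OF t]]
      by (auto simp: ph_def intro!: power_mono hs_norm_nonneg)
    moreover have "min (real 0) (2 * \<beta>) = 0" using \<beta>_nonneg by simp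
    ultimately show ?case by (auto intro!: exI[of _ "K\<^sup>2"])
  next
    case (Suc n)
    then obtain K where "\<And>t. t \<in> {0..T} \<Longrightarrow> fst (z t) \<in> hs \<alpha> (min (real n) (2 * \<beta>)) \<and> (hs_norm \<alpha> (min (real n) (2 * \<beta>)) (fst (z t)))\<^sup>2 \<le> K"
      by blast
    from regularity_step[OF st _ _ _ this, of "min (real (Suc n)) (2 * \<beta>)"] \<beta>_nonneg show ?case by auto
  qed
  obtain n where "2 * \<beta> \<le> real n" using real_arch_simple by blast
  then have "min (real n) (2 * \<beta>) = 2 * \<beta>" by simp
  with *[of n] t show ?thesis by auto
qed

end

section \<open>Dominated sequence-valued functions of time\<close>

context spectrum
begin

lemma hs_norm_sq_sums:
  assumes "x \<in> hs \<alpha> \<delta>"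
  shows "(\<lambda>k. \<alpha> k powr \<delta> * (x k)\<^sup>2) sums (hs_norm \<alpha> \<delta> x)\<^sup>2"
  unfolding hs_norm_sq using assms by (intro has_sum_imp_sums has_sum_infsum) (simp add: hs_def)

text \<open>Weierstrass' test for the series that defines the norm.\<close>

lemma dominated_continuous:
  fixes h :: "nat \<Rightarrow> real \<Rightarrow> real"
  assumes h: "\<And>k. continuous_on {0..L} (h k)" and a: "a summable_on UNIV"
    and dom: "\<And>k t. t \<in> {0..L} \<Longrightarrow> \<alpha> k powr \<delta> * (h k t)\<^sup>2 \<le> a k"
    and t: "t \<in> {0..L}" and e: "\<epsilon> > 0"
  shows "\<exists>\<eta>>0. \<forall>s\<in>{0..L}. \<bar>s - t\<bar> < \<eta> \<longrightarrow> hs_norm \<alpha> \<delta> ((\<lambda>k. h k s) - (\<lambda>k. h k t)) < \<epsilon>"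
proof -
  let ?d = "\<lambda>s. hs_norm \<alpha> \<delta> ((\<lambda>k. h k s) - (\<lambda>k. h k t))"
  define D where "D k s = \<alpha> k powr \<delta> * (h k s - h k t)\<^sup>2" for k s
  have mem: "(\<lambda>k. h k s) \<in> hs \<alpha> \<delta>" if "s \<in> {0..L}" for s
    using hs_dominated(1)[OF dom[OF that] a] .
  have Dle: "norm (D k s) \<le> 4 * a k" if "s \<in> {0..L}" for k s
  proof -
    have "(h k s - h k t)\<^sup>2 \<le> 2 * (h k s)\<^sup>2 + 2 * (h k t)\<^sup>2"
      using weighted_sq_add_le[of 1 "h k s" "- h k t"] by simp
    from mult_left_mono[OF this, of "\<alpha> k powr \<delta>"] show ?thesis
      using dom[OF that, of k] dom[OF t, of k] by (simp add: D_def algebra_simps)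
  qed
  have sm: "summable (\<lambda>k. 4 * a k)"
    using a by (intro summable_mult summable_on_imp_summable)
  have cont: "continuous_on {0..L} (\<lambda>s. \<Sum>k. D k s)"
  proof (rule uniform_limit_theorem[OF _ Weierstrass_m_test[OF Dle sm]])
    show "\<forall>\<^sub>F n in sequentially. continuous_on {0..L} (\<lambda>s. \<Sum>k<n. D k s)"
      unfolding D_def by (intro always_eventually allI continuous_intros h)
  qed auto
  have sq: "(\<Sum>k. D k s) = (?d s)\<^sup>2" if "s \<in> {0..L}" for s
    using sums_unique[OF hs_norm_sq_sums[OF hs_diff[OF mem[OF that] mem[OF t]]]] by (simp add: D_def)
  obtain \<eta> where \<eta>: "\<eta> > 0" "\<And>s. s \<in> {0..L} \<Longrightarrow> \<bar>s - t\<bar> < \<eta> \<Longrightarrow> \<bar>(\<Sum>k. D k s) - (\<Sum>k. D k t)\<bar> < \<epsilon>\<^sup>2"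
    using cont[unfolded continuous_on_iff dist_real_def, rule_format, OF t zero_less_power[OF e, of 2]] by blast
  have "?d s < \<epsilon>" if "s \<in> {0..L}" "\<bar>s - t\<bar> < \<eta>" for s
  proof -
    have "(\<Sum>k. D k t) = 0" by (simp add: D_def)
    then have "(?d s)\<^sup>2 < \<epsilon>\<^sup>2"
      using \<eta>(2)[OF that] sq[OF that(1)] by simp
    then show ?thesis using e by (simp add: power2_less_imp_less)
  qed
  then show ?thesis using \<eta>(1) by blast
qed

text \<open>Monotone convergence: integration in time and summation over the modes may be exchanged, so
  bounds on the force can be obtained mode by mode.\<close>

lemma integral_hs_norm_sq_le:
  fixes h :: "nat \<Rightarrow> real \<Rightarrow> real"
  assumes h: "\<And>k. continuous_on {0..L} (h k)" and mem: "\<And>t. t \<in> {0..L} \<Longrightarrow> (\<lambda>k. h k t) \<in> hs \<alpha> \<delta>"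
    and le: "\<And>k. \<alpha> k powr \<delta> * integral {0..L} (\<lambda>t. (h k t)\<^sup>2) \<le> a k" and a: "a summable_on UNIV"
  shows "(\<lambda>t. (hs_norm \<alpha> \<delta> (\<lambda>k. h k t))\<^sup>2) integrable_on {0..L}"
    and "integral {0..L} (\<lambda>t. (hs_norm \<alpha> \<delta> (\<lambda>k. h k t))\<^sup>2) \<le> infsum a UNIV"
proof -
  let ?N = "\<lambda>t. (hs_norm \<alpha> \<delta> (\<lambda>k. h k t))\<^sup>2"
  define F where "F n t = (\<Sum>k<n. \<alpha> k powr \<delta> * (h k t)\<^sup>2)" for n t
  have i: "(\<lambda>t. \<alpha> k powr \<delta> * (h k t)\<^sup>2) integrable_on {0..L}" for k
    by (intro integrable_continuous_real continuous_intros h)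
  have Fi: "F n integrable_on {0..L}" for n
    unfolding F_def by (intro integrable_sum i) auto
  have a0: "0 \<le> a k" for k
    by (rule order_trans[OF _ le]) (intro mult_nonneg_nonneg integral_nonneg integrable_continuous_real continuous_intros h; simp)
  have FI: "integral {0..L} (F n) \<le> infsum a UNIV" for n
  proof -
    have "integral {0..L} (F n) = (\<Sum>k<n. \<alpha> k powr \<delta> * integral {0..L} (\<lambda>t. (h k t)\<^sup>2))"
      unfolding F_def using i by (simp add: integral_sum)
    also have "\<dots> \<le> (\<Sum>k<n. a k)" by (intro sum_mono le)
    also have "\<dots> \<le> infsum a UNIV" using a a0 by (intro finite_sum_le_infsum) auto
    finally show ?thesis .
  qed
  have FI0: "0 \<le> integral {0..L} (F n)" for n
    by (intro integral_nonneg Fi) (auto simp: F_def sum_nonneg)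
  have "?N integrable_on {0..L} \<and>
    (\<lambda>n. integral {0..L} (F n)) \<longlonglongrightarrow> integral {0..L} ?N"
  proof (rule monotone_convergence_increasing)
    show "F n integrable_on {0..L}" for n by (rule Fi)
    show "F n t \<le> F (Suc n) t" for n t by (simp add: F_def)
    show "(\<lambda>n. F n t) \<longlonglongrightarrow> (hs_norm \<alpha> \<delta> (\<lambda>k. h k t))\<^sup>2" if "t \<in> {0..L}" for t
      using hs_norm_sq_sums[OF mem[OF that]] by (simp add: F_def sums_def)
    show "bounded (range (\<lambda>n. integral {0..L} (F n)))"
      unfolding bounded_iff using FI FI0 by (intro exI[of _ "infsum a UNIV"]) auto
  qed
  then show "?N integrable_on {0..L}"
      "integral {0..L} ?N \<le> infsum a UNIV"
    using FI by (auto intro: LIMSEQ_le_const2)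
qed

end


section \<open>Displacing the end point\<close>

context wave_semigroup
begin

text \<open>The free motion started at \<open>(x, - y)\<close>: run backwards in time it arrives at \<open>(x, y)\<close>, and since
  reversing time changes the sign of the friction only, the force it needs is \<open>-2\<close> times the velocity
  of the free motion.  Here \<open>s\<close> is the time to go.\<close>

definition back_u :: "phase \<Rightarrow> nat \<Rightarrow> real \<Rightarrow> real" where
  "back_u q k s = (p k s + g k s / \<mu>) * fst q k + g k s * (- snd q k)"

definition back_v :: "phase \<Rightarrow> nat \<Rightarrow> real \<Rightarrow> real" where
  "back_v q k s = - \<alpha> k * g k s / \<mu> * fst q k + p k s * (- snd q k)"

definition energy :: "phase \<Rightarrow> nat \<Rightarrow> real" where
  "energy q k = \<alpha> k * (fst q k)\<^sup>2 + \<mu> * (snd q k)\<^sup>2"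

lemma back_oscillator: "damped_oscillator \<mu> (\<alpha> k) (back_u q k) (back_v q k)"
  unfolding back_u_def[abs_def] back_v_def[abs_def] by (rule free_oscillator)

lemma back_0: "back_u q k 0 = fst q k" "back_v q k 0 = - snd q k"
  by (simp_all add: back_u_def back_v_def)

lemma energy_nonneg: "0 \<le> energy q k"
  using \<mu>_pos by (simp add: energy_def less_imp_le)

lemma back_bounds:
  assumes "0 \<le> s"
  shows "(back_u q k s)\<^sup>2 \<le> energy q k / \<alpha> k" "(back_v q k s)\<^sup>2 \<le> energy q k / \<mu>"
    "integral {0..s} (\<lambda>s. (back_v q k s)\<^sup>2) \<le> energy q k / 2"
  using damped_oscillator_bounds[OF back_oscillator \<mu>_pos \<alpha>_pos assms, of q k] by (simp_all add: back_0 energy_def)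

text \<open>The reversed free motion, cut off so that it starts from rest one unit of time before the final
  time \<open>L\<close>; \<open>detour1\<close> is its velocity and \<open>detour_force\<close> is \<open>\<mu>w'' + w' + \<alpha>\<^sub>kw\<close> for \<open>w = detour\<close>.\<close>

definition detour :: "real \<Rightarrow> phase \<Rightarrow> nat \<Rightarrow> real \<Rightarrow> real" where
  "detour L q k t = cutoff (L - t) * back_u q k (L - t)"

definition detour1 :: "real \<Rightarrow> phase \<Rightarrow> nat \<Rightarrow> real \<Rightarrow> real" where
  "detour1 L q k t = - (cutoff1 (L - t) * back_u q k (L - t) + cutoff (L - t) * back_v q k (L - t))"

definition detour_force :: "real \<Rightarrow> phase \<Rightarrow> nat \<Rightarrow> real \<Rightarrow> real" where
  "detour_force L q k t = (\<mu> * cutoff2 (L - t) - cutoff1 (L - t)) * back_u q k (L - t) +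
     (2 * \<mu> * cutoff1 (L - t) - 2 * cutoff (L - t)) * back_v q k (L - t)"

lemma continuous_back:
  "continuous_on {0..L} (\<lambda>t. back_u q k (L - t))" "continuous_on {0..L} (\<lambda>t. back_v q k (L - t))"
  using damped_oscillatorD(1,2)[OF back_oscillator[of k q]]
  by (auto intro!: continuous_on_compose2[of "{0..}" "back_u q k"] continuous_on_compose2[of "{0..}" "back_v q k"] continuous_intros)

lemma continuous_cutoff_back:
  "continuous_on A (\<lambda>t. cutoff (L - t))" "continuous_on A (\<lambda>t. cutoff1 (L - t))" "continuous_on A (\<lambda>t. cutoff2 (L - t))"
  by (auto intro!: continuous_on_compose2[OF continuous_cutoff(1)] continuous_on_compose2[OF continuous_cutoff(2)]
      continuous_on_compose2[OF continuous_cutoff(3)] continuous_intros)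

lemma continuous_detour:
  "continuous_on {0..L} (detour L q k)" "continuous_on {0..L} (detour1 L q k)" "continuous_on {0..L} (detour_force L q k)"
  unfolding detour_def[abs_def] detour1_def[abs_def] detour_force_def[abs_def]
  by (intro continuous_intros continuous_back continuous_cutoff_back)+

lemma detour_end: "detour L q k L = fst q k" "detour1 L q k L = snd q k"
  by (simp_all add: detour_def detour1_def back_0)

lemma detour_start: "1 \<le> L \<Longrightarrow> detour L q k 0 = 0" "1 \<le> L \<Longrightarrow> detour1 L q k 0 = 0"
  by (simp_all add: detour_def detour1_def)

lemma detour_duhamel:
  assumes L: "1 \<le> L" and t: "t \<in> {0..L}"
  shows "((\<lambda>s. g k (t - s) * (detour_force L q k s / \<mu>)) has_integral detour L q k t) {0..t}"
    and "((\<lambda>s. p k (t - s) * (detour_force L q k s / \<mu>)) has_integral detour1 L q k t) {0..t}"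
proof -
  note D = damped_oscillatorD(3,4)[OF back_oscillator[of k q]]
  define detour2 where "detour2 s = cutoff2 (L - s) * back_u q k (L - s) + 2 * cutoff1 (L - s) * back_v q k (L - s)
      - cutoff (L - s) * (\<alpha> k * back_u q k (L - s) + back_v q k (L - s)) / \<mu>" for s
  have i: "((\<lambda>s. L - s) has_real_derivative - 1) (at s)" for s
    by (auto intro!: derivative_eq_intros)
  have dc: "((\<lambda>s. cutoff (L - s)) has_real_derivative - cutoff1 (L - s)) (at s)"
      "((\<lambda>s. cutoff1 (L - s)) has_real_derivative - cutoff2 (L - s)) (at s)" for s
    using DERIV_chain2[where g = "\<lambda>s. L - s", OF DERIV_cutoff i] DERIV_chain2[where g = "\<lambda>s. L - s", OF DERIV_cutoff1 i]
    by simp_all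
  have du: "((\<lambda>s. back_u q k (L - s)) has_real_derivative - back_v q k (L - s)) (at s)"
    and dv: "((\<lambda>s. back_v q k (L - s)) has_real_derivative (\<alpha> k * back_u q k (L - s) + back_v q k (L - s)) / \<mu>) (at s)"
    if "s < L" for s
    using DERIV_chain2[where f = "back_u q k" and g = "\<lambda>s. L - s", OF D(1) i]
      DERIV_chain2[where f = "back_v q k" and g = "\<lambda>s. L - s", OF D(2) i] that
    by (simp_all add: minus_divide_left add.commute)
  have 1: "(detour L q k has_real_derivative detour1 L q k s) (at s)" if "0 < s" "s < t" for s
    unfolding detour_def[abs_def] detour1_def using that t
    by (auto intro!: derivative_eq_intros dc du simp: algebra_simps)
  have 2: "(detour1 L q k has_real_derivative detour2 s) (at s)" if "0 < s" "s < t" for s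
    unfolding detour1_def[abs_def] detour2_def using that t
    by (auto intro!: derivative_eq_intros dc du dv simp: algebra_simps add_divide_distrib)
  have f: "(\<mu> * detour2 s + detour1 L q k s + \<alpha> k * detour L q k s) / \<mu> = detour_force L q k s / \<mu>" for s
    using \<mu>_pos by (simp add: detour2_def detour1_def detour_def detour_force_def field_simps)
  have c: "continuous_on {0..t} (detour L q k)" "continuous_on {0..t} (detour1 L q k)"
    using t by (auto intro: continuous_on_subset[OF continuous_detour(1)] continuous_on_subset[OF continuous_detour(2)])
  have t0: "0 \<le> t" using t by simp
  show "((\<lambda>s. g k (t - s) * (detour_force L q k s / \<mu>)) has_integral detour L q k t) {0..t}"
    using duhamel(1)[where k = k, OF t0 c detour_start[OF L] 1 2] by (simp add: f)
  show "((\<lambda>s. p k (t - s) * (detour_force L q k s / \<mu>)) has_integral detour1 L q k t) {0..t}"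
    using duhamel(2)[where k = k, OF t0 c detour_start[OF L] 1 2] by (simp add: f)
qed

text \<open>The cost of a displacement will depend on \<open>\<mu>\<close> through this number only, which is constant for
  \<open>\<mu> \<le> 1\<close>.\<close>

definition m :: real where
  "m = max 1 \<mu>"

lemma m_bounds: "1 \<le> m" "\<mu> \<le> m"
  by (simp_all add: m_def)

lemma detour_sq_le:
  assumes t: "t \<in> {0..L}"
  shows "(detour L q k t)\<^sup>2 \<le> (if t \<in> {L - 1..L} then energy q k / \<alpha> 0 else 0)"
    and "(detour1 L q k t)\<^sup>2 \<le> (72 / \<alpha> 0 + 2 / \<mu>) * energy q k"
    and "(detour_force L q k t)\<^sup>2 \<le> (if t \<in> {L - 1..L} then 2592 * m\<^sup>2 / \<alpha> 0 * energy q k else 0)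
      + 392 * m\<^sup>2 * (back_v q k (L - t))\<^sup>2"
proof -
  define s where "s = L - t"
  have s: "0 \<le> s" using t by (simp add: s_def)
  define u v where "u = back_u q k s" and "v = back_v q k s"
  note cb = cutoff_bounds[OF s]
  have u: "u\<^sup>2 \<le> energy q k / \<alpha> 0"
  proof -
    have "energy q k / \<alpha> k \<le> energy q k / \<alpha> 0"
      using \<alpha>0_le[of k] energy_nonneg by (intro divide_left_mono) auto
    then show ?thesis using back_bounds(1)[OF s, of q k] by (simp add: u_def)
  qed
  have v: "v\<^sup>2 \<le> energy q k / \<mu>" using back_bounds(2)[OF s] by (simp add: v_def)
  have mult_sq: "(a * b)\<^sup>2 \<le> C\<^sup>2 * d" if "\<bar>a\<bar> \<le> C" "b\<^sup>2 \<le> d" for a b C d :: real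
    unfolding power_mult_distrib using that
    by (intro mult_mono) (auto simp: abs_le_square_iff[symmetric])
  have sum_sq: "(a + b)\<^sup>2 \<le> 2 * a\<^sup>2 + 2 * b\<^sup>2" for a b :: real
    using weighted_sq_add_le[of 1 a b] by simp
  have late: "t \<notin> {L - 1..L} \<Longrightarrow> 1 \<le> s" using t by (auto simp: s_def)
  show "(detour L q k t)\<^sup>2 \<le> (if t \<in> {L - 1..L} then energy q k / \<alpha> 0 else 0)"
  proof (cases "t \<in> {L - 1..L}")
    case True
    then show ?thesis using mult_sq[OF cb(1) u] by (simp add: detour_def s_def[symmetric] u_def)
  next
    case False
    then show ?thesis using late by (auto simp: detour_def s_def)
  qed
  have "(detour1 L q k t)\<^sup>2 = (cutoff1 s * u + cutoff s * v)\<^sup>2"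
    unfolding detour1_def s_def[symmetric] u_def v_def by (rule power2_minus)
  also have "\<dots> \<le> 2 * (6\<^sup>2 * (energy q k / \<alpha> 0)) + 2 * (1\<^sup>2 * (energy q k / \<mu>))"
    using sum_sq[of "cutoff1 s * u" "cutoff s * v"] mult_sq[OF cb(2) u] mult_sq[OF cb(1) v] by linarith
  finally show "(detour1 L q k t)\<^sup>2 \<le> (72 / \<alpha> 0 + 2 / \<mu>) * energy q k"
    by (simp add: algebra_simps)
  have c2: "\<bar>\<mu> * cutoff2 s - cutoff1 s\<bar> \<le> 36 * m" "\<bar>2 * \<mu> * cutoff1 s - 2 * cutoff s\<bar> \<le> 14 * m"
  proof -
    have "\<bar>\<mu> * cutoff2 s\<bar> \<le> m * 30" "\<bar>\<mu> * cutoff1 s\<bar> \<le> m * 6"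
      unfolding abs_mult using cb m_bounds \<mu>_pos by (intro mult_mono; simp)+
    then show "\<bar>\<mu> * cutoff2 s - cutoff1 s\<bar> \<le> 36 * m" "\<bar>2 * \<mu> * cutoff1 s - 2 * cutoff s\<bar> \<le> 14 * m"
      using cb m_bounds by linarith+
  qed
  have fv: "((2 * \<mu> * cutoff1 s - 2 * cutoff s) * v)\<^sup>2 \<le> (14 * m)\<^sup>2 * v\<^sup>2" by (rule mult_sq[OF c2(2) order_refl])
  have fu: "((\<mu> * cutoff2 s - cutoff1 s) * u)\<^sup>2 \<le> (if t \<in> {L - 1..L} then (36 * m)\<^sup>2 * (energy q k / \<alpha> 0) else 0)"
    using mult_sq[OF c2(1) u] late by auto
  show "(detour_force L q k t)\<^sup>2 \<le> (if t \<in> {L - 1..L} then 2592 * m\<^sup>2 / \<alpha> 0 * energy q k else 0)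
      + 392 * m\<^sup>2 * (back_v q k (L - t))\<^sup>2"
  proof -
    have "(detour_force L q k t)\<^sup>2 \<le> 2 * ((\<mu> * cutoff2 s - cutoff1 s) * u)\<^sup>2
        + 2 * ((2 * \<mu> * cutoff1 s - 2 * cutoff s) * v)\<^sup>2"
      unfolding detour_force_def s_def[symmetric] u_def v_def by (rule sum_sq)
    also have "\<dots> \<le> 2 * (if t \<in> {L - 1..L} then (36 * m)\<^sup>2 * (energy q k / \<alpha> 0) else 0) + 2 * ((14 * m)\<^sup>2 * v\<^sup>2)"
      using fu fv by linarith
    also have "\<dots> = (if t \<in> {L - 1..L} then 2592 * m\<^sup>2 / \<alpha> 0 * energy q k else 0) + 392 * m\<^sup>2 * v\<^sup>2"
      by (simp add: power_mult_distrib)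
    finally show ?thesis unfolding v_def s_def .
  qed
qed

text \<open>The decisive estimate: the position contributes for one unit of time only, and the square of the
  velocity has integral at most half the initial energy, by dissipation.\<close>

lemma integral_detour_force_sq_le:
  assumes L: "1 \<le> L"
  shows "integral {0..L} (\<lambda>t. (detour_force L q k t)\<^sup>2) \<le> (2592 / \<alpha> 0 + 196) * m\<^sup>2 * energy q k"
proof -
  let ?V = "\<lambda>s. (back_v q k s)\<^sup>2"
  have "?V integrable_on {0..L}"
    using damped_oscillatorD(2)[OF back_oscillator[of k q]]
    by (intro integrable_continuous_real continuous_on_power) (auto elim: continuous_on_subset)
  then have "(?V has_integral integral {0..L} ?V) {0..L}" by (rule integrable_integral)
  then have "((\<lambda>s. ?V (- s)) has_integral integral {0..L} ?V) {-L..0}"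
    using has_integral_reflect_real[of ?V "integral {0..L} ?V" L 0] by simp
  then have V: "((\<lambda>t. ?V (L - t)) has_integral integral {0..L} ?V) {0..L}"
    using has_integral_shift_Icc_real[of "\<lambda>t. ?V (L - t)" L "integral {0..L} ?V" "- L" 0] by (simp add: o_def)
  define C where "C = 2592 * m\<^sup>2 / \<alpha> 0 * energy q k"
  have "((\<lambda>t. C) has_integral C) {L - 1..L}"
    using has_integral_const_real[of C "L - 1" L] by simp
  then have "((\<lambda>t. if t \<in> {L - 1..L} then C else 0) has_integral C) {0..L}"
    using L by (subst has_integral_restrict) auto
  from has_integral_add[OF this has_integral_mult_right[OF V, of "392 * m\<^sup>2"]]
  have R: "((\<lambda>t. (if t \<in> {L - 1..L} then C else 0) + 392 * m\<^sup>2 * ?V (L - t)) has_integral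
      C + 392 * m\<^sup>2 * integral {0..L} ?V) {0..L}" .
  have "(\<lambda>t. (detour_force L q k t)\<^sup>2) integrable_on {0..L}"
    by (intro integrable_continuous_real continuous_on_power continuous_detour)
  then have "integral {0..L} (\<lambda>t. (detour_force L q k t)\<^sup>2) \<le> C + 392 * m\<^sup>2 * integral {0..L} ?V"
    by (rule has_integral_le[OF integrable_integral R]) (unfold C_def, rule detour_sq_le(3))
  also have "\<dots> \<le> C + 392 * m\<^sup>2 * (energy q k / 2)"
    using back_bounds(3)[of L q k] L by (intro add_left_mono mult_left_mono) auto
  finally show ?thesis by (simp add: C_def algebra_simps)
qed

end

context controlled_wave
begin

lemma energy_summable:
  assumes q: "q \<in> ph \<alpha> (1 + 2 * \<beta>)"
  shows "(\<lambda>k. \<alpha> k powr (2 * \<beta>) * energy q k) summable_on UNIV"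
    and "(\<Sum>\<^sub>\<infinity>k. \<alpha> k powr (2 * \<beta>) * energy q k) \<le> m * (ph_norm \<alpha> (1 + 2 * \<beta>) q)\<^sup>2"
proof -
  have eq: "\<alpha> k powr (2 * \<beta>) * energy q k =
      \<alpha> k powr (1 + 2 * \<beta>) * (fst q k)\<^sup>2 + \<mu> * (\<alpha> k powr (2 * \<beta>) * (snd q k)\<^sup>2)" for k
    using powr_add[of "\<alpha> k" 1 "2 * \<beta>"] abs_of_pos[OF \<alpha>_pos[of k]] by (simp add: energy_def algebra_simps)
  have s: "(\<lambda>k. \<alpha> k powr (1 + 2 * \<beta>) * (fst q k)\<^sup>2) summable_on UNIV"
      "(\<lambda>k. \<alpha> k powr (2 * \<beta>) * (snd q k)\<^sup>2) summable_on UNIV"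
    using q by (auto simp: ph_def hs_def)
  show "(\<lambda>k. \<alpha> k powr (2 * \<beta>) * energy q k) summable_on UNIV"
    unfolding eq by (intro summable_on_add summable_on_cmult_right s)
  have "(\<Sum>\<^sub>\<infinity>k. \<alpha> k powr (2 * \<beta>) * energy q k) =
      (hs_norm \<alpha> (1 + 2 * \<beta>) (fst q))\<^sup>2 + \<mu> * (hs_norm \<alpha> (2 * \<beta>) (snd q))\<^sup>2"
    unfolding eq hs_norm_sq using s by (subst infsum_add) (auto intro: summable_on_cmult_right simp: infsum_cmult_right')
  also have "\<dots> \<le> m * (hs_norm \<alpha> (1 + 2 * \<beta>) (fst q))\<^sup>2 + m * (hs_norm \<alpha> (2 * \<beta>) (snd q))\<^sup>2"
    using m_bounds mult_right_mono[of 1 m "(hs_norm \<alpha> (1 + 2 * \<beta>) (fst q))\<^sup>2"]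
    by (intro add_mono mult_right_mono) auto
  finally show "(\<Sum>\<^sub>\<infinity>k. \<alpha> k powr (2 * \<beta>) * energy q k) \<le> m * (ph_norm \<alpha> (1 + 2 * \<beta>) q)\<^sup>2"
    by (simp add: ph_norm_sq distrib_left)
qed

lemma weighted_energy_dominated:
  assumes q: "q \<in> ph \<alpha> (1 + 2 * \<beta>)" and \<delta>: "\<delta> \<le> 2 * \<beta>" and C: "0 \<le> C"
    and h: "\<And>k. (h k)\<^sup>2 \<le> C * energy q k"
  shows "\<alpha> k powr \<delta> * (h k)\<^sup>2 \<le> \<alpha> 0 powr (\<delta> - 2 * \<beta>) * C * (\<alpha> k powr (2 * \<beta>) * energy q k)"
proof -
  have "\<alpha> k powr \<delta> * (h k)\<^sup>2 \<le> (\<alpha> 0 powr (\<delta> - 2 * \<beta>) * \<alpha> k powr (2 * \<beta>)) * (C * energy q k)"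
    using \<alpha>_powr_mono[OF \<delta>, of k] h by (intro mult_mono) auto
  then show ?thesis by (simp add: mult_ac)
qed

definition detour_path :: "real \<Rightarrow> phase \<Rightarrow> real \<Rightarrow> phase" where
  "detour_path L q t = ((\<lambda>k. detour L q k t), (\<lambda>k. detour1 L q k t))"

lemma detour_regular:
  assumes q: "q \<in> ph \<alpha> (1 + 2 * \<beta>)" and t: "t \<in> {0..L}"
  shows "(\<lambda>k. detour L q k t) \<in> hs \<alpha> (2 * \<beta>)"
    and "(hs_norm \<alpha> (2 * \<beta>) (\<lambda>k. detour L q k t))\<^sup>2
      \<le> (if t \<in> {L - 1..L} then m * (ph_norm \<alpha> (1 + 2 * \<beta>) q)\<^sup>2 / \<alpha> 0 else 0)"
    and "(\<lambda>k. detour_force L q k t) \<in> hs \<alpha> (2 * \<beta>)"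
proof -
  define a where "a k = \<alpha> k powr (2 * \<beta>) * energy q k" for k
  define i :: real where "i = (if t \<in> {L - 1..L} then 1 / \<alpha> 0 else 0)"
  have a: "a summable_on UNIV" "infsum a UNIV \<le> m * (ph_norm \<alpha> (1 + 2 * \<beta>) q)\<^sup>2"
    using energy_summable[OF q] by (simp_all add: a_def[abs_def])
  have i0: "0 \<le> i" by (simp add: i_def less_imp_le)
  have le: "\<alpha> k powr (2 * \<beta>) * (detour L q k t)\<^sup>2 \<le> i * a k" for k
  proof -
    have "(detour L q k t)\<^sup>2 \<le> i * energy q k" for k
      using detour_sq_le(1)[OF t, of q k] by (auto simp: i_def split: if_splits)
    from weighted_energy_dominated[OF q order_refl i0 this] show ?thesis by (simp add: a_def)
  qed
  note d = hs_dominated[where x = "\<lambda>k. detour L q k t", OF le summable_on_cmult_right[OF a(1)]]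
  show "(\<lambda>k. detour L q k t) \<in> hs \<alpha> (2 * \<beta>)" by (rule d(1))
  have "infsum (\<lambda>k. i * a k) UNIV = i * infsum a UNIV" by (rule infsum_cmult_right')
  then have "(hs_norm \<alpha> (2 * \<beta>) (\<lambda>k. detour L q k t))\<^sup>2 \<le> i * (m * (ph_norm \<alpha> (1 + 2 * \<beta>) q)\<^sup>2)"
    using d(2) mult_left_mono[OF a(2) i0] by linarith
  then show "(hs_norm \<alpha> (2 * \<beta>) (\<lambda>k. detour L q k t))\<^sup>2
      \<le> (if t \<in> {L - 1..L} then m * (ph_norm \<alpha> (1 + 2 * \<beta>) q)\<^sup>2 / \<alpha> 0 else 0)"
    by (auto simp: i_def split: if_splits)
  define C where "C = 2592 * m\<^sup>2 / \<alpha> 0 + 392 * m\<^sup>2 / \<mu>"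
  have C: "0 \<le> C" using \<mu>_pos by (simp add: C_def less_imp_le)
  have f: "(detour_force L q k t)\<^sup>2 \<le> C * energy q k" for k
  proof -
    have "(detour_force L q k t)\<^sup>2 \<le> 2592 * m\<^sup>2 / \<alpha> 0 * energy q k + 392 * m\<^sup>2 * (energy q k / \<mu>)"
    proof (rule order_trans[OF detour_sq_le(3)[OF t]], rule add_mono)
      show "(if t \<in> {L - 1..L} then 2592 * m\<^sup>2 / \<alpha> 0 * energy q k else 0) \<le> 2592 * m\<^sup>2 / \<alpha> 0 * energy q k"
        using energy_nonneg[of q k] by (simp add: less_imp_le)
      show "392 * m\<^sup>2 * (back_v q k (L - t))\<^sup>2 \<le> 392 * m\<^sup>2 * (energy q k / \<mu>)"
        using t by (intro mult_left_mono back_bounds(2)) auto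
    qed
    then show ?thesis by (simp add: C_def algebra_simps)
  qed
  have fa: "\<alpha> k powr (2 * \<beta>) * (detour_force L q k t)\<^sup>2 \<le> C * a k" for k
    using weighted_energy_dominated[OF q order_refl C, of "\<lambda>k. detour_force L q k t" k] f by (simp add: a_def)
  show "(\<lambda>k. detour_force L q k t) \<in> hs \<alpha> (2 * \<beta>)"
    by (rule hs_dominated(1)[OF fa summable_on_cmult_right[OF a(1)]])
qed

lemma detour_path_mem:
  assumes q: "q \<in> ph \<alpha> (1 + 2 * \<beta>)"
  shows "detour_path L q \<in> paths \<alpha> 0 L"
proof -
  define a where "a C \<delta> k = \<alpha> 0 powr (\<delta> - 2 * \<beta>) * C * (\<alpha> k powr (2 * \<beta>) * energy q k)" for C \<delta> k
  have a: "a C \<delta> summable_on UNIV" for C \<delta>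
    unfolding a_def by (intro summable_on_cmult_right energy_summable(1) q)
  have 1: "\<alpha> k powr 0 * (detour L q k t)\<^sup>2 \<le> a (1 / \<alpha> 0) 0 k" if t: "t \<in> {0..L}" for t k
    unfolding a_def
  proof (rule weighted_energy_dominated[OF q])
    show "(detour L q k t)\<^sup>2 \<le> 1 / \<alpha> 0 * energy q k" for k
      using detour_sq_le(1)[OF t, of q k] energy_nonneg[of q k] divide_nonneg_pos[OF energy_nonneg[of q k] \<alpha>_pos[of 0]]
      by (auto split: if_splits)
  qed (use \<beta>_nonneg in \<open>auto simp: less_imp_le\<close>)
  have 2: "\<alpha> k powr (-1) * (detour1 L q k t)\<^sup>2 \<le> a (72 / \<alpha> 0 + 2 / \<mu>) (-1) k" if t: "t \<in> {0..L}" for t k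
    unfolding a_def using \<beta>_nonneg \<mu>_pos
    by (intro weighted_energy_dominated[OF q] detour_sq_le(2)[OF t]) (auto simp: less_imp_le)
  show ?thesis
    unfolding paths_iff
  proof (intro ballI conjI allI impI)
    fix t assume t: "t \<in> {0..L}"
    show "detour_path L q t \<in> ph \<alpha> 0"
      unfolding detour_path_def ph_def using hs_dominated(1)[OF 1[OF t] a] hs_dominated(1)[OF 2[OF t] a] by simp
    fix \<epsilon> :: real assume "\<epsilon> > 0"
    then have e: "\<epsilon> / 2 > 0" by simp
    obtain \<eta>1 where 3: "\<eta>1 > 0" "\<And>s. s \<in> {0..L} \<Longrightarrow> \<bar>s - t\<bar> < \<eta>1 \<Longrightarrow>
        hs_norm \<alpha> 0 ((\<lambda>k. detour L q k s) - (\<lambda>k. detour L q k t)) < \<epsilon> / 2"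
      using dominated_continuous[OF continuous_detour(1) a 1 t e] by blast
    obtain \<eta>2 where 4: "\<eta>2 > 0" "\<And>s. s \<in> {0..L} \<Longrightarrow> \<bar>s - t\<bar> < \<eta>2 \<Longrightarrow>
        hs_norm \<alpha> (-1) ((\<lambda>k. detour1 L q k s) - (\<lambda>k. detour1 L q k t)) < \<epsilon> / 2"
      using dominated_continuous[OF continuous_detour(2) a 2 t e] by blast
    have "ph_norm \<alpha> 0 (detour_path L q s - detour_path L q t) < \<epsilon>" if "s \<in> {0..L}" "\<bar>s - t\<bar> < min \<eta>1 \<eta>2" for s
      using ph_norm_le_add[of \<alpha> 0 "detour_path L q s - detour_path L q t"] 3(2)[of s] 4(2)[of s] that
      by (simp add: detour_path_def)
    then show "\<exists>\<eta>>0. \<forall>s\<in>{0..L}. \<bar>s - t\<bar> < \<eta> \<longrightarrow> ph_norm \<alpha> 0 (detour_path L q s - detour_path L q t) < \<epsilon>"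
      using 3(1) 4(1) by (intro exI[of _ "min \<eta>1 \<eta>2"]) auto
  qed
qed

text \<open>Half the squared norm of the control that has to be added for the detour is at most this
  number times the square of the displacement.  The three terms come from the position, from the velocity and from
  the change of \<open>B\<close> along the path.\<close>

definition cost_factor :: real where
  "cost_factor = c\<^sup>2 * (2592 / \<alpha> 0 + 196 + (\<gamma> (2 * \<beta>))\<^sup>2 / \<alpha> 0) * m ^ 3"

lemma cost_factor_nonneg: "0 \<le> cost_factor"
  using m_bounds by (simp add: cost_factor_def less_imp_le)

text \<open>The detour is superimposed on the given path.  The additional control provides its force and
  compensates the change of \<open>B\<close>, which is at most \<open>\<gamma>\<close> times the size of the detour in \<open>H\<^sup>2\<^sup>\<beta>\<close>.\<close>

lemma steers_displaced:
  assumes st: "steers T z \<psi>" and T: "1 \<le> T" and q: "q \<in> ph \<alpha> (1 + 2 * \<beta>)" and \<eta>: "0 < \<eta>"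
  obtains z' \<psi>' where "steers T z' \<psi>'" "z' T = z T + q"
    "(L2_time_norm \<alpha> 0 T \<psi>')\<^sup>2 \<le> (1 + \<eta>) * (L2_time_norm \<alpha> 0 T \<psi>)\<^sup>2
       + (1 + 1 / \<eta>) * (2 * cost_factor * (ph_norm \<alpha> (1 + 2 * \<beta>) q)\<^sup>2)"
proof -
  let ?n = "hs_norm \<alpha> (2 * \<beta>)" and ?N = "L2_time_norm \<alpha> 0 T"
  note s = steersD[OF st]
  have b0: "0 \<le> 2 * \<beta>" using \<beta>_nonneg by simp
  define N where "N = (ph_norm \<alpha> (1 + 2 * \<beta>) q)\<^sup>2"
  define w f where "w t = (\<lambda>k. detour T q k t)" and "f t = (\<lambda>k. detour_force T q k t)" for t
  define z' where "z' t = z t + detour_path T q t" for t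
  have fst_z': "fst (z' t) = fst (z t) + w t" for t by (simp add: z'_def detour_path_def w_def)
  define b where "b t = B (fst (z' t)) - B (fst (z t))" for t
  define \<theta> where "\<theta> t = (\<lambda>k. (f t - b t) k / lam k)" for t
  define \<psi>' where "\<psi>' t = \<psi> t + \<theta> t" for t
  have z': "z' \<in> paths \<alpha> 0 T"
    unfolding z'_def by (intro paths_add s(2) detour_path_mem q)
  have w: "w t \<in> hs \<alpha> (2 * \<beta>)" and f: "f t \<in> hs \<alpha> (2 * \<beta>)"
    and wN: "(?n (w t))\<^sup>2 \<le> (if t \<in> {T - 1..T} then m * N / \<alpha> 0 else 0)" if "t \<in> {0..T}" for t
    unfolding w_def f_def N_def by (fact detour_regular[OF q that])+
  define J where "J t = (if t \<in> {T - 1..T} then (\<gamma> (2 * \<beta>))\<^sup>2 * (m * N / \<alpha> 0) else 0)" for t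
  have b: "b t \<in> hs \<alpha> (2 * \<beta>)" "(?n (b t))\<^sup>2 \<le> J t" if t: "t \<in> {0..T}" for t
  proof -
    have u: "fst (z t) \<in> hs \<alpha> (2 * \<beta>)" "fst (z' t) \<in> hs \<alpha> (2 * \<beta>)"
      using steered_regular[OF st t] w[OF t] by (auto simp: fst_z' intro: hs_add)
    show "b t \<in> hs \<alpha> (2 * \<beta>)" unfolding b_def by (intro hs_diff B_mem b0 order_refl u)
    have "?n (b t) \<le> \<gamma> (2 * \<beta>) * ?n (w t)"
      using B_diff_le[OF b0 order_refl u(2,1)] by (simp add: b_def fst_z')
    from power_mono[OF this hs_norm_nonneg, of 2]
    have "(?n (b t))\<^sup>2 \<le> (\<gamma> (2 * \<beta>))\<^sup>2 * (?n (w t))\<^sup>2"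
      by (simp add: power_mult_distrib)
    also have "\<dots> \<le> (\<gamma> (2 * \<beta>))\<^sup>2 * (if t \<in> {T - 1..T} then m * N / \<alpha> 0 else 0)"
      by (intro mult_left_mono wN[OF t]) simp
    finally show "(?n (b t))\<^sup>2 \<le> J t" by (auto simp: J_def split: if_splits)
  qed
  (* A majorant of the squared norm of the additional control whose integral is computable. *)
  define R where "R t = 2 * c\<^sup>2 * ((?n (f t))\<^sup>2 + J t)" for t
  have \<theta>: "\<theta> t \<in> hs \<alpha> 0" "(hs_norm \<alpha> 0 (\<theta> t))\<^sup>2 \<le> R t" if t: "t \<in> {0..T}" for t
  proof -
    have d: "f t - b t \<in> hs \<alpha> (2 * \<beta>)" by (intro hs_diff f b t)
    show "\<theta> t \<in> hs \<alpha> 0" unfolding \<theta>_def by (rule Q_inverse_bound(1)[OF d])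
    have "(hs_norm \<alpha> 0 (\<theta> t))\<^sup>2 \<le> c\<^sup>2 * (?n (f t - b t))\<^sup>2"
      unfolding \<theta>_def by (rule Q_inverse_bound(2)[OF d])
    also have "\<dots> \<le> c\<^sup>2 * (2 * (?n (f t))\<^sup>2 + 2 * J t)"
      using hs_norm_sq_add2_le[OF f[OF t] hs_minus(1)[OF b(1)[OF t]]] b(2)[OF t]
      by (intro mult_left_mono) (simp_all add: hs_minus(2))
    finally show "(hs_norm \<alpha> 0 (\<theta> t))\<^sup>2 \<le> R t"
      by (simp add: R_def algebra_simps)
  qed
  have R: "R integrable_on {0..T}" "integral {0..T} R \<le> 2 * cost_factor * N"
  proof -
    define a where "a k = \<alpha> k powr (2 * \<beta>) * energy q k" for k
    have a: "a summable_on UNIV" "infsum a UNIV \<le> m * N"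
      using energy_summable[OF q] by (simp_all add: a_def[abs_def] N_def)
    define C where "C = (2592 / \<alpha> 0 + 196) * m\<^sup>2"
    have C: "0 \<le> C" by (simp add: C_def less_imp_le)
    have le: "\<alpha> k powr (2 * \<beta>) * integral {0..T} (\<lambda>t. (detour_force T q k t)\<^sup>2) \<le> C * a k" for k
      using mult_left_mono[OF integral_detour_force_sq_le[OF T, of q k], of "\<alpha> k powr (2 * \<beta>)"]
      by (simp add: C_def a_def mult_ac)
    note I = integral_hs_norm_sq_le[OF continuous_detour(3) detour_regular(3)[OF q] le summable_on_cmult_right[OF a(1)]]
    have I': "(\<lambda>t. (?n (f t))\<^sup>2) integrable_on {0..T}"
        "integral {0..T} (\<lambda>t. (?n (f t))\<^sup>2) \<le> C * (m * N)"
      using I(1) order_trans[OF I(2), of "C * (m * N)"] mult_left_mono[OF a(2) C]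
      by (simp_all add: f_def infsum_cmult_right')
    define j where "j = (\<gamma> (2 * \<beta>))\<^sup>2 * (m * N / \<alpha> 0)"
    have "((\<lambda>t. j) has_integral j) {T - 1..T}"
      using has_integral_const_real[of j "T - 1" T] by simp
    then have J: "(J has_integral j) {0..T}"
      unfolding J_def j_def[symmetric] using T by (subst has_integral_restrict) auto
    have R: "(R has_integral 2 * c\<^sup>2 * (integral {0..T} (\<lambda>t. (?n (f t))\<^sup>2) + j)) {0..T}"
      unfolding R_def by (intro has_integral_mult_right has_integral_add integrable_integral I'(1) J)
    then show "R integrable_on {0..T}" by blast
    have j: "j \<le> (\<gamma> (2 * \<beta>))\<^sup>2 / \<alpha> 0 * (m ^ 3 * N)"
    proof -
      have "m * N \<le> m ^ 3 * N"
        using m_bounds(1) power_increasing[of 1 3 m] by (intro mult_right_mono) (auto simp: N_def)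
      from mult_left_mono[OF this, of "(\<gamma> (2 * \<beta>))\<^sup>2 / \<alpha> 0"] show ?thesis by (simp add: j_def less_imp_le)
    qed
    have "integral {0..T} R \<le> 2 * c\<^sup>2 * (C * (m * N) + (\<gamma> (2 * \<beta>))\<^sup>2 / \<alpha> 0 * (m ^ 3 * N))"
      unfolding integral_unique[OF R] by (intro mult_left_mono add_mono I'(2) j) simp
    also have "\<dots> = 2 * cost_factor * N"
      by (simp add: cost_factor_def C_def power3_eq_cube power2_eq_square algebra_simps)
    finally show "integral {0..T} R \<le> 2 * cost_factor * N" .
  qed
  have cz: "continuous_on {0..T} (\<lambda>t. \<theta> t k)" for k
    unfolding \<theta>_def b_def f_def fun_diff_def minus_apply
    by (intro continuous_intros continuous_detour continuous_B_along_path[OF z'] continuous_B_along_path[OF s(2)]) simp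
  define U where "U t = (1 + \<eta>) * (hs_norm \<alpha> 0 (\<psi> t))\<^sup>2 + (1 + 1 / \<eta>) * R t" for t
  have \<psi>sq: "(\<lambda>t. (hs_norm \<alpha> 0 (\<psi> t))\<^sup>2) integrable_on {0..T}" and \<psi>m: "\<And>t. t \<in> {0<..<T} \<Longrightarrow> \<psi> t \<in> hs \<alpha> 0"
    using s(4) by (auto simp: L2_time_iff)
  have U: "U integrable_on {0..T}"
    unfolding U_def by (intro integrable_add integrable_on_mult_right \<psi>sq R(1))
  have \<psi>'m: "\<psi>' t \<in> hs \<alpha> 0" "(hs_norm \<alpha> 0 (\<psi>' t))\<^sup>2 \<le> U t" if t: "t \<in> {0<..<T}" for t
  proof -
    have t': "t \<in> {0..T}" using t by auto
    show "\<psi>' t \<in> hs \<alpha> 0" unfolding \<psi>'_def by (intro hs_add \<psi>m[OF t] \<theta>(1)[OF t'])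
    have "(1 + 1 / \<eta>) * (hs_norm \<alpha> 0 (\<theta> t))\<^sup>2 \<le> (1 + 1 / \<eta>) * R t"
      using \<eta> by (intro mult_left_mono \<theta>(2)[OF t']) auto
    then show "(hs_norm \<alpha> 0 (\<psi>' t))\<^sup>2 \<le> U t"
      unfolding \<psi>'_def U_def using hs_norm_sq_add_le[OF \<psi>m[OF t] \<theta>(1)[OF t'] \<eta>] by linarith
  qed
  have coord: "(\<lambda>t. \<psi>' t k) absolutely_integrable_on {0..T}" for k
    unfolding \<psi>'_def plus_fun_apply using s(4)
    by (intro set_integral_add(1) absolutely_integrable_continuous_real[OF cz]) (auto simp: L2_time_iff)
  have sq: "(\<lambda>t. (hs_norm \<alpha> 0 (\<psi>' t))\<^sup>2) integrable_on {0<..<T}"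
  proof (rule measurable_bounded_by_integrable_imp_integrable_real)
    show "(\<lambda>t. (hs_norm \<alpha> 0 (\<psi>' t))\<^sup>2) \<in> borel_measurable (lebesgue_on {0<..<T})"
    proof (rule hs_measurable_norm_sq)
      show "(\<lambda>t. \<psi>' t k) \<in> borel_measurable (lebesgue_on {0<..<T})" for k
        using coord[of k] by (simp add: absolutely_integrable_on_Icc_iff_Ioo absolutely_integrable_measurable_real)
    qed (use \<psi>'m in simp)
    show "U integrable_on {0<..<T}" using U by (simp add: integrable_on_Icc_iff_Ioo)
    show "\<bar>(hs_norm \<alpha> 0 (\<psi>' t))\<^sup>2\<bar> \<le> U t" if "t \<in> {0<..<T}" for t using \<psi>'m(2)[OF that] by simp
  qed simp
  have \<psi>': "\<psi>' \<in> L2_time \<alpha> 0 T"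
    unfolding L2_time_iff using \<psi>'m(1) coord sq by (simp add: integrable_on_Icc_iff_Ioo)
  have cost: "(?N \<psi>')\<^sup>2 \<le> (1 + \<eta>) * (?N \<psi>)\<^sup>2 + (1 + 1 / \<eta>) * (2 * cost_factor * N)"
  proof -
    have "(?N \<psi>')\<^sup>2 = integral {0<..<T} (\<lambda>t. (hs_norm \<alpha> 0 (\<psi>' t))\<^sup>2)"
      unfolding L2_time_norm_sq[OF \<psi>'] by (rule integral_open_interval_real)
    also have "\<dots> \<le> integral {0<..<T} U"
      using U \<psi>'m(2) by (intro integral_le sq) (auto simp: integrable_on_Icc_iff_Ioo)
    also have "\<dots> = integral {0..T} U" by (rule integral_open_interval_real[symmetric])
    also have "\<dots> = (1 + \<eta>) * (?N \<psi>)\<^sup>2 + (1 + 1 / \<eta>) * integral {0..T} R"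
      unfolding U_def L2_time_norm_sq[OF s(4)] using \<psi>sq R(1)
      by (subst integral_add) (auto intro: integrable_on_mult_right)
    also have "\<dots> \<le> (1 + \<eta>) * (?N \<psi>)\<^sup>2 + (1 + 1 / \<eta>) * (2 * cost_factor * N)"
      using \<eta> by (intro add_left_mono mult_left_mono R(2)) auto
    finally show ?thesis .
  qed
  have frc: "force z' \<psi>' k t = force z \<psi> k t + detour_force T q k t / \<mu>" for k t
    by (simp add: force_def \<psi>'_def \<theta>_def b_def f_def distrib_left add_divide_distrib[symmetric])
  have steers: "steers T z' \<psi>'"
  proof (rule steersI[OF s(1) z' _ \<psi>'])
    show "z' 0 = 0" using s(3) detour_start[OF T] by (simp add: z'_def detour_path_def zero_prod_def zero_fun_def)
    fix t k assume t: "t \<in> {0..T}"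
    show "((\<lambda>s. g k (t - s) * force z' \<psi>' k s) has_integral fst (z' t) k) {0..t}"
      using has_integral_add[OF s(5)[OF t] detour_duhamel(1)[OF T t]]
      by (simp add: frc fst_z' w_def distrib_left)
    show "((\<lambda>s. p k (t - s) * force z' \<psi>' k s) has_integral snd (z' t) k) {0..t}"
      using has_integral_add[OF s(6)[OF t] detour_duhamel(2)[OF T t]]
      by (simp add: frc z'_def detour_path_def distrib_left)
  qed
  have end_point: "z' T = z T + q"
    by (simp add: z'_def detour_path_def detour_end)
  show thesis by (rule that[OF steers end_point cost[unfolded N_def]])
qed


section \<open>The quasi-potential\<close>

abbreviation V :: "phase \<Rightarrow> ereal" where
  "V \<equiv> quasi_potential \<alpha> S B Q \<mu>"

abbreviation W :: "coeffs \<Rightarrow> ereal" where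
  "W \<equiv> quasi_potential_pos \<alpha> S B Q \<mu>"

lemma V_le_cost:
  assumes "steers T z \<psi>"
  shows "V (z T) \<le> ereal (1 / 2 * (L2_time_norm \<alpha> 0 T \<psi>)\<^sup>2)"
proof -
  have "V (z T) \<le> action \<alpha> S B Q \<mu> 0 T z"
    unfolding quasi_potential_def using assms by (intro Inf_lower) (auto simp: steers_def)
  also have "\<dots> \<le> ereal (1 / 2 * (L2_time_norm \<alpha> 0 T \<psi>)\<^sup>2)"
    unfolding action_def using assms by (intro Inf_lower) (auto simp: steers_def)
  finally show ?thesis .
qed

lemma V_less_cost:
  assumes "V x < r"
  obtains T z \<psi> where "steers T z \<psi>" "z T = x" "ereal (1 / 2 * (L2_time_norm \<alpha> 0 T \<psi>)\<^sup>2) < r"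
proof -
  obtain T z where z: "T > 0" "z \<in> paths \<alpha> 0 T" "z 0 = 0" "z T = x" "action \<alpha> S B Q \<mu> 0 T z < r"
    using assms unfolding quasi_potential_def Inf_less_iff by blast
  then obtain \<psi> where "\<psi> \<in> L2_time \<alpha> 0 T" "mild_solution S B Q \<mu> 0 T \<psi> z" "ereal (1 / 2 * (L2_time_norm \<alpha> 0 T \<psi>)\<^sup>2) < r"
    unfolding action_def Inf_less_iff by blast
  with z show thesis by (intro that[of T z \<psi>]) (auto simp: steers_def)
qed

lemma V_nonneg: "0 \<le> V x"
  unfolding quasi_potential_def action_def by (auto intro!: Inf_greatest)

lemma V_0: "V 0 = 0"
proof (rule antisym[OF _ V_nonneg])
  have z: "(\<lambda>t. 0) \<in> paths \<alpha> 0 1" by (auto simp: paths_iff intro!: exI[of _ 1])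
  have \<psi>: "(\<lambda>t. 0) \<in> L2_time \<alpha> 0 1" by (simp add: L2_time_iff integrable_0)
  have "steers 1 (\<lambda>t. 0) (\<lambda>t. 0)"
    by (rule steersI) (auto simp: z \<psi> force_def B_zero)
  from V_le_cost[OF this] show "V 0 \<le> 0" by (simp add: L2_time_norm_def zero_ereal_def)
qed

text \<open>This makes the square root of the quasi-potential Lipschitz on \<open>\<H>\<close> along increments in
  \<open>\<H>\<^sub>1\<^sub>+\<^sub>2\<^sub>\<beta>\<close>: optimizing over \<open>\<eta>\<close> completes the square.\<close>

lemma V_displaced:
  assumes q: "q \<in> ph \<alpha> (1 + 2 * \<beta>)" and \<eta>: "0 < \<eta>"
  shows "V (x + q) \<le> ereal (1 + \<eta>) * V x + ereal ((1 + 1 / \<eta>) * (cost_factor * (ph_norm \<alpha> (1 + 2 * \<beta>) q)\<^sup>2))"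
proof (cases "V x")
  case (real v)
  define N where "N = (1 + 1 / \<eta>) * (cost_factor * (ph_norm \<alpha> (1 + 2 * \<beta>) q)\<^sup>2)"
  have "V (x + q) \<le> ereal ((1 + \<eta>) * v + N) + ereal e" if e: "e > 0" for e
  proof -
    have "V x < ereal (v + e / (1 + \<eta>))" using real e \<eta> by simp
    then obtain T z \<psi> where st: "steers T z \<psi>" "z T = x"
      and c: "1 / 2 * (L2_time_norm \<alpha> 0 T \<psi>)\<^sup>2 < v + e / (1 + \<eta>)"
      by (elim V_less_cost) auto
    obtain z1 \<psi>1 where st1: "steers (T + 1) z1 \<psi>1" "z1 (T + 1) = x" "L2_time_norm \<alpha> 0 (T + 1) \<psi>1 = L2_time_norm \<alpha> 0 T \<psi>"
      using steers_delay[OF st(1)] st(2) by metis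
    have T: "1 \<le> T + 1" using steersD(1)[OF st(1)] by simp
    obtain z2 \<psi>2 where st2: "steers (T + 1) z2 \<psi>2" "z2 (T + 1) = x + q"
      and c2: "(L2_time_norm \<alpha> 0 (T + 1) \<psi>2)\<^sup>2 \<le> (1 + \<eta>) * (L2_time_norm \<alpha> 0 T \<psi>)\<^sup>2
        + (1 + 1 / \<eta>) * (2 * cost_factor * (ph_norm \<alpha> (1 + 2 * \<beta>) q)\<^sup>2)"
      using steers_displaced[OF st1(1) T q \<eta>] st1(2,3) by metis
    have "V (x + q) \<le> ereal (1 / 2 * (L2_time_norm \<alpha> 0 (T + 1) \<psi>2)\<^sup>2)"
      using V_le_cost[OF st2(1)] st2(2) by simp
    also have "\<dots> \<le> ereal ((1 + \<eta>) * (1 / 2 * (L2_time_norm \<alpha> 0 T \<psi>)\<^sup>2) + N)"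
    proof -
      have "(1 + 1 / \<eta>) * (2 * cost_factor * (ph_norm \<alpha> (1 + 2 * \<beta>) q)\<^sup>2) = 2 * N" by (simp add: N_def)
      moreover have "(1 + \<eta>) * (1 / 2 * (L2_time_norm \<alpha> 0 T \<psi>)\<^sup>2) = (1 + \<eta>) * (L2_time_norm \<alpha> 0 T \<psi>)\<^sup>2 / 2" by simp
      ultimately show ?thesis using c2 by simp
    qed
    also have "\<dots> \<le> ereal ((1 + \<eta>) * (v + e / (1 + \<eta>)) + N)"
      using c \<eta> by (auto intro!: mult_left_mono)
    also have "(1 + \<eta>) * (v + e / (1 + \<eta>)) + N = (1 + \<eta>) * v + N + e"
      using \<eta> by (simp add: field_simps)
    finally show ?thesis by simp
  qed
  then have "V (x + q) \<le> ereal ((1 + \<eta>) * v + N)" by (rule ereal_le_epsilon2)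
  then show ?thesis using real by (simp add: N_def)
qed (use V_nonneg[of x] \<eta> in auto)

lemma W_nonneg: "0 \<le> W x"
  unfolding quasi_potential_pos_def by (auto intro!: INF_greatest V_nonneg)

lemma W_0: "W 0 = 0"
proof (rule antisym[OF _ W_nonneg])
  have "W 0 \<le> V (0, 0)" unfolding quasi_potential_pos_def by (rule INF_lower) simp
  then show "W 0 \<le> 0" using V_0 by (simp add: zero_prod_def)
qed

text \<open>The displacement \<open>(\<xi>, 0)\<close> leaves the velocity alone, however rough the latter may be.\<close>

lemma W_displaced:
  assumes \<xi>: "\<xi> \<in> hs \<alpha> (1 + 2 * \<beta>)" and \<eta>: "0 < \<eta>"
  shows "W (x + \<xi>) \<le> ereal (1 + \<eta>) * W x + ereal ((1 + 1 / \<eta>) * (cost_factor * (hs_norm \<alpha> (1 + 2 * \<beta>) \<xi>)\<^sup>2))"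
proof -
  define N where "N = (1 + 1 / \<eta>) * (cost_factor * (hs_norm \<alpha> (1 + 2 * \<beta>) \<xi>)\<^sup>2)"
  have q: "(\<xi>, 0) \<in> ph \<alpha> (1 + 2 * \<beta>)" "ph_norm \<alpha> (1 + 2 * \<beta>) (\<xi>, 0) = hs_norm \<alpha> (1 + 2 * \<beta>) \<xi>"
    using \<xi> by (simp_all add: ph_def ph_norm_def hs_norm_nonneg)
  have V: "W (x + \<xi>) \<le> ereal (1 + \<eta>) * V (x, y) + ereal N" if y: "y \<in> hs \<alpha> (-1)" for y
  proof -
    have "W (x + \<xi>) \<le> V (x + \<xi>, y)" unfolding quasi_potential_pos_def by (rule INF_lower[OF y])
    also have "(x + \<xi>, y) = (x, y) + (\<xi>, 0)" by simp
    also note V_displaced[OF q(1) \<eta>, of "(x, y)"]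
    finally show ?thesis unfolding N_def q(2) .
  qed
  show ?thesis
  proof (cases "W x")
    case (real v)
    have "W (x + \<xi>) \<le> ereal ((1 + \<eta>) * v + N) + ereal e" if e: "e > 0" for e
    proof -
      have "W x < ereal (v + e / (1 + \<eta>))" using real e \<eta> by simp
      then obtain y where y: "y \<in> hs \<alpha> (-1)" "V (x, y) < ereal (v + e / (1 + \<eta>))"
        unfolding quasi_potential_pos_def by (auto simp: INF_less_iff)
      have "ereal (1 + \<eta>) * V (x, y) \<le> ereal (1 + \<eta>) * ereal (v + e / (1 + \<eta>))"
        using y(2) \<eta> by (intro ereal_mult_left_mono) auto
      then have "W (x + \<xi>) \<le> ereal (1 + \<eta>) * ereal (v + e / (1 + \<eta>)) + ereal N"
        using V[OF y(1)] by (meson add_right_mono order_trans)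
      also have "\<dots> = ereal ((1 + \<eta>) * (v + e / (1 + \<eta>)) + N)" by simp
      also have "(1 + \<eta>) * (v + e / (1 + \<eta>)) + N = (1 + \<eta>) * v + N + e"
        using \<eta> by (simp add: field_simps)
      finally show ?thesis by (simp only: plus_ereal.simps)
    qed
    then have "W (x + \<xi>) \<le> ereal ((1 + \<eta>) * v + N)" by (rule ereal_le_epsilon2)
    then show ?thesis using real by (simp add: N_def)
  qed (use W_nonneg[of x] \<eta> in auto)
qed

end

section \<open>From the quadratic estimate to continuity\<close>

text \<open>What remains of the quadratic estimate after the choices \<open>\<eta> = d\<close>, which balances the two error
  terms, and \<open>\<eta> = 1\<close>, which bounds the unknown value by the known bound \<open>M\<close>.\<close>

definition modulus :: "real \<Rightarrow> real \<Rightarrow> real \<Rightarrow> real" where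
  "modulus M K d = d * (2 * M + K * (2 * d\<^sup>2 + d + 1))"

lemma modulus_bound:
  fixes v v' :: real
  assumes v: "0 \<le> v" "v \<le> M" and K: "0 \<le> K" and d: "0 \<le> d"
    and le1: "\<And>\<eta>. 0 < \<eta> \<Longrightarrow> v' \<le> (1 + \<eta>) * v + (1 + 1 / \<eta>) * (K * d\<^sup>2)"
    and le2: "\<And>\<eta>. 0 < \<eta> \<Longrightarrow> v \<le> (1 + \<eta>) * v' + (1 + 1 / \<eta>) * (K * d\<^sup>2)"
  shows "\<bar>v - v'\<bar> \<le> modulus M K d"
proof (cases "d = 0")
  (* Division by d is not possible, but now the second error term vanishes and \<eta> may tend to 0. *)
  case True
  have "a \<le> b" if "\<And>\<eta>. 0 < \<eta> \<Longrightarrow> a \<le> (1 + \<eta>) * b" for a b :: real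
  proof (rule field_le_epsilon)
    fix e :: real assume e: "0 < e"
    define \<eta> where "\<eta> = e / (\<bar>b\<bar> + 1)"
    have "0 < \<eta>" using e by (simp add: \<eta>_def)
    have "\<eta> * b \<le> \<eta> * (\<bar>b\<bar> + 1)" using \<open>0 < \<eta>\<close> by (intro mult_left_mono) auto
    also have "\<dots> = e" by (simp add: \<eta>_def)
    finally show "a \<le> b + e" using that[OF \<open>0 < \<eta>\<close>] by (simp add: distrib_right)
  qed
  then have "v' \<le> v" "v \<le> v'" using le1 le2 True by simp_all
  then show ?thesis using True by (simp add: modulus_def)
next
  case False
  then have d: "0 < d" using d by simp
  have two: "v' \<le> 2 * M + 2 * (K * d\<^sup>2)" using le1[of 1] v by simp
  have q: "(1 + 1 / d) * (K * d\<^sup>2) = K * (d\<^sup>2 + d)" using d by (simp add: power2_eq_square field_simps)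
  have "v' - v \<le> d * v + K * (d\<^sup>2 + d)" "v - v' \<le> d * v' + K * (d\<^sup>2 + d)"
    using le1[OF d] le2[OF d] unfolding q by (simp_all add: distrib_right)
  moreover have "d * v \<le> d * (2 * M + 2 * (K * d\<^sup>2))" "d * v' \<le> d * (2 * M + 2 * (K * d\<^sup>2))"
    using two v d K by (auto intro!: mult_left_mono add_increasing2)
  moreover have "d * (2 * M + 2 * (K * d\<^sup>2)) + K * (d\<^sup>2 + d) = modulus M K d"
    by (simp add: modulus_def power2_eq_square algebra_simps)
  ultimately show ?thesis by (simp add: abs_le_iff)
qed

lemma modulus_tendsto_0:
  assumes "(d \<longlongrightarrow> 0) F"
  shows "((\<lambda>n. modulus M K (d n)) \<longlongrightarrow> 0) F"
  unfolding modulus_def by (rule tendsto_eq_intros assms refl)+ simp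

text \<open>The common pattern of the statements about \<open>V\<close> and \<open>W\<close>: the value at
  a displaced point exceeds a multiple of the original value by at most a quadratic amount.\<close>

locale quadratic_displacement =
  fixes X :: "'a::ab_group_add set" and n :: "'a \<Rightarrow> real" and F :: "'a \<Rightarrow> ereal" and K :: real
  assumes X_diff: "x \<in> X \<Longrightarrow> y \<in> X \<Longrightarrow> x - y \<in> X"
    and n_nonneg: "0 \<le> n x" and n_minus: "n (x - y) = n (y - x)"
    and K: "0 \<le> K" and F_nonneg: "0 \<le> F x" and F_0: "F 0 = 0"
    and F_displaced: "q \<in> X \<Longrightarrow> 0 < \<eta> \<Longrightarrow> F (x + q) \<le> ereal (1 + \<eta>) * F x + ereal ((1 + 1 / \<eta>) * (K * (n q)\<^sup>2))"
begin

lemma bounded_by: "x \<in> X \<Longrightarrow> F x \<le> ereal (2 * K * (n x)\<^sup>2)"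
  using F_displaced[of x 1 0] by (simp add: F_0 mult.assoc)

lemma finite_on: "x \<in> X \<Longrightarrow> \<exists>v\<ge>0. F x = ereal v \<and> v \<le> 2 * K * (n x)\<^sup>2"
  using bounded_by[of x] F_nonneg[of x] by (cases "F x") auto

lemma maps_to: "F \<in> X \<rightarrow> {0..<\<infinity>}"
proof
  fix x assume "x \<in> X"
  from finite_on[OF this] show "F x \<in> {0..<\<infinity>}" by auto
qed

lemma difference_le:
  assumes x: "x \<in> X" "y \<in> X"
  shows "\<bar>F x - F y\<bar> \<le> ereal (modulus (2 * K * (n x)\<^sup>2) K (n (x - y)))"
proof -
  obtain v where v: "0 \<le> v" "F x = ereal v" "v \<le> 2 * K * (n x)\<^sup>2" using finite_on[OF x(1)] by blast
  obtain v' where v': "0 \<le> v'" "F y = ereal v'" using finite_on[OF x(2)] by blast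
  have "\<bar>v - v'\<bar> \<le> modulus (2 * K * (n x)\<^sup>2) K (n (x - y))"
  proof (rule modulus_bound[OF v(1,3) K n_nonneg])
    fix \<eta> :: real assume \<eta>: "0 < \<eta>"
    show "v' \<le> (1 + \<eta>) * v + (1 + 1 / \<eta>) * (K * (n (x - y))\<^sup>2)"
      using F_displaced[OF X_diff[OF x(2,1)] \<eta>, of x] v v' n_minus[of y x] by simp
    show "v \<le> (1 + \<eta>) * v' + (1 + 1 / \<eta>) * (K * (n (x - y))\<^sup>2)"
      using F_displaced[OF X_diff[OF x] \<eta>, of y] v v' by simp
  qed
  then show ?thesis using v v' by simp
qed

lemma continuous:
  assumes M: "Metric_space X (\<lambda>x y. n (x - y))"
  shows "continuous_map (Metric_space.mtopology X (\<lambda>x y. n (x - y))) euclidean F"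
proof -
  interpret Metric_space X "\<lambda>x y. n (x - y)" by fact
  show ?thesis
    unfolding continuous_map_from_metric
  proof (intro conjI ballI allI impI)
    show "F \<in> X \<rightarrow> topspace euclidean" by simp
    fix x U assume x: "x \<in> X" and U: "openin euclidean U \<and> F x \<in> U"
    obtain v where v: "F x = ereal v" using finite_on[OF x] by blast
    have "open (ereal -` U)"
      using U by (intro open_vimage) (auto intro!: continuous_on_ereal continuous_on_id)
    then obtain e where e: "e > 0" "\<And>v'. \<bar>v' - v\<bar> < e \<Longrightarrow> ereal v' \<in> U"
      using U v by (force simp: open_real)
    have "((\<lambda>d. modulus (2 * K * (n x)\<^sup>2) K d) \<longlongrightarrow> 0) (at_right 0)"
      by (intro modulus_tendsto_0 tendsto_ident_at)
    from order_tendstoD(2)[OF this e(1)] obtain r where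
      r: "r > 0" "\<And>d. 0 < d \<Longrightarrow> d < r \<Longrightarrow> modulus (2 * K * (n x)\<^sup>2) K d < e"
      by (auto simp: eventually_at_right_field)
    have "F y \<in> U" if y: "y \<in> X" "n (x - y) < r" for y
    proof -
      obtain v' where v': "F y = ereal v'" using finite_on[OF y(1)] by blast
      have "modulus (2 * K * (n x)\<^sup>2) K (n (x - y)) < e"
        using r(2)[of "n (x - y)"] n_nonneg[of "x - y"] y(2) e(1)
        by (cases "n (x - y) = 0") (auto simp: modulus_def)
      then have "\<bar>v' - v\<bar> < e" using difference_le[OF x y(1)] v v' by (simp add: abs_minus_commute)
      then show ?thesis using e(2) v' by simp
    qed
    then show "\<exists>r>0. \<forall>y. y \<in> X \<and> n (x - y) < r \<longrightarrow> F y \<in> U" using r(1) by blast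
  qed
qed

end

lemma uniform_convergence:
  fixes F :: "real \<Rightarrow> 'a::ab_group_add \<Rightarrow> ereal"
  assumes F: "\<And>\<mu>. \<mu> \<in> I \<Longrightarrow> quadratic_displacement X n (F \<mu>) K" and I: "I \<noteq> {}"
    and x: "x \<in> X" "\<And>j. xn j \<in> X" and lim: "(\<lambda>j. n (x - xn j)) \<longlonglongrightarrow> 0"
  shows "(\<lambda>j. SUP \<mu>\<in>I. \<bar>F \<mu> x - F \<mu> (xn j)\<bar>) \<longlonglongrightarrow> 0"
proof (rule tendsto_sandwich[OF _ _ tendsto_const])
  have "(\<lambda>j. ereal (modulus (2 * K * (n x)\<^sup>2) K (n (x - xn j)))) \<longlonglongrightarrow> ereal 0"
    by (intro tendsto_ereal modulus_tendsto_0 lim)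
  then show "(\<lambda>j. ereal (modulus (2 * K * (n x)\<^sup>2) K (n (x - xn j)))) \<longlonglongrightarrow> 0"
    by (simp add: zero_ereal_def)
  show "\<forall>\<^sub>F j in sequentially. (SUP \<mu>\<in>I. \<bar>F \<mu> x - F \<mu> (xn j)\<bar>) \<le> ereal (modulus (2 * K * (n x)\<^sup>2) K (n (x - xn j)))"
    by (intro always_eventually allI SUP_least quadratic_displacement.difference_le[OF F] x)
  obtain \<mu> where "\<mu> \<in> I" using I by blast
  then show "\<forall>\<^sub>F j in sequentially. 0 \<le> (SUP \<mu>\<in>I. \<bar>F \<mu> x - F \<mu> (xn j)\<bar>)"
    by (intro always_eventually allI SUP_upper2) auto
qed


section \<open>The operator \<open>Q\<close>\<close>

lemma filterlim_powr_at_top: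
  fixes a :: real
  assumes "0 < a"
  shows "filterlim (\<lambda>x. x powr a) at_top at_top"
proof -
  have "filterlim (\<lambda>x. exp (a * ln x)) at_top at_top"
    by (intro filterlim_compose[OF exp_at_top] filterlim_tendsto_pos_mult_at_top[OF tendsto_const assms] ln_at_top)
  moreover have "\<forall>\<^sub>F x in at_top. exp (a * ln x) = x powr a"
    using eventually_gt_at_top[of 0] by eventually_elim (simp add: powr_def)
  ultimately show ?thesis using filterlim_cong[OF refl refl] by fast
qed

context spectrum
begin

lemma hs_truncation:
  assumes x: "x \<in> hs \<alpha> \<delta>"
  shows "(\<lambda>n. hs_norm \<alpha> \<delta> (\<lambda>k. if k < n then 0 else x k)) \<longlonglongrightarrow> 0"
    and "(\<lambda>k. if k < n then 0 else x k) \<in> hs \<alpha> \<delta>"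
proof -
  let ?r = "\<lambda>n k. if k < n then 0 else x k"
  define a where "a k = \<alpha> k powr \<delta> * (x k)\<^sup>2" for k
  have sm: "a summable_on UNIV" using x by (simp add: hs_def a_def[abs_def])
  have mem: "?r n \<in> hs \<alpha> \<delta>" for n
    by (rule hs_dominated(1)[of _ _ _ a]) (auto simp: a_def intro: sm)
  then show "?r n \<in> hs \<alpha> \<delta>" .
  have eq: "(hs_norm \<alpha> \<delta> (?r n))\<^sup>2 = (hs_norm \<alpha> \<delta> x)\<^sup>2 - (\<Sum>k<n. a k)" for n
  proof -
    have s: "(\<lambda>k. a k - (if k < n then a k else 0)) sums ((hs_norm \<alpha> \<delta> x)\<^sup>2 - (\<Sum>k<n. a k))"
    proof (rule sums_diff)
      show "a sums (hs_norm \<alpha> \<delta> x)\<^sup>2" using hs_norm_sq_sums[OF x] by (simp add: a_def[abs_def])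
      show "(\<lambda>k. if k < n then a k else 0) sums (\<Sum>k<n. a k)"
        using sums_If_finite_set[of "{..<n}" a] by simp
    qed
    have "(\<lambda>k. a k - (if k < n then a k else 0)) = (\<lambda>k. \<alpha> k powr \<delta> * (if k < n then 0 else x k)\<^sup>2)"
      by (auto simp: a_def)
    from s[unfolded this] show ?thesis by (rule sums_unique2[OF hs_norm_sq_sums[OF mem[of n]]])
  qed
  have "(\<lambda>n. \<Sum>k<n. a k) \<longlonglongrightarrow> (hs_norm \<alpha> \<delta> x)\<^sup>2"
    using hs_norm_sq_sums[OF x] by (simp add: sums_def a_def)
  then have "(\<lambda>n. (hs_norm \<alpha> \<delta> x)\<^sup>2 - (\<Sum>k<n. a k)) \<longlonglongrightarrow> (hs_norm \<alpha> \<delta> x)\<^sup>2 - (hs_norm \<alpha> \<delta> x)\<^sup>2"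
    by (intro tendsto_diff tendsto_const)
  then have "(\<lambda>n. (hs_norm \<alpha> \<delta> (?r n))\<^sup>2) \<longlonglongrightarrow> 0"
    unfolding eq by simp
  from tendsto_real_sqrt[OF this] show "(\<lambda>n. hs_norm \<alpha> \<delta> (?r n)) \<longlonglongrightarrow> 0"
    by (simp add: hs_norm_nonneg)
qed

text \<open>A bounded operator which is diagonal on the basis is diagonal: it is so on truncations, and the
  remainder is negligible.\<close>

lemma bounded_diagonal:
  assumes Q: "hs_bounded_linear \<alpha> 0 Q" and e: "\<And>k. Q (unit_coeffs k) = scl (lam k) (unit_coeffs k)"
    and x: "x \<in> hs \<alpha> 0"
  shows "Q x = (\<lambda>k. lam k * x k)"
proof -
  have lin: "\<And>x y. x \<in> hs \<alpha> 0 \<Longrightarrow> y \<in> hs \<alpha> 0 \<Longrightarrow> Q (x + y) = Q x + Q y" "\<And>a x. x \<in> hs \<alpha> 0 \<Longrightarrow> Q (scl a x) = scl a (Q x)"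
    and mem: "\<And>x. x \<in> hs \<alpha> 0 \<Longrightarrow> Q x \<in> hs \<alpha> 0"
    using Q unfolding hs_bounded_linear_def by blast+
  obtain C where C: "\<And>x. x \<in> hs \<alpha> 0 \<Longrightarrow> hs_norm \<alpha> 0 (Q x) \<le> C * hs_norm \<alpha> 0 x"
    using Q unfolding hs_bounded_linear_def by blast
  define h where "h n = (\<lambda>k. if k < n then x k else 0)" for n
  define r where "r n = (\<lambda>k. if k < n then 0 else x k)" for n
  have xhr: "x = h n + r n" for n by (auto simp: h_def r_def fun_eq_iff)
  have r: "r n \<in> hs \<alpha> 0" "(\<lambda>n. hs_norm \<alpha> 0 (r n)) \<longlonglongrightarrow> 0" for n
    using hs_truncation[OF x] by (simp_all add: r_def)
  have h: "h n \<in> hs \<alpha> 0 \<and> Q (h n) = (\<lambda>k. lam k * h n k)" for n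
  proof (induction n)
    case 0
    have "h 0 = scl 0 x" by (auto simp: h_def scl_def)
    then show ?case using lin(2)[OF x, of 0] by (auto simp: h_def scl_def hs_zero[unfolded zero_fun_def])
  next
    case (Suc n)
    have eq: "h (Suc n) = h n + scl (x n) (unit_coeffs n)"
      by (auto simp: h_def scl_def unit_coeffs_def fun_eq_iff less_Suc_eq)
    have u: "scl (x n) (unit_coeffs n) \<in> hs \<alpha> 0" by (intro hs_scl unit_coeffs_mem)
    have "Q (h (Suc n)) = Q (h n) + scl (x n) (Q (unit_coeffs n))"
      unfolding eq using Suc u by (simp add: lin unit_coeffs_mem)
    also have "\<dots> = (\<lambda>k. lam k * h n k) + scl (x n) (scl (lam n) (unit_coeffs n))"
      using Suc by (simp only: e)
    also have "\<dots> = (\<lambda>k. lam k * h (Suc n) k)"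
      by (auto simp: h_def scl_def unit_coeffs_def fun_eq_iff less_Suc_eq)
    finally have "Q (h (Suc n)) = (\<lambda>k. lam k * h (Suc n) k)" .
    moreover have "h (Suc n) \<in> hs \<alpha> 0" unfolding eq by (rule hs_add[OF conjunct1[OF Suc] u])
    ultimately show ?case by blast
  qed
  show ?thesis
  proof
    fix k
    have "\<bar>Q x k - lam k * x k\<bar> \<le> C * hs_norm \<alpha> 0 (r n)" if "k < n" for n
    proof -
      have "Q (h n + r n) = Q (h n) + Q (r n)" using h r(1) by (intro lin(1)) auto
      then have "Q x = Q (h n) + Q (r n)" by (simp only: xhr[symmetric])
      then have "Q x k - lam k * x k = Q (r n) k" using h that by (simp add: h_def)
      moreover have "\<bar>Q (r n) k\<bar> \<le> hs_norm \<alpha> 0 (Q (r n))"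
        using hs_coord_0_le[OF mem[OF r(1)], of n k] by (simp add: abs_le_square_iff[symmetric] hs_norm_nonneg)
      ultimately show ?thesis using C[OF r(1), of n] by simp
    qed
    moreover have "(\<lambda>n. C * hs_norm \<alpha> 0 (r n)) \<longlonglongrightarrow> 0" by (intro tendsto_mult_right_zero r(2))
    ultimately have "\<bar>Q x k - lam k * x k\<bar> \<le> 0"
      by (intro LIMSEQ_le_const[of "\<lambda>n. C * hs_norm \<alpha> 0 (r n)"]) (auto intro!: exI[of _ "Suc k"])
    then show "Q x k = lam k * x k" by simp
  qed
qed

text \<open>Boundedness of \<open>Q\<close> on \<open>H\<close> and \<open>\<alpha>\<^sub>k \<rightarrow> \<infinity>\<close> leave no room for a negative \<open>\<beta>\<close>.\<close>

lemma exponent_nonneg: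
  assumes Q: "hs_bounded_linear \<alpha> 0 Q" and e: "\<And>k. Q (unit_coeffs k) = scl (lam k) (unit_coeffs k)"
    and c: "c > 0" and lam: "\<And>k. 1 / c * \<alpha> k powr (- \<beta>) \<le> lam k" and lim: "filterlim \<alpha> at_top sequentially"
  shows "0 \<le> \<beta>"
proof (rule ccontr)
  assume "\<not> 0 \<le> \<beta>"
  then have b: "0 < - \<beta>" by simp
  obtain C where C: "\<And>x. x \<in> hs \<alpha> 0 \<Longrightarrow> hs_norm \<alpha> 0 (Q x) \<le> C * hs_norm \<alpha> 0 x"
    using Q unfolding hs_bounded_linear_def by blast
  have unit: "hs_norm \<alpha> 0 (unit_coeffs k) = 1" for k
  proof -
    have eq: "(\<lambda>j. \<alpha> j powr 0 * (unit_coeffs k j)\<^sup>2) = (\<lambda>j. if j = k then 1 else 0)"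
      by (auto simp: unit_coeffs_def)
    have "(hs_norm \<alpha> 0 (unit_coeffs k))\<^sup>2 = 1"
      using hs_norm_sq_sums[OF unit_coeffs_mem, of 0 k] sums_single[of k "\<lambda>_. 1::real"]
      unfolding eq by (rule sums_unique2)
    then show ?thesis using hs_norm_nonneg[of \<alpha> 0 "unit_coeffs k"] by (simp add: power2_eq_1_iff)
  qed
  have "\<alpha> k powr (- \<beta>) \<le> c * C" for k
  proof -
    have "lam k \<le> \<bar>lam k\<bar> * hs_norm \<alpha> 0 (unit_coeffs k)" by (simp add: unit)
    also have "\<dots> \<le> C" using C[OF unit_coeffs_mem, of k] by (simp add: e hs_scl unit)
    finally have "c * lam k \<le> c * C" using c by (intro mult_left_mono) auto
    moreover have "\<alpha> k powr (- \<beta>) \<le> c * lam k" using lam[of k] c by (simp add: field_simps)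
    ultimately show ?thesis by linarith
  qed
  moreover have "filterlim (\<lambda>k. \<alpha> k powr (- \<beta>)) at_top sequentially"
    by (rule filterlim_compose[OF filterlim_powr_at_top[OF b] lim])
  then have "\<forall>\<^sub>F k in sequentially. c * C + 1 \<le> \<alpha> k powr (- \<beta>)" by (simp add: filterlim_at_top)
  then obtain k where "c * C + 1 \<le> \<alpha> k powr (- \<beta>)" by (auto simp: eventually_sequentially)
  ultimately show False by (smt (verit))
qed

end

lemma filterlim_bigtheta_at_top:
  fixes f g :: "nat \<Rightarrow> real"
  assumes f: "f \<in> \<Theta>(g)" and pos: "\<And>k. 0 < f k" and g: "filterlim g at_top sequentially"
  shows "filterlim f at_top sequentially"
proof -
  from bigthetaD2[OF f] have "f \<in> \<Omega>(g)" .
  then obtain C where C: "C > 0" "\<forall>\<^sub>F k in sequentially. norm (f k) \<ge> C * norm (g k)"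
    by (rule landau_omega.bigE)
  have "filterlim (\<lambda>k. C * g k) at_top sequentially"
    by (rule filterlim_tendsto_pos_mult_at_top[OF tendsto_const C(1) g])
  then show ?thesis
  proof (rule filterlim_at_top_mono)
    show "\<forall>\<^sub>F k in sequentially. C * g k \<le> f k"
      using C(2)
    proof eventually_elim
      case (elim k)
      have "C * g k \<le> C * norm (g k)" using C(1) by (intro mult_left_mono) auto
      then show ?case using elim pos[of k] by simp
    qed
  qed
qed

theorem theorem6p3:
  fixes D :: "(real^'d) set"
    and e :: "nat \<Rightarrow> real^'d \<Rightarrow> real"
    and \<alpha> lam :: "nat \<Rightarrow> real"
    and Q B :: "coeffs \<Rightarrow> coeffs"
    and DB :: "coeffs \<Rightarrow> coeffs \<Rightarrow> coeffs"
    and \<gamma> :: "real \<Rightarrow> real"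
    and c \<beta> :: real
    and S :: "real \<Rightarrow> real \<Rightarrow> phase \<Rightarrow> phase"
  assumes D: "open D" "connected D" "D \<noteq> {}" "bounded D"
    and basis: "complete_orthonormal_basis D e"
    and eigen: "\<And>k. dirichlet_laplacian D (e k) (\<lambda>x. - \<alpha> k * e k x)"
    and alpha: "0 < \<alpha> 0" "mono \<alpha>"
      "\<alpha> \<in> \<Theta>(\<lambda>k. real (Suc k) powr (2 / real CARD('d)))"
    and beta: "\<beta> > (real CARD('d) - 2) / 4"
    and Q: "hs_bounded_linear \<alpha> 0 Q" "\<And>k. Q (unit_coeffs k) = scl (lam k) (unit_coeffs k)"
    and lam: "c > 0" "\<And>k. 1 / c * \<alpha> k powr (- \<beta>) \<le> lam k \<and> lam k \<le> c * \<alpha> k powr (- \<beta>)"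
    and B_lipschitz: "\<And>\<delta>. \<delta> \<in> {0..1 + 2 * \<beta>} \<Longrightarrow> hs_lipschitz \<alpha> \<delta> (\<gamma> \<delta>) B \<and> \<gamma> \<delta> < \<alpha> 0"
    and B_zero: "B 0 = 0"
    and B_diff: "B \<in> hs \<alpha> (2 * \<beta>) \<rightarrow> hs \<alpha> (2 * \<beta>)"
      "\<And>x. x \<in> hs \<alpha> (2 * \<beta>) \<Longrightarrow> hs_has_derivative \<alpha> (2 * \<beta>) B (DB x) x"
      "(SUP x\<in>hs \<alpha> (2 * \<beta>). ereal (hs_opnorm \<alpha> (2 * \<beta>) (DB x))) = ereal (\<gamma> (2 * \<beta>))"
    and semigroup: "\<And>\<mu> \<delta>. \<mu> > 0 \<Longrightarrow>
      ph_semigroup_generated_by \<alpha> \<delta> (ph \<alpha> (1 + \<delta>)) (A_mu \<alpha> \<mu>) (S \<mu>)"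
  defines "V \<equiv> \<lambda>\<mu>. quasi_potential \<alpha> (S \<mu>) B Q \<mu>"
    and "W \<equiv> \<lambda>\<mu>. quasi_potential_pos \<alpha> (S \<mu>) B Q \<mu>"
  shows
    "(\<forall>\<mu>>0.
        V \<mu> \<in> ph \<alpha> (1 + 2 * \<beta>) \<rightarrow> {0..<\<infinity>} \<and>
        continuous_map (ph_topology \<alpha> (1 + 2 * \<beta>)) euclidean (V \<mu>) \<and>
        W \<mu> \<in> hs \<alpha> (1 + 2 * \<beta>) \<rightarrow> {0..<\<infinity>} \<and>
        continuous_map (hs_topology \<alpha> (1 + 2 * \<beta>)) euclidean (W \<mu>)) \<and>
     (\<forall>p pn. p \<in> ph \<alpha> (1 + 2 * \<beta>) \<longrightarrow> (\<forall>n. pn n \<in> ph \<alpha> (1 + 2 * \<beta>)) \<longrightarrow>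
        (\<lambda>n. ph_norm \<alpha> (1 + 2 * \<beta>) (p - pn n)) \<longlonglongrightarrow> 0 \<longrightarrow>
        (\<lambda>n. SUP \<mu>\<in>{0<..<1}. \<bar>V \<mu> p - V \<mu> (pn n)\<bar>) \<longlonglongrightarrow> 0) \<and>
     (\<forall>x xn. x \<in> hs \<alpha> (1 + 2 * \<beta>) \<longrightarrow> (\<forall>n. xn n \<in> hs \<alpha> (1 + 2 * \<beta>)) \<longrightarrow>
        (\<lambda>n. hs_norm \<alpha> (1 + 2 * \<beta>) (x - xn n)) \<longlonglongrightarrow> 0 \<longrightarrow>
        (\<lambda>n. SUP \<mu>\<in>{0<..<1}. \<bar>W \<mu> x - W \<mu> (xn n)\<bar>) \<longlonglongrightarrow> 0)"
proof -
  let ?P = "ph \<alpha> (1 + 2 * \<beta>)" and ?p = "ph_norm \<alpha> (1 + 2 * \<beta>)"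
    and ?H = "hs \<alpha> (1 + 2 * \<beta>)" and ?h = "hs_norm \<alpha> (1 + 2 * \<beta>)"
  have spec: "spectrum \<alpha>" using alpha(1,2) by unfold_locales
  interpret spectrum \<alpha> by (rule spec)
  have "filterlim (\<lambda>k. real (Suc k) powr (2 / real CARD('d))) at_top sequentially"
    by (intro filterlim_compose[OF filterlim_powr_at_top] filterlim_compose[OF filterlim_real_sequentially filterlim_Suc]) auto
  then have "filterlim \<alpha> at_top sequentially"
    by (rule filterlim_bigtheta_at_top[OF alpha(3) \<alpha>_pos])
  then have \<beta>: "0 \<le> \<beta>"
    using lam by (intro exponent_nonneg[OF Q lam(1)]) auto
  have lip: "hs_lipschitz \<alpha> \<delta> (\<gamma> \<delta>) B" if "0 \<le> \<delta>" "\<delta> \<le> 2 * \<beta>" for \<delta>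
    using B_lipschitz[of \<delta>] that by simp
  have wave: "controlled_wave \<alpha> \<mu> (S \<mu>) B Q lam c \<beta> \<gamma>" if \<mu>: "0 < \<mu>" for \<mu>
    by unfold_locales (use \<mu> semigroup \<beta> lam bounded_diagonal[OF Q] lip B_zero in auto)
  define K where "K \<mu> = controlled_wave.cost_factor \<alpha> \<mu> c \<beta> \<gamma>" for \<mu>
  (* The constant does not see \<mu> below 1: this is where the uniformity in \<mu> comes from. *)
  have K_small: "K \<mu> = K 1" if "\<mu> \<in> {0<..<1}" for \<mu>
  proof -
    have "wave_semigroup.m \<mu> = wave_semigroup.m 1"
      using that wave_semigroup.m_def[OF controlled_wave.axioms(1)[OF wave]] by simp
    then show ?thesis
      using that unfolding K_def by (simp add: controlled_wave.cost_factor_def[OF wave])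
  qed
  have V: "quadratic_displacement ?P ?p (V \<mu>) (K \<mu>)" if \<mu>: "0 < \<mu>" for \<mu>
  proof -
    interpret controlled_wave \<alpha> \<mu> "S \<mu>" B Q lam c \<beta> \<gamma> by (rule wave[OF \<mu>])
    show ?thesis
      unfolding V_def K_def
      by unfold_locales (auto simp: ph_norm_diff_commute cost_factor_nonneg V_nonneg V_0 intro: ph_diff V_displaced)
  qed
  have W: "quadratic_displacement ?H ?h (W \<mu>) (K \<mu>)" if \<mu>: "0 < \<mu>" for \<mu>
  proof -
    interpret controlled_wave \<alpha> \<mu> "S \<mu>" B Q lam c \<beta> \<gamma> by (rule wave[OF \<mu>])
    show ?thesis
      unfolding W_def K_def
      by unfold_locales (auto simp: hs_norm_diff_commute hs_norm_nonneg cost_factor_nonneg W_nonneg W_0 intro: hs_diff W_displaced)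
  qed
  have ne: "{0<..<1::real} \<noteq> {}" by simp
  have V1: "quadratic_displacement ?P ?p (V \<mu>) (K 1)"
    and W1: "quadratic_displacement ?H ?h (W \<mu>) (K 1)" if "\<mu> \<in> {0<..<1}" for \<mu>
    using V[of \<mu>] W[of \<mu>] K_small[OF that] that by simp_all
  show ?thesis
  proof (intro conjI allI impI)
    fix \<mu> :: real assume \<mu>: "0 < \<mu>"
    show "V \<mu> \<in> ?P \<rightarrow> {0..<\<infinity>}" by (rule quadratic_displacement.maps_to[OF V[OF \<mu>]])
    show "W \<mu> \<in> ?H \<rightarrow> {0..<\<infinity>}" by (rule quadratic_displacement.maps_to[OF W[OF \<mu>]])
    show "continuous_map (ph_topology \<alpha> (1 + 2 * \<beta>)) euclidean (V \<mu>)"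
      unfolding ph_topology_def
      by (rule quadratic_displacement.continuous[OF V[OF \<mu>] Metric_space_ph[OF \<alpha>_pos]])
    show "continuous_map (hs_topology \<alpha> (1 + 2 * \<beta>)) euclidean (W \<mu>)"
      unfolding hs_topology_def
      by (rule quadratic_displacement.continuous[OF W[OF \<mu>] Metric_space_hs[OF \<alpha>_pos]])
  next
    fix p pn
    assume "p \<in> ?P" "\<forall>n. pn n \<in> ?P" "(\<lambda>n. ?p (p - pn n)) \<longlonglongrightarrow> 0"
    then show "(\<lambda>n. SUP \<mu>\<in>{0<..<1}. \<bar>V \<mu> p - V \<mu> (pn n)\<bar>) \<longlonglongrightarrow> 0"
      by (intro uniform_convergence[OF V1 ne]) auto
  next
    fix x xn
    assume "x \<in> ?H" "\<forall>n. xn n \<in> ?H" "(\<lambda>n. ?h (x - xn n)) \<longlonglongrightarrow> 0"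
    then show "(\<lambda>n. SUP \<mu>\<in>{0<..<1}. \<bar>W \<mu> x - W \<mu> (xn n)\<bar>) \<longlonglongrightarrow> 0"
      by (intro uniform_convergence[OF W1 ne]) auto
  qed
qed

end
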